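(* Consider the optimal control problem of minimizing a final cost $g^0(t_f,x(t_f))$, $x=(r,v,m)$, for the control system $$\dot r=v,\qquad \dot v=-\frac{D(r,v)}{m}\frac{v}{\Vert v\Vert}-g(r)+C\frac{u}{m},\qquad \dot m=-b\Vert u\Vert,\qquad \Vert u(t)\Vert\le 1,$$ with initial conditions $r(0)=r_0$, $v(0)=v_0$, $m(0)=m_0$ and final condition $x(t_f)\in M_1$, the final time $t_f$ being free or not. Assume that either the final mass $m(t_f)$ is free and $\frac{\partial g^0}{\partial m}\neq 0$, or the final time $t_f$ is free and $\frac{\partial g^0}{\partial t}\neq 0$. Let $u$ be an optimal control defined on $[0,t_f]$, associated to the trajectory $(r(\cdot),v(\cdot),m(\cdot))$; degenerate extremals are excluded, i.e. the extremal associated with $u$ by the Pontryagin Maximum Principle is assumed nondegenerate (see context). Then there exist absolutely continuous mappings $p_r:[0,t_f]\to\mathbb{R}^3$, $p_v:[0,t_f]\to\mathbb{R}^3$, $p_m:[0,t_f]\to\mathbb{R}$ and a real number $p^0\le 0$, such that $(p_r(\cdot),p_v(\cdot),p_m(\cdot),p^0)$ is nontrivial, and such that a.e. on $[0,t_f]$ $$\begin{aligned} \dot p_r&=\frac1m\frac{\langle p_v,v\rangle}{\Vert v\Vert}\frac{\partial D}{\partial r}+\Big\langle p_v,\frac{\partial g}{\partial r}\Big\rangle,\\ \dot p_v&=-p_r+\frac1m\frac{\langle p_v,v\rangle}{\Vert v\Vert}\frac{\partial D}{\partial v}+\frac Dm\frac{p_v}{\Vert v\Vert}-\frac Dm\langle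 p_v,v\rangle\frac{v}{\Vert v\Vert^3},\\ \dot p_m&=\frac1m\Big\langle p_v,-\frac{D(r,v)}{m}\frac{v}{\Vert v\Vert}+C\frac um\Big\rangle . \end{aligned}$$ Define the switching function $\Psi$ on $[0,t_f]$ by $$\Psi(t)=\frac{C}{m(t)}\Vert p_v(t)\Vert-b\,p_m(t).$$ Then, for almost every $t\in[0,t_f]$: 1. if $\Psi(t)<0$ then $u(t)=0$; 2. if $\Psi(t)>0$ then $u(t)=\frac{p_v(t)}{\Vert p_v(t)\Vert}$; and moreover: 3. if $\Psi(t)=0$ on a subset $I\subset[0,t_f]$ of positive Lebesgue measure, then the equation $$\dot\Psi(t)=\Xi(r(t),v(t),m(t),p(t))=0$$ must hold (almost everywhere) on $I$, and $$u(t)=\alpha(t)\frac{p_v(t)}{\Vert p_v(t)\Vert}\quad\text{a.e. on } I,$$ where $\alpha(t)\in[0,1]$ is determined by the relation $$A(r,v,m,p_r,p_v,p_m)\,\alpha=B(r,v,m,p_r,p_v,p_m)\quad\text{a.e. on } I,$$ which is the relation $\ddot\Psi=0$ written with $u=\alpha\,p_v/\Vert p_v\Vert$. The functions $\Xi$, $A$, $B$ are described in the context.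
   Context: Setting. $\Vert\cdot\Vert$ and $\langle\cdot,\cdot\rangle$ are the Euclidean norm and scalar product of $\mathbb{R}^3$. The state is $x=(r,v,m)\in\mathbb{R}^3\times\mathbb{R}^3\times\mathbb{R}$: position, velocity and mass of a spacecraft. $D(r,v)>0$ is the drag and $g(r)\in\mathbb{R}^3$ the gravity, both mappings being of class $C^1$; $b>0$ and $C>0$ are constants. Controls are measurable functions with values in the closed unit ball of $\mathbb{R}^3$. The cost $g^0=g^0(t,x)$ is real-valued of class $C^1$, and the target is $M_1\subset\mathbb{R}^7$; that the final mass is free means $M_1=N_1\times\mathbb{R}$ with $N_1\subset\mathbb{R}^6$. $\partial D/\partial r$ and $\partial D/\partial v$ are gradients, and $\langle p_v,\partial g/\partial r\rangle$ is the gradient with respect to $r$ of $\langle p_v,g(r)\rangle$ for fixed $p_v$. Extremals. The Hamiltonian is $$H=\langle p_r,v\rangle+\Big\langle p_v,-\frac{D(r,v)}{m}\frac{v}{\Vert v\Vert}-g(r)+C\frac um\Big\rangle-p_m b\Vert u\Vert,\qquad p=(p_r,p_v,p_m).$$ The Pontryagin Maximum Principle associates with an optimal control $u$ an absolutely continuous $p(\cdot)$ and a real $p^0\le0$, with $(p(\cdot),p^0)$ nontrivial, such that a.e. $\dot p=-\partial H/\partial x$ (the adjoint equations in the claim) and $u(t)$ maximizes $H(x(t),p(t),w)$ over $\Vert w\Vert\le1$; the maximum is constant in $t$, and equals $-p^0\frac{\partial g^0}{\partial t}(t_f,x(t_f))$ if $t_f$ is free; and, when $M_1$ is a submanifold,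 $p(t_f)-p^0\frac{\partial g^0}{\partial x}(t_f,x(t_f))\perp T_{x(t_f)}M_1$. The extremal is called degenerate if $p_r(t)=p_v(t)=0$ for every $t\in[0,t_f]$. The function $\Xi$. It is the expression of $\dot\Psi$ along the extremal when $u=\alpha\,p_v/\Vert p_v\Vert$ with $\alpha\geq 0$, and does not depend on $u$: $$\Xi(r,v,m,p)=\frac{Db}{m^2\Vert v\Vert}\langle p_v,v\rangle+\frac{C}{m\Vert p_v\Vert}\Big(-\langle p_v,p_r\rangle+\frac{\langle p_v,v\rangle}{m\Vert v\Vert}\Big\langle\frac{\partial D}{\partial v},p_v\Big\rangle+\frac{D\Vert p_v\Vert^2}{m\Vert v\Vert}-\frac Dm\frac{\langle p_v,v\rangle^2}{\Vert v\Vert^3}\Big).$$ The functions $A$, $B$. Since $\Psi$, and then $\dot\Psi=\Xi$, vanish on $I$, one differentiates once more and obtains $\ddot\Psi=0$ a.e. on $I$. Replacing the derivatives of the state and of $p$ by the right-hand sides of the state and adjoint equations with $u=\alpha\,p_v/\Vert p_v\Vert$, $\Vert u\Vert=\alpha$, this becomes an equation affine in $\alpha$, of the form $A\alpha=B$ with $A,B$ functions of $(r,v,m,p_r,p_v,p_m)$. Their lengthy explicit expressions are not given. The relation is expected to be generically nontrivial, i.e. $A\neq0$ (this is argued by analogy with the scalar-control case and checked numerically, not proved for this system).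
   Formalization: Since D is only of class C^1, A, B and the second derivative of Ψ need not exist; the relation Aα=B (i.e. Ψ''=0) is asserted at almost every t in I at which ∂D/∂v is differentiable at (r(t),v(t)), which is automatic for D of class C^2. *)

theory Defs
  imports "HOL-Analysis.Analysis"
begin

text \<open>\<open>C1_on f S\<close> is meant for open sets \<open>S\<close>.\<close>

definition C1_on :: "('a::real_normed_vector \<Rightarrow> 'b::real_normed_vector) \<Rightarrow> 'a set \<Rightarrow> bool" where
  "C1_on f S \<longleftrightarrow>
     (\<exists>f'. (\<forall>x\<in>S. (f has_derivative blinfun_apply (f' x)) (at x)) \<and> continuous_on S f')"

definition gradient :: "('a::real_inner \<Rightarrow> real) \<Rightarrow> 'a \<Rightarrow> 'a" where
  "gradient f x = (THE d. GDERIV f x :> d)"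

text \<open>The members of a division are compact intervals with disjoint interiors, so this is
  the usual \<open>\<epsilon>\<close>-\<open>\<delta>\<close> condition on finite families of nonoverlapping intervals.\<close>

definition abs_continuous_on :: "(real \<Rightarrow> 'a::real_normed_vector) \<Rightarrow> real set \<Rightarrow> bool" where
  "abs_continuous_on f J \<longleftrightarrow>
     (\<forall>\<epsilon>>0. \<exists>\<delta>>0. \<forall>d. d division_of \<Union>d \<and> \<Union>d \<subseteq> J \<and> (\<Sum>k\<in>d. Sup k - Inf k) < \<delta> \<longrightarrow>
        (\<Sum>k\<in>d. norm (f (Sup k) - f (Inf k))) < \<epsilon>)"

definition C1_submanifold :: "'a::euclidean_space set \<Rightarrow> bool" where
  "C1_submanifold M \<longleftrightarrow>
     (\<exists>n. \<forall>x\<in>M. \<exists>U V \<phi> \<psi> E. open U \<and> x \<in> U \<and> open V \<and>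
        homeomorphism U V \<phi> \<psi> \<and> C1_on \<phi> U \<and> C1_on \<psi> V \<and>
        subspace E \<and> dim E = n \<and> \<phi> ` (M \<inter> U) = V \<inter> (E :: 'a set))"

definition tangent_space :: "'a::euclidean_space set \<Rightarrow> 'a \<Rightarrow> 'a set" where
  "tangent_space M x =
     {w. \<exists>\<gamma> \<epsilon>. 0 < \<epsilon> \<and> \<gamma> C1_differentiable_on {-\<epsilon><..<\<epsilon>} \<and> \<gamma> ` {-\<epsilon><..<\<epsilon>} \<subseteq> M \<and>
        \<gamma> 0 = x \<and> (\<gamma> has_vector_derivative w) (at 0)}"

text \<open>A state is \<open>(r, v, m)\<close>; a costate is \<open>(p\<^sub>r, p\<^sub>v, p\<^sub>m)\<close>. The drag term is singular at
  \<open>v = 0\<close> and at \<open>m = 0\<close>, so trajectories live in the open set \<open>state_space Q\<close>, where the open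
  set \<open>Q\<close> of positions is the domain of the gravity field (for instance \<open>UNIV\<close>, or the
  complement of the origin for a central field).\<close>

type_synonym vec3 = "real ^ 3"
type_synonym state = "vec3 \<times> vec3 \<times> real"

definition state_space :: "vec3 set \<Rightarrow> state set" where
  "state_space Q = {(r, v, m). r \<in> Q \<and> v \<noteq> 0 \<and> 0 < m}"

fun dynamics :: "(vec3 \<Rightarrow> vec3 \<Rightarrow> real) \<Rightarrow> (vec3 \<Rightarrow> vec3) \<Rightarrow> real \<Rightarrow> real \<Rightarrow>
    state \<Rightarrow> vec3 \<Rightarrow> state" where
  "dynamics D g b C (r, v, m) u =
     (v,
      - (D r v / m) *\<^sub>R (v /\<^sub>R norm v) - g r + C *\<^sub>R (u /\<^sub>R m),
      - b * norm u)"

definition admissible :: "(vec3 \<Rightarrow> vec3 \<Rightarrow> real) \<Rightarrow> (vec3 \<Rightarrow> vec3) \<Rightarrow> real \<Rightarrow> real \<Rightarrow>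
    vec3 set \<Rightarrow> state \<Rightarrow> state set \<Rightarrow> real \<Rightarrow> (real \<Rightarrow> vec3) \<Rightarrow> (real \<Rightarrow> state) \<Rightarrow> bool" where
  "admissible D g b C Q x\<^sub>0 M\<^sub>1 T u x \<longleftrightarrow>
     0 < T \<and>
     u \<in> borel_measurable (lebesgue_on {0..T}) \<and> (\<forall>t\<in>{0..T}. norm (u t) \<le> 1) \<and>
     abs_continuous_on x {0..T} \<and> (\<forall>t\<in>{0..T}. x t \<in> state_space Q) \<and>
     (AE t in lebesgue_on {0..T}. (x has_vector_derivative dynamics D g b C (x t) (u t)) (at t)) \<and>
     x 0 = x\<^sub>0 \<and> x T \<in> M\<^sub>1"

text \<open>If \<open>free_time\<close> is false, only competitors with the same final time are considered.\<close>

definition optimal :: "(vec3 \<Rightarrow> vec3 \<Rightarrow> real) \<Rightarrow> (vec3 \<Rightarrow> vec3) \<Rightarrow> real \<Rightarrow> real \<Rightarrow>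
    vec3 set \<Rightarrow> state \<Rightarrow> state set \<Rightarrow> bool \<Rightarrow> (real \<Rightarrow> state \<Rightarrow> real) \<Rightarrow>
    real \<Rightarrow> (real \<Rightarrow> vec3) \<Rightarrow> (real \<Rightarrow> state) \<Rightarrow> bool" where
  "optimal D g b C Q x\<^sub>0 M\<^sub>1 free_time g0 T u x \<longleftrightarrow>
     admissible D g b C Q x\<^sub>0 M\<^sub>1 T u x \<and>
     (\<forall>T' u' x'. admissible D g b C Q x\<^sub>0 M\<^sub>1 T' u' x' \<and> (free_time \<or> T' = T) \<longrightarrow>
        g0 T (x T) \<le> g0 T' (x' T'))"

definition free_final_mass :: "state set \<Rightarrow> bool" where
  "free_final_mass M\<^sub>1 \<longleftrightarrow> (\<exists>N\<^sub>1. M\<^sub>1 = {(r, v, m). (r, v) \<in> N\<^sub>1})"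

fun hamiltonian :: "(vec3 \<Rightarrow> vec3 \<Rightarrow> real) \<Rightarrow> (vec3 \<Rightarrow> vec3) \<Rightarrow> real \<Rightarrow> real \<Rightarrow>
    state \<Rightarrow> state \<Rightarrow> vec3 \<Rightarrow> real" where
  "hamiltonian D g b C (r, v, m) (p\<^sub>r, p\<^sub>v, p\<^sub>m) u =
     p\<^sub>r \<bullet> v + p\<^sub>v \<bullet> (- (D r v / m) *\<^sub>R (v /\<^sub>R norm v) - g r + C *\<^sub>R (u /\<^sub>R m)) - p\<^sub>m * b * norm u"

text \<open>The conclusion of the maximum principle. The last condition is the mass component of
  transversality; it needs no regularity of \<open>N\<^sub>1\<close> when \<open>M\<^sub>1 = N\<^sub>1 \<times> \<real>\<close>, since \<open>x\<close> remains optimal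
  for the smaller target \<open>{(r T, v T)} \<times> \<real>\<close>.\<close>

definition pmp_extremal :: "(vec3 \<Rightarrow> vec3 \<Rightarrow> real) \<Rightarrow> (vec3 \<Rightarrow> vec3) \<Rightarrow> real \<Rightarrow> real \<Rightarrow>
    state set \<Rightarrow> bool \<Rightarrow> (real \<Rightarrow> state \<Rightarrow> real) \<Rightarrow>
    real \<Rightarrow> (real \<Rightarrow> vec3) \<Rightarrow> (real \<Rightarrow> state) \<Rightarrow> (real \<Rightarrow> state) \<Rightarrow> real \<Rightarrow> bool" where
  "pmp_extremal D g b C M\<^sub>1 free_time g0 T u x p p0 \<longleftrightarrow>
     abs_continuous_on p {0..T} \<and> p0 \<le> 0 \<and> \<not> ((\<forall>t\<in>{0..T}. p t = 0) \<and> p0 = 0) \<and>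
     (AE t in lebesgue_on {0..T}.
        (p has_vector_derivative - gradient (\<lambda>y. hamiltonian D g b C y (p t) (u t)) (x t)) (at t)) \<and>
     (AE t in lebesgue_on {0..T}. \<forall>w\<in>cball 0 1.
        hamiltonian D g b C (x t) (p t) w \<le> hamiltonian D g b C (x t) (p t) (u t)) \<and>
     (\<exists>h. (\<forall>t\<in>{0..T}. (SUP w\<in>cball 0 1. hamiltonian D g b C (x t) (p t) w) = h) \<and>
          (free_time \<longrightarrow> h = - p0 * deriv (\<lambda>s. g0 s (x T)) T)) \<and>
     (C1_submanifold M\<^sub>1 \<longrightarrow>
        (\<forall>w\<in>tangent_space M\<^sub>1 (x T). (p T - p0 *\<^sub>R gradient (g0 T) (x T)) \<bullet> w = 0)) \<and>
     (free_final_mass M\<^sub>1 \<longrightarrow>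
        snd (snd (p T - p0 *\<^sub>R gradient (g0 T) (x T))) = 0)"

fun adjoint_r :: "(vec3 \<Rightarrow> vec3 \<Rightarrow> real) \<Rightarrow> (vec3 \<Rightarrow> vec3) \<Rightarrow> state \<Rightarrow> state \<Rightarrow> vec3" where
  "adjoint_r D g (r, v, m) (p\<^sub>r, p\<^sub>v, p\<^sub>m) =
     ((1 / m) * ((p\<^sub>v \<bullet> v) / norm v)) *\<^sub>R gradient (\<lambda>y. D y v) r + gradient (\<lambda>y. p\<^sub>v \<bullet> g y) r"

fun adjoint_v :: "(vec3 \<Rightarrow> vec3 \<Rightarrow> real) \<Rightarrow> state \<Rightarrow> state \<Rightarrow> vec3" where
  "adjoint_v D (r, v, m) (p\<^sub>r, p\<^sub>v, p\<^sub>m) =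
     - p\<^sub>r + ((1 / m) * ((p\<^sub>v \<bullet> v) / norm v)) *\<^sub>R gradient (D r) v
     + (D r v / m) *\<^sub>R (p\<^sub>v /\<^sub>R norm v) - ((D r v / m) * (p\<^sub>v \<bullet> v)) *\<^sub>R (v /\<^sub>R norm v ^ 3)"

fun adjoint_m :: "(vec3 \<Rightarrow> vec3 \<Rightarrow> real) \<Rightarrow> real \<Rightarrow> state \<Rightarrow> state \<Rightarrow> vec3 \<Rightarrow> real" where
  "adjoint_m D C (r, v, m) (p\<^sub>r, p\<^sub>v, p\<^sub>m) u =
     (1 / m) * (p\<^sub>v \<bullet> (- (D r v / m) *\<^sub>R (v /\<^sub>R norm v) + C *\<^sub>R (u /\<^sub>R m)))"

definition extremal_rhs :: "(vec3 \<Rightarrow> vec3 \<Rightarrow> real) \<Rightarrow> (vec3 \<Rightarrow> vec3) \<Rightarrow> real \<Rightarrow> real \<Rightarrow>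
    state \<times> state \<Rightarrow> vec3 \<Rightarrow> state \<times> state" where
  "extremal_rhs D g b C z u =
     (dynamics D g b C (fst z) u,
      (adjoint_r D g (fst z) (snd z), adjoint_v D (fst z) (snd z), adjoint_m D C (fst z) (snd z) u))"

definition switching :: "real \<Rightarrow> real \<Rightarrow> (real \<Rightarrow> real) \<Rightarrow> (real \<Rightarrow> vec3) \<Rightarrow> (real \<Rightarrow> real) \<Rightarrow>
    real \<Rightarrow> real" where
  "switching b C m p\<^sub>v p\<^sub>m t = C / m t * norm (p\<^sub>v t) - b * p\<^sub>m t"

fun Xi :: "(vec3 \<Rightarrow> vec3 \<Rightarrow> real) \<Rightarrow> real \<Rightarrow> real \<Rightarrow> state \<times> state \<Rightarrow> real" where
  "Xi D b C ((r, v, m), (p\<^sub>r, p\<^sub>v, p\<^sub>m)) =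
     D r v * b / (m\<^sup>2 * norm v) * (p\<^sub>v \<bullet> v)
     + C / (m * norm p\<^sub>v) *
       (- (p\<^sub>v \<bullet> p\<^sub>r) + (p\<^sub>v \<bullet> v) / (m * norm v) * (gradient (D r) v \<bullet> p\<^sub>v)
        + D r v * (norm p\<^sub>v)\<^sup>2 / (m * norm v) - D r v / m * (p\<^sub>v \<bullet> v)\<^sup>2 / norm v ^ 3)"

text \<open>Along an extremal with \<open>u = \<alpha> p\<^sub>v / \<parallel>p\<^sub>v\<parallel>\<close>, \<open>\<alpha> \<ge> 0\<close>, the state and adjoint equations are
  affine in \<open>\<alpha>\<close> (lemma \<open>extremal_rhs_affine\<close>). By the chain rule the time derivative of \<open>Xi\<close>,
  i.e. the second derivative of the switching function, is the differential of \<open>Xi\<close> applied to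
  this right-hand side, hence \<open>sing_A * \<alpha> - sing_B\<close>.\<close>

fun thrust_dir :: "state \<times> state \<Rightarrow> vec3" where
  "thrust_dir (x, (p\<^sub>r, p\<^sub>v, p\<^sub>m)) = p\<^sub>v /\<^sub>R norm p\<^sub>v"

definition sing_A :: "(vec3 \<Rightarrow> vec3 \<Rightarrow> real) \<Rightarrow> (vec3 \<Rightarrow> vec3) \<Rightarrow> real \<Rightarrow> real \<Rightarrow>
    state \<times> state \<Rightarrow> real" where
  "sing_A D g b C z = frechet_derivative (Xi D b C) (at z)
     (extremal_rhs D g b C z (thrust_dir z) - extremal_rhs D g b C z 0)"

definition sing_B :: "(vec3 \<Rightarrow> vec3 \<Rightarrow> real) \<Rightarrow> (vec3 \<Rightarrow> vec3) \<Rightarrow> real \<Rightarrow> real \<Rightarrow>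
    state \<times> state \<Rightarrow> real" where
  "sing_B D g b C z = - frechet_derivative (Xi D b C) (at z) (extremal_rhs D g b C z 0)"

lemma extremal_rhs_affine:
  assumes "0 \<le> \<alpha>"
  shows "extremal_rhs D g b C z (\<alpha> *\<^sub>R thrust_dir z) =
    extremal_rhs D g b C z 0
    + \<alpha> *\<^sub>R (extremal_rhs D g b C z (thrust_dir z) - extremal_rhs D g b C z 0)"
proof -
  obtain r v m pr pv pm where z: "z = ((r, v, m), (pr, pv, pm))"
    by (metis prod.exhaust)
  show ?thesis
    unfolding z extremal_rhs_def
    using assms by (simp add: algebra_simps inner_simps)
qed

end

theory Submission
  imports Defs
begin

text \<open>No extremal with all the conditions of the maximum principle has to be constructed: a costate
  with \<open>(p\<^sub>r, p\<^sub>v) \<noteq> 0\<close> that satisfies the adjoint equation and the maximum condition suffices for the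
  conclusion. If \<open>u = 0\<close> almost everywhere, the constant costate \<open>(0, 0, 1)\<close> does. Otherwise, if no such
  costate exists, needle variations, a rescaling of time and Brouwer's fixed point theorem show that
  every direction \<open>(\<delta>t, \<delta>r, \<delta>v, \<delta>m)\<close> with \<open>\<delta>m + b \<delta>t > 0\<close> can be reached exactly, and every direction
  at all unless \<open>\<parallel>u\<parallel> = 1\<close> almost everywhere. Optimality then makes the differential of the cost
  nonnegative on the reachable tangential directions. This contradicts the assumption on the partial
  derivatives of the cost, or it makes the constant costate \<open>(0, 0, - c)\<close> with suitable \<open>c > 0\<close> a
  degenerate extremal, which is excluded.

  Along a nondegenerate costate \<open>p\<^sub>v\<close> vanishes only on a null set: at almost every zero the derivative
  \<open>- p\<^sub>r\<close> of \<open>p\<^sub>v\<close> vanishes as well, and the equation for \<open>(p\<^sub>r, p\<^sub>v)\<close> is linear homogeneous. Maximizing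
  the Hamiltonian gives the form of \<open>u\<close>. Almost every point of a set is one of its limit points,
  so \<open>\<Psi> = 0\<close> on \<open>I\<close> yields \<open>\<Xi> = 0\<close>, and then the relation \<open>A \<alpha> = B\<close>, almost everywhere on \<open>I\<close>.\<close>

subsection \<open>Absolutely continuous functions and indefinite integrals\<close>

text \<open>The exceptional half-space has a concrete meaning. Since m' >= - b along every
  trajectory, m(T') + b T' >= m(0), with equality exactly for full thrust almost everywhere. So when
  \<open>norm u = 1\<close> almost everywhere, the directions with \<delta>m + b \<delta>t < 0 are
  truly out of reach. The nondegeneracy hypothesis speaks only of extremals that satisfy every
  condition of the maximum principle, including transversality and the value of the maximized
  Hamiltonian, whereas a separating hyperplane yields a costate for one direction only. Hence a
  degenerate normal cannot be used as it stands: the missing conditions are read off from the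
  directions that are reachable. The target is an arbitrary set, so approximate reachability is
  worthless. Points of a curve inside it must be hit exactly, which is why the variations need
  coefficients that depend continuously on a parameter. The costates delivered have
  \<open>p0 = 0\<close>, nontriviality being carried by p itself; \<open>p0 = - 1\<close> occurs
  only in the extremal used for the contradiction. The multiplier \<alpha> is the norm of u.\<close>

lemma AE_lebesgue_on_iff_negligible:
  assumes "S \<in> sets lebesgue"
  shows "(AE t in lebesgue_on S. P t) \<longleftrightarrow> (\<exists>N. negligible N \<and> (\<forall>t\<in>S - N. P t))"
proof -
  have "(AE t in lebesgue_on S. P t) \<longleftrightarrow> (AE t in lebesgue. t \<in> S \<longrightarrow> P t)"
    using assms by (simp add: AE_restrict_space_iff)
  also have "\<dots> \<longleftrightarrow> (\<exists>N\<in>null_sets lebesgue. {t. \<not> (t \<in> S \<longrightarrow> P t)} \<subseteq> N)"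
    by (auto simp: eventually_ae_filter)
  also have "\<dots> \<longleftrightarrow> (\<exists>N. negligible N \<and> (\<forall>t\<in>S - N. P t))"
    unfolding negligible_iff_null_sets by blast
  finally show ?thesis .
qed

lemma negligible_outer_open:
  fixes N :: "real set"
  assumes "negligible N" "0 < e"
  obtains G where "open G" "N \<subseteq> G" "G \<in> lmeasurable" "measure lebesgue G < e"
proof -
  have N: "N \<in> sets lebesgue" "emeasure lebesgue N = 0"
    using assms negligible_iff_null_sets by auto
  obtain G where G: "open G" "N \<subseteq> G" "G - N \<in> lmeasurable" "emeasure lebesgue (G - N) < ennreal e"
    using sets_lebesgue_outer_open[OF N(1) assms(2)] .
  have GN: "G = (G - N) \<union> N" using G by auto
  have Gm: "G \<in> lmeasurable"
    using G(3) assms(1) negligible_imp_measurable GN by (metis fmeasurable.Un)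
  have "measure lebesgue G \<le> measure lebesgue (G - N) + measure lebesgue N"
    by (subst GN, rule measure_Un_le) (use N G(3) in auto)
  also have "\<dots> = measure lebesgue (G - N)"
    using assms(1) negligible_imp_measure0 by simp
  also have "\<dots> < e"
    using G(3,4) assms(2) by (simp add: emeasure_eq_measure2 ennreal_less_iff)
  finally show ?thesis using that G Gm by blast
qed

lemma abs_continuous_onE:
  assumes "abs_continuous_on f J" "0 < e"
  obtains \<delta> where "0 < \<delta>" "\<And>D. D division_of \<Union>D \<Longrightarrow> \<Union>D \<subseteq> J \<Longrightarrow>
      (\<Sum>k\<in>D. Sup k - Inf k) < \<delta> \<Longrightarrow> (\<Sum>k\<in>D. norm (f (Sup k) - f (Inf k))) < e"
proof -
  have "\<exists>\<delta>>0. \<forall>D. D division_of \<Union>D \<and> \<Union>D \<subseteq> J \<and>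
      (\<Sum>k\<in>D. Sup k - Inf k) < \<delta> \<longrightarrow> (\<Sum>k\<in>D. norm (f (Sup k) - f (Inf k))) < e"
    using assms(1)[unfolded abs_continuous_on_def, THEN spec, THEN mp, OF assms(2)] .
  then obtain \<delta> where "0 < \<delta>" and "\<forall>D. D division_of \<Union>D \<and> \<Union>D \<subseteq> J \<and>
      (\<Sum>k\<in>D. Sup k - Inf k) < \<delta> \<longrightarrow> (\<Sum>k\<in>D. norm (f (Sup k) - f (Inf k))) < e"
    by (elim exE conjE) (rule that)
  then show ?thesis by (intro that[of \<delta>]) simp_all
qed

text \<open>The gauge treats two regions differently. Outside \<open>N\<close> it is the radius of
  differentiability; on \<open>N\<close> it is an open set of such small measure that absolute
  continuity bounds the total increment over the intervals tagged there.\<close>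

lemma abs_continuous_on_imp_has_integral:
  fixes f :: "real \<Rightarrow> 'a::banach"
  assumes ac: "abs_continuous_on f {a..b}" and "a \<le> b" and N: "negligible N"
    and f': "\<And>t. t \<in> {a..b} - N \<Longrightarrow> (f has_vector_derivative f' t) (at t within {a..b})"
  shows "(f' has_integral (f b - f a)) {a..b}"
proof -
  \<comment> \<open>Zero on \<open>N\<close>: the Riemann terms tagged there vanish and leave only
    increments of \<open>f\<close>.\<close>
  define g where "g t = (if t \<in> N then 0 else f' t)" for t
  have "(g has_integral (f b - f a)) {a..b}"
    unfolding has_integral_real
  proof (intro allI impI)
    fix e :: real assume "0 < e"
    \<comment> \<open>Half of \<open>e\<close> is spent on the tags outside \<open>N\<close>; the 1
      covers the case a = b.\<close>
    define e' where "e' = e / (2 * (b - a + 1))"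
    have e': "0 < e'" using \<open>0 < e\<close> \<open>a \<le> b\<close> by (simp add: e'_def)
    have "\<forall>t. \<exists>d>0. t \<in> {a..b} - N \<longrightarrow>
        (\<forall>y\<in>{a..b}. norm (y - t) < d \<longrightarrow> norm (f y - f t - (y - t) *\<^sub>R f' t) \<le> e' * norm (y - t))"
      using f' e' unfolding has_vector_derivative_def has_derivative_within_alt by blast
    then obtain d where d0: "\<And>t. 0 < d t" and d: "\<And>t y. t \<in> {a..b} - N \<Longrightarrow> y \<in> {a..b} \<Longrightarrow>
        norm (y - t) < d t \<Longrightarrow> norm (f y - f t - (y - t) *\<^sub>R f' t) \<le> e' * norm (y - t)"
      by metis
    obtain \<delta> where \<delta>: "0 < \<delta>" and ac\<delta>: "\<And>D. D division_of \<Union>D \<Longrightarrow> \<Union>D \<subseteq> {a..b} \<Longrightarrow>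
        (\<Sum>k\<in>D. Sup k - Inf k) < \<delta> \<Longrightarrow> (\<Sum>k\<in>D. norm (f (Sup k) - f (Inf k))) < e / 2"
      by (rule abs_continuous_onE[OF ac half_gt_zero[OF \<open>0 < e\<close>]]) (rule that)
    obtain G where G: "open G" "N \<subseteq> G" "G \<in> lmeasurable" "measure lebesgue G < \<delta>"
      using negligible_outer_open[OF N \<delta>] .
    define \<gamma> where "\<gamma> t = (if t \<in> N then G else ball t (d t))" for t
    have "gauge \<gamma>"
      using G d0 by (auto simp: gauge_def \<gamma>_def)
    moreover have "norm ((\<Sum>(x,K)\<in>p. measure lborel K *\<^sub>R g x) - (f b - f a)) < e"
      if p: "p tagged_division_of {a..b}" and fine: "\<gamma> fine p" for p
    proof -
      define q where "q = {xk \<in> p. fst xk \<in> N}"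
      have finp: "finite p" using p by blast
      have q_sub: "q \<subseteq> p" by (auto simp: q_def)
      have K: "\<exists>u v. K = {u..v} \<and> u \<le> v \<and> x \<in> {u..v} \<and> u \<in> {a..b} \<and> v \<in> {a..b} \<and> K \<subseteq> {a..b}"
        if xK: "(x, K) \<in> p" for x K
      proof -
        obtain u v where uv: "K = cbox u v" using tagged_division_ofD(4)[OF p xK] by blast
        have "x \<in> K" "K \<subseteq> {a..b}" using tagged_division_ofD(2,3)[OF p xK] by blast+
        then show ?thesis using uv by (intro exI[of _ u] exI[of _ v]) auto
      qed
      note add = additive_tagged_division_1[OF \<open>a \<le> b\<close> p]
      have 1: "(\<Sum>xk\<in>q. norm (f (Sup (snd xk)) - f (Inf (snd xk)))) < e / 2"
      proof -
        have pq: "q tagged_division_of \<Union>(snd ` q)"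
          using p q_sub by (meson tagged_division_of_def tagged_partial_division_of_Union_self tagged_partial_division_subset)
        have div: "snd ` q division_of \<Union>(snd ` q)"
          using pq by (rule division_of_tagged_division)
        have "(\<Sum>k\<in>snd ` q. Sup k - Inf k) = (\<Sum>k\<in>snd ` q. measure lebesgue k)"
        proof (rule sum.cong[OF refl])
          fix k assume "k \<in> snd ` q"
          then obtain x where "(x, k) \<in> p" using q_sub by auto
          from K[OF this] show "Sup k - Inf k = measure lebesgue k" by auto
        qed
        also have "\<dots> = measure lebesgue (\<Union>(snd ` q))"
          using content_division[OF div] by simp
        also have "\<dots> \<le> measure lebesgue G"
        proof (rule measure_mono_fmeasurable)
          show "\<Union>(snd ` q) \<subseteq> G"
            using fine unfolding fine_def q_def \<gamma>_def by fastforce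
          show "\<Union>(snd ` q) \<in> sets lebesgue"
            using div lmeasurable_division by blast
        qed (rule G)
        also have "\<dots> < \<delta>" by (rule G)
        finally have "(\<Sum>k\<in>snd ` q. Sup k - Inf k) < \<delta>" .
        moreover have "\<Union>(snd ` q) \<subseteq> {a..b}"
          using K q_sub by fastforce
        ultimately have "(\<Sum>k\<in>snd ` q. norm (f (Sup k) - f (Inf k))) < e / 2"
          by (intro ac\<delta> div)
        \<comment> \<open>Passing from intervals to tagged pairs needs a summand that is zero on
          degenerate intervals. \<open>Sup\<close> and \<open>Inf\<close> of the empty set have no
          useful value, hence the conditional.\<close>
        also have "(\<Sum>k\<in>snd ` q. norm (f (Sup k) - f (Inf k)))
            = (\<Sum>k\<in>snd ` q. if k = {} then 0 else norm (f (Sup k) - f (Inf k)))"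
          using K q_sub by (intro sum.cong) fastforce+
        also have "\<dots> = (\<Sum>(x,k)\<in>q. if k = {} then 0 else norm (f (Sup k) - f (Inf k)))"
        proof (rule sum.over_tagged_division_lemma[OF pq, symmetric])
          fix u v :: real assume "box u v = {}"
          then have "cbox u v = {} \<or> u = v" by auto
          then show "(if cbox u v = {} then 0 else norm (f (Sup (cbox u v)) - f (Inf (cbox u v)))) = 0"
            by auto
        qed
        also have "\<dots> = (\<Sum>(x,k)\<in>q. norm (f (Sup k) - f (Inf k)))"
          using K q_sub by (intro sum.cong) fastforce+
        finally show ?thesis by (simp add: case_prod_unfold)
      qed
      have 2: "norm (measure lborel (snd xk) *\<^sub>R g (fst xk) - (f (Sup (snd xk)) - f (Inf (snd xk))))
          \<le> e' * (Sup (snd xk) - Inf (snd xk))" if xk: "xk \<in> p - q" for xk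
      proof -
        obtain x k where xk_eq: "xk = (x, k)" by fastforce
        have xk_p: "(x, k) \<in> p" and "x \<notin> N" using xk by (auto simp: q_def xk_eq)
        obtain u v where uv: "k = {u..v}" "u \<le> v" "x \<in> {u..v}" "u \<in> {a..b}" "v \<in> {a..b}"
          using K[OF xk_p] by blast
        have x: "x \<in> {a..b} - N" using uv \<open>x \<notin> N\<close> by auto
        have "k \<subseteq> ball x (d x)" using fineD[OF fine xk_p] \<open>x \<notin> N\<close> by (simp add: \<gamma>_def)
        moreover have "u \<in> k" "v \<in> k" using uv by auto
        ultimately have "u \<in> ball x (d x)" "v \<in> ball x (d x)" by blast+
        then have "norm (u - x) < d x" "norm (v - x) < d x"
          by (simp_all add: dist_norm norm_minus_commute)
        then have "norm (f u - f x - (u - x) *\<^sub>R f' x) \<le> e' * norm (u - x)"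
          "norm (f v - f x - (v - x) *\<^sub>R f' x) \<le> e' * norm (v - x)"
          using d[OF x uv(4)] d[OF x uv(5)] by blast+
        moreover have "(v - u) *\<^sub>R f' x - (f v - f u)
            = (f u - f x - (u - x) *\<^sub>R f' x) - (f v - f x - (v - x) *\<^sub>R f' x)"
          by (simp add: algebra_simps)
        ultimately have "norm ((v - u) *\<^sub>R f' x - (f v - f u)) \<le> e' * norm (u - x) + e' * norm (v - x)"
          using norm_triangle_ineq4 by (smt (verit))
        also have "\<dots> = e' * (v - u)" using uv by (simp add: algebra_simps)
        finally show ?thesis using uv \<open>x \<notin> N\<close> by (simp add: xk_eq g_def)
      qed
      have fb: "f b - f a = (\<Sum>xk\<in>p. f (Sup (snd xk)) - f (Inf (snd xk)))"
        using add[of f] by (simp add: case_prod_unfold)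
      have "(\<Sum>(x,K)\<in>p. measure lborel K *\<^sub>R g x) - (f b - f a)
          = (\<Sum>xk\<in>p. measure lborel (snd xk) *\<^sub>R g (fst xk) - (f (Sup (snd xk)) - f (Inf (snd xk))))"
        unfolding fb case_prod_unfold by (rule sum_subtractf[symmetric])
      also have "\<dots> = (\<Sum>xk\<in>p - q. measure lborel (snd xk) *\<^sub>R g (fst xk) - (f (Sup (snd xk)) - f (Inf (snd xk))))
          + (\<Sum>xk\<in>q. measure lborel (snd xk) *\<^sub>R g (fst xk) - (f (Sup (snd xk)) - f (Inf (snd xk))))"
        by (rule sum.subset_diff[OF q_sub finp])
      finally have "norm ((\<Sum>(x,K)\<in>p. measure lborel K *\<^sub>R g x) - (f b - f a))
          \<le> norm (\<Sum>xk\<in>p - q. measure lborel (snd xk) *\<^sub>R g (fst xk) - (f (Sup (snd xk)) - f (Inf (snd xk))))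
          + norm (\<Sum>xk\<in>q. measure lborel (snd xk) *\<^sub>R g (fst xk) - (f (Sup (snd xk)) - f (Inf (snd xk))))"
        by (simp add: norm_triangle_ineq)
      moreover have "norm (\<Sum>xk\<in>p - q. measure lborel (snd xk) *\<^sub>R g (fst xk) - (f (Sup (snd xk)) - f (Inf (snd xk)))) < e / 2"
      proof -
        have "norm (\<Sum>xk\<in>p - q. measure lborel (snd xk) *\<^sub>R g (fst xk) - (f (Sup (snd xk)) - f (Inf (snd xk))))
            \<le> (\<Sum>xk\<in>p - q. e' * (Sup (snd xk) - Inf (snd xk)))"
          by (rule sum_norm_le) (rule 2)
        also have "\<dots> \<le> (\<Sum>xk\<in>p. e' * (Sup (snd xk) - Inf (snd xk)))"
        proof (rule sum_mono2[OF finp])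
          fix xk assume "xk \<in> p - (p - q)"
          then obtain x k where "xk = (x, k)" "(x, k) \<in> p" by (cases xk) auto
          with K[of x k] show "0 \<le> e' * (Sup (snd xk) - Inf (snd xk))" using e' by auto
        qed auto
        also have "\<dots> = e' * (b - a)"
          using add[of "\<lambda>x. x"] by (simp add: sum_distrib_left[symmetric] case_prod_unfold)
        also have "\<dots> < e / 2" using \<open>0 < e\<close> \<open>a \<le> b\<close> by (simp add: e'_def field_simps)
        finally show ?thesis .
      qed
      moreover have "norm (\<Sum>xk\<in>q. measure lborel (snd xk) *\<^sub>R g (fst xk) - (f (Sup (snd xk)) - f (Inf (snd xk)))) < e / 2"
      proof -
        have "norm (\<Sum>xk\<in>q. measure lborel (snd xk) *\<^sub>R g (fst xk) - (f (Sup (snd xk)) - f (Inf (snd xk))))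
            \<le> (\<Sum>xk\<in>q. norm (f (Sup (snd xk)) - f (Inf (snd xk))))"
          by (rule sum_norm_le) (auto simp: q_def g_def norm_minus_commute)
        with 1 show ?thesis by linarith
      qed
      ultimately show ?thesis by linarith
    qed
    ultimately show "\<exists>\<gamma>. gauge \<gamma> \<and> (\<forall>p. p tagged_division_of {a..b} \<and> \<gamma> fine p \<longrightarrow>
        norm ((\<Sum>(x,K)\<in>p. measure lborel K *\<^sub>R g x) - (f b - f a)) < e)"
      by (intro exI[of _ \<gamma>]) simp
  qed
  then show ?thesis
    by (rule has_integral_spike[OF N, rotated]) (auto simp: g_def)
qed

lemma division_of_interval:
  assumes "D division_of \<Union>D" "(k :: real set) \<in> D"
  obtains u v where "k = {u..v}" "u \<le> v"
proof -
  obtain u v where "k = cbox u v" "k \<noteq> {}" using division_ofD(3,4)[OF assms] by blast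
  then show ?thesis by (intro that[of u v]) auto
qed

lemma lipschitz_on_imp_abs_continuous_on:
  fixes f :: "real \<Rightarrow> 'a::real_normed_vector"
  assumes "L-lipschitz_on J f"
  shows "abs_continuous_on f J"
  unfolding abs_continuous_on_def
proof (intro allI impI)
  fix e :: real assume "0 < e"
  have L: "0 \<le> L" using assms lipschitz_on_nonneg by blast
  show "\<exists>\<delta>>0. \<forall>d. d division_of \<Union>d \<and> \<Union>d \<subseteq> J \<and> (\<Sum>k\<in>d. Sup k - Inf k) < \<delta> \<longrightarrow>
      (\<Sum>k\<in>d. norm (f (Sup k) - f (Inf k))) < e"
  proof (intro exI[of _ "e / (L + 1)"] conjI allI impI)
    show "0 < e / (L + 1)" using \<open>0 < e\<close> L by simp
  next
    fix D assume D: "D division_of \<Union>D \<and> \<Union>D \<subseteq> J \<and> (\<Sum>k\<in>D. Sup k - Inf k) < e / (L + 1)"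
    have ge: "0 \<le> Sup k - Inf k \<and> norm (f (Sup k) - f (Inf k)) \<le> L * (Sup k - Inf k)" if kD: "k \<in> D" for k
    proof -
      obtain u v where uv: "k = {u..v}" "u \<le> v"
        using division_of_interval[OF conjunct1[OF D] kD] .
      then have "u \<in> J" "v \<in> J"
        using subsetD[OF conjunct1[OF conjunct2[OF D]] UnionI[OF kD]] by auto
      then show ?thesis
        using lipschitz_onD[OF assms, of v u] uv by (simp add: dist_norm)
    qed
    then have "(\<Sum>k\<in>D. norm (f (Sup k) - f (Inf k))) \<le> (\<Sum>k\<in>D. L * (Sup k - Inf k))"
      by (intro sum_mono) auto
    also have "\<dots> = L * (\<Sum>k\<in>D. Sup k - Inf k)" by (simp add: sum_distrib_left)
    also have "\<dots> \<le> (L + 1) * (\<Sum>k\<in>D. Sup k - Inf k)"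
      using ge by (intro mult_right_mono sum_nonneg) auto
    also have "\<dots> < e" using D L by (simp add: field_simps)
    finally show "(\<Sum>k\<in>D. norm (f (Sup k) - f (Inf k))) < e" .
  qed
qed

lemma abs_continuous_on_imp_continuous_on:
  fixes f :: "real \<Rightarrow> 'a::real_normed_vector"
  assumes "abs_continuous_on f {a..b}"
  shows "continuous_on {a..b} f"
  unfolding continuous_on_iff
proof (intro ballI allI impI)
  fix x e :: real assume x: "x \<in> {a..b}" and "0 < e"
  obtain \<delta> where \<delta>: "0 < \<delta>" and ac\<delta>: "\<And>D. D division_of \<Union>D \<Longrightarrow> \<Union>D \<subseteq> {a..b} \<Longrightarrow>
      (\<Sum>k\<in>D. Sup k - Inf k) < \<delta> \<Longrightarrow> (\<Sum>k\<in>D. norm (f (Sup k) - f (Inf k))) < e"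
    by (rule abs_continuous_onE[OF assms \<open>0 < e\<close>]) (rule that)
  have *: "norm (f v - f u) < e" if "u \<le> v" "u \<in> {a..b}" "v \<in> {a..b}" "v - u < \<delta>" for u v
    using ac\<delta>[of "{{u..v}}"] that division_of_self[of u v] by auto
  show "\<exists>d>0. \<forall>x'\<in>{a..b}. dist x' x < d \<longrightarrow> dist (f x') (f x) < e"
  proof (intro exI[of _ \<delta>] conjI \<delta> ballI impI)
    fix y assume "y \<in> {a..b}" "dist y x < \<delta>"
    then show "dist (f y) (f x) < e"
      using *[of x y] *[of y x] x by (cases "x \<le> y") (auto simp: dist_norm norm_minus_commute)
  qed
qed

text \<open>\<open>integrable_ccontinuous_explicit\<close> gives, almost everywhere, the limit of
  averages over [x, x + h] only. Applied to the reflected function it gives the left averages, and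
  both together the two-sided derivative.\<close>

lemma indefinite_integral_has_vector_derivative_AE:
  fixes f :: "real \<Rightarrow> 'a::euclidean_space"
  assumes f: "f integrable_on {a..b}"
  obtains N where "negligible N" "\<And>t. t \<in> {a..b} - N \<Longrightarrow> t \<in> {a<..<b}"
    "\<And>t. t \<in> {a..b} - N \<Longrightarrow> ((\<lambda>t. integral {a..t} f) has_vector_derivative f t) (at t)"
proof -
  \<comment> \<open>Extension by zero lets averages at points near the ends leave the
    interval.\<close>
  define g where "g t = (if t \<in> {a..b} then f t else 0)" for t
  have "g integrable_on UNIV" unfolding g_def[abs_def] integrable_restrict_UNIV by (rule f)
  then have g: "g integrable_on {c..d}" for c d
    by (metis integrable_on_subcbox top_greatest box_real(2))
  then have g1: "g integrable_on cbox c d" and g2: "(\<lambda>t. g (- t)) integrable_on cbox c d" for c d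
    using Henstock_Kurzweil_Integration.integrable_reflect_real[where f=g and b="-c" and a="-d"] g
      Henstock_Kurzweil_Integration.integrable_reflect_real[where f=g and b="-d" and a="-c"] by auto
  obtain N1 where N1: "negligible N1" and d1: "\<And>x e. x \<notin> N1 \<Longrightarrow> 0 < e \<Longrightarrow>
      \<exists>d>0. \<forall>h. 0 < h \<and> h < d \<longrightarrow> norm (integral {x..x + h} g /\<^sub>R h - g x) < e"
    using integrable_ccontinuous_explicit[OF g1] by auto
  obtain N2 where N2: "negligible N2" and d2: "\<And>x e. x \<notin> N2 \<Longrightarrow> 0 < e \<Longrightarrow>
      \<exists>d>0. \<forall>h. 0 < h \<and> h < d \<longrightarrow> norm (integral {x..x + h} (\<lambda>t. g (- t)) /\<^sub>R h - g (- x)) < e"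
    using integrable_ccontinuous_explicit[OF g2] by auto
  define N where "N = N1 \<union> uminus ` N2 \<union> {a, b}"
  have "negligible N"
    unfolding N_def using N1 N2
    by (intro negligible_Un negligible_differentiable_image_negligible) (auto intro!: differentiable_on_minus)
  moreover have "((\<lambda>t. integral {a..t} f) has_vector_derivative f t) (at t)" if t: "t \<in> {a..b} - N" for t
  proof -
    have t': "a < t" "t < b" "t \<notin> N1" "- t \<notin> N2" using t by (auto simp: N_def image_iff) 
    have "((\<lambda>y. integral {a..y} g) has_derivative (\<lambda>h. h *\<^sub>R g t)) (at t within UNIV)"
      unfolding has_derivative_within_alt
    proof (intro conjI allI impI)
      fix e :: real assume "0 < e"
      obtain d1' where d1': "0 < d1'" "\<And>h. 0 < h \<Longrightarrow> h < d1' \<Longrightarrow> norm (integral {t..t + h} g /\<^sub>R h - g t) < e"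
        using d1[OF t'(3) \<open>0 < e\<close>] by blast
      obtain d2' where d2': "0 < d2'" "\<And>h. 0 < h \<Longrightarrow> h < d2' \<Longrightarrow>
          norm (integral {-t..-t + h} (\<lambda>t. g (- t)) /\<^sub>R h - g t) < e"
        using d2[OF t'(4) \<open>0 < e\<close>] by auto
      show "\<exists>d>0. \<forall>y\<in>UNIV. norm (y - t) < d \<longrightarrow>
          norm (integral {a..y} g - integral {a..t} g - (y - t) *\<^sub>R g t) \<le> e * norm (y - t)"
      \<comment> \<open>The bound t - a keeps \<open>y\<close> to the right of \<open>a\<close>, so
        that the integrals from \<open>a\<close> are over adjacent intervals.\<close>
      proof (intro exI[of _ "min (min d1' d2') (t - a)"] conjI ballI impI)
        show "0 < min (min d1' d2') (t - a)" using d1' d2' t' by auto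
      next
        fix y assume y: "norm (y - t) < min (min d1' d2') (t - a)"
        consider "y = t" | "t < y" | "y < t" by linarith
        then show "norm (integral {a..y} g - integral {a..t} g - (y - t) *\<^sub>R g t) \<le> e * norm (y - t)"
        proof cases
          case 2
          define h where "h = y - t"
          have h: "0 < h" "h < d1'" "y = t + h" using 2 y by (auto simp: h_def)
          have "integral {a..y} g - integral {a..t} g = integral {t..y} g"
            using Henstock_Kurzweil_Integration.integral_combine[of a t y g] g 2 t' by (auto simp: algebra_simps)
          then have "integral {a..y} g - integral {a..t} g - (y - t) *\<^sub>R g t
              = h *\<^sub>R (integral {t..t + h} g /\<^sub>R h - g t)"
            using h by (simp add: algebra_simps)
          then show ?thesis using d1'(2)[OF h(1,2)] h
            by (simp add: mult.commute mult_left_mono less_imp_le)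
        next
          case 3
          define h where "h = t - y"
          have h: "0 < h" "h < d2'" "y = t - h" "a \<le> y" using 3 y by (auto simp: h_def)
          have "integral {a..t} g - integral {a..y} g = integral {y..t} g"
            using Henstock_Kurzweil_Integration.integral_combine[of a y t g] g 3 h by (auto simp: algebra_simps)
          also have "\<dots> = integral {-t..-t + h} (\<lambda>t. g (- t))"
            using Henstock_Kurzweil_Integration.integral_reflect_real[of t "t - h" g] unfolding h(3) by simp
          finally have "integral {a..y} g - integral {a..t} g - (y - t) *\<^sub>R g t
              = - h *\<^sub>R (integral {-t..-t + h} (\<lambda>t. g (- t)) /\<^sub>R h - g t)"
            using h(1) unfolding h(3) by (simp add: algebra_simps)
          then show ?thesis using d2'(2)[OF h(1,2)] h
            by (simp add: mult.commute mult_left_mono less_imp_le)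
        qed (use \<open>0 < e\<close> in auto)
      qed
    qed (intro bounded_linear_intros)
    then have "((\<lambda>y. integral {a..y} g) has_vector_derivative g t) (at t)"
      by (simp add: has_vector_derivative_def)
    then have "((\<lambda>y. integral {a..y} f) has_vector_derivative g t) (at t)"
    proof (rule has_vector_derivative_transform_within_open[where S="{a<..<b}"])
      fix y assume "y \<in> {a<..<b}"
      then show "integral {a..y} g = integral {a..y} f"
        by (intro integral_cong) (auto simp: g_def)
    qed (use t' in auto)
    then show ?thesis using t' by (simp add: g_def)
  qed
  moreover have "t \<in> {a<..<b}" if "t \<in> {a..b} - N" for t
    using that by (auto simp: N_def)
  ultimately show ?thesis using that by blast
qed

section \<open>Gronwall's inequality and differential equations with measurable time
  dependence\<close>

lemma gronwall:
  fixes \<phi> :: "real \<Rightarrow> real"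
  assumes cont: "continuous_on {0..T} \<phi>" and "0 \<le> L"
    and le: "\<And>t. t \<in> {0..T} \<Longrightarrow> \<phi> t \<le> c + L * integral {0..t} \<phi>"
    and t: "t \<in> {0..T}"
  shows "\<phi> t \<le> c * exp (L * t)"
proof -
  \<comment> \<open>Integrating factor: the hypothesis makes the derivative of \<open>h\<close>
    nonpositive, and \<open>h 0 = c\<close>.\<close>
  define h where "h s = exp (- L * s) * (c + L * integral {0..s} \<phi>)" for s
  have int: "\<phi> integrable_on {0..T}" using cont by (rule integrable_continuous_interval)
  have I: "continuous_on {0..T} (\<lambda>s. integral {0..s} \<phi>)"
    using int by (rule indefinite_integral_continuous_1)
  have "h t \<le> h 0"
  proof (cases "t = 0")
    case False
    show ?thesis
    proof (rule DERIV_nonpos_imp_decreasing_open[of 0 t h])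
      fix s assume s: "0 < s" "s < t"
      have "((\<lambda>s. integral {0..s} \<phi>) has_vector_derivative \<phi> s) (at s within {0..T})"
        using integral_has_vector_derivative[OF cont, of s] s t by auto
      then have "((\<lambda>s. integral {0..s} \<phi>) has_real_derivative \<phi> s) (at s)"
        using s t at_within_interior[of s "{0..T}"]
        by (auto simp: has_real_derivative_iff_has_vector_derivative)
      then have "(h has_real_derivative
          (exp (- L * s) * (- L)) * (c + L * integral {0..s} \<phi>) + exp (- L * s) * (L * \<phi> s)) (at s)"
        unfolding h_def by (auto intro!: derivative_eq_intros)
      moreover have "(exp (- L * s) * (- L)) * (c + L * integral {0..s} \<phi>) + exp (- L * s) * (L * \<phi> s)
          = exp (- L * s) * L * (\<phi> s - (c + L * integral {0..s} \<phi>))" by (simp add: algebra_simps)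
      moreover have "\<dots> \<le> 0"
        using le[of s] s t \<open>0 \<le> L\<close> by (intro mult_nonneg_nonpos) auto
      ultimately show "\<exists>y. (h has_real_derivative y) (at s) \<and> y \<le> 0" by metis
    next
      show "continuous_on {0..t} h"
        unfolding h_def using t by (intro continuous_intros continuous_on_subset[OF I]) auto
    qed (use t in auto)
  qed simp
  then have "exp (- L * t) * (c + L * integral {0..t} \<phi>) \<le> c" by (simp add: h_def)
  then have "c + L * integral {0..t} \<phi> \<le> c * exp (L * t)"
    by (simp add: exp_minus field_simps)
  then show ?thesis using le[OF t] by linarith
qed

text \<open>Gronwall for two solutions with a forcing error \<open>e\<close> of which only the
  integral counts. A large change of the control on a short needle is therefore harmless.\<close>

lemma integral_comparison:
  fixes y z :: "real \<Rightarrow> 'a::euclidean_space"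
  assumes y: "continuous_on {0..T} y" "\<And>t. t \<in> {0..T} \<Longrightarrow> (f has_integral (y t - c)) {0..t}"
    and z: "continuous_on {0..T} z" "\<And>t. t \<in> {0..T} \<Longrightarrow> (g has_integral (z t - c)) {0..t}"
    and "0 \<le> L"
    and le: "\<And>s. s \<in> {0..T} \<Longrightarrow> norm (f s - g s) \<le> L * norm (y s - z s) + e s"
    and e: "e integrable_on {0..T}" "\<And>s. s \<in> {0..T} \<Longrightarrow> 0 \<le> e s" "integral {0..T} e \<le> \<delta>"
    and t: "t \<in> {0..T}"
  shows "norm (y t - z t) \<le> \<delta> * exp (L * t)"
proof (rule gronwall[where \<phi> = "\<lambda>t. norm (y t - z t)", OF _ \<open>0 \<le> L\<close> _ t])
  show cont: "continuous_on {0..T} (\<lambda>t. norm (y t - z t))"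
    by (intro continuous_intros y z)
  fix t assume t: "t \<in> {0..T}"
  then have sub: "{0..t} \<subseteq> {0..T}" by auto
  have int: "(\<lambda>s. norm (y s - z s)) integrable_on {0..t}"
    using continuous_on_subset[OF cont sub] by (rule integrable_continuous_interval)
  have ie: "e integrable_on {0..t}" using integrable_subinterval_real[OF e(1) sub] .
  have I: "((\<lambda>s. f s - g s) has_integral (y t - z t)) {0..t}"
    using has_integral_diff[OF y(2)[OF t] z(2)[OF t]] by simp
  have "norm (y t - z t) = norm (integral {0..t} (\<lambda>s. f s - g s))"
    using I by (simp add: integral_unique)
  also have "\<dots> \<le> integral {0..t} (\<lambda>s. L * norm (y s - z s) + e s)"
    using le sub int ie I
    by (intro integral_norm_bound_integral integrable_add integrable_on_mult_right has_integral_integrable[OF I]) auto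
  also have "\<dots> = L * integral {0..t} (\<lambda>s. norm (y s - z s)) + integral {0..t} e"
    using integral_add[OF integrable_on_mult_right[OF int, of L] ie] by simp
  also have "integral {0..t} e \<le> integral {0..T} e"
    using e(2) by (intro integral_subset_le sub ie e(1)) auto
  finally show "norm (y t - z t) \<le> \<delta> + L * integral {0..t} (\<lambda>s. norm (y s - z s))"
    using e(3) by linarith
qed

text \<open>Measurability in time enters through \<open>int\<close>. The factorial bound on the
  increments of the Picard iterates is summable on all of \<open>{0..T}\<close>, so the interval is
  never subdivided.\<close>

lemma picard_lindelof_caratheodory:
  fixes F :: "real \<Rightarrow> 'a::euclidean_space \<Rightarrow> 'a"
  assumes "0 \<le> T" "0 \<le> L"
    and lip: "\<And>t y z. t \<in> {0..T} \<Longrightarrow> norm (F t y - F t z) \<le> L * norm (y - z)"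
    and int: "\<And>y. continuous_on {0..T} y \<Longrightarrow> (\<lambda>t. F t (y t)) integrable_on {0..T}"
    and bnd: "\<And>t. t \<in> {0..T} \<Longrightarrow> norm (F t c) \<le> M"
  obtains y where "continuous_on {0..T} y"
    "\<And>t. t \<in> {0..T} \<Longrightarrow> ((\<lambda>s. F s (y s)) has_integral (y t - c)) {0..t}"
proof -
  have "0 \<le> M" using bnd[of 0] \<open>0 \<le> T\<close> norm_ge_zero[of "F 0 c"] by (meson atLeastAtMost_iff order_trans order_refl)
  define Y where "Y = rec_nat (\<lambda>t. c) (\<lambda>_ y t. c + integral {0..t} (\<lambda>s. F s (y s)))"
  have Y0: "Y 0 = (\<lambda>t. c)" and YS: "Y (Suc n) = (\<lambda>t. c + integral {0..t} (\<lambda>s. F s (Y n s)))" for n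
    by (simp_all add: Y_def)
  have contY: "continuous_on {0..T} (Y n)" for n
    by (induction n) (auto simp: Y0 YS intro!: continuous_intros indefinite_integral_continuous_1 int)
  have intY: "(\<lambda>s. F s (Y n s)) integrable_on {0..t}" if "t \<in> {0..T}" for n t
    using that by (intro integrable_subinterval_real[OF int[OF contY]]) auto
  have step: "norm (Y (Suc n) t - Y n t) \<le> M * T * ((L * t) ^ n / fact n)" if "t \<in> {0..T}" for n t
    using that
  proof (induction n arbitrary: t)
    case 0
    have "norm (integral {0..t} (\<lambda>s. F s c)) \<le> integral {0..t} (\<lambda>s. M)"
      using 0 bnd intY[OF 0, of 0] by (intro integral_norm_bound_integral) (auto simp: Y0)
    also have "\<dots> = M * t" using 0 by simp
    also have "\<dots> \<le> M * T" using 0 \<open>0 \<le> M\<close> by (intro mult_left_mono) auto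
    finally show ?case by (simp add: Y0 YS)
  next
    case (Suc n)
    have *: "((\<lambda>s. L * (M * T * ((L * s) ^ n / fact n))) has_integral
        (M * T * ((L * t) ^ Suc n / fact (Suc n)) - M * T * ((L * 0) ^ Suc n / fact (Suc n)))) {0..t}"
    proof (rule fundamental_theorem_of_calculus)
      fix x
      have "((\<lambda>s. M * T * ((L * s) ^ Suc n / fact (Suc n))) has_real_derivative
         M * T * ((real (Suc n) * (L * x) ^ n * L) / fact (Suc n))) (at x within {0..t})"
        by (rule derivative_eq_intros refl | simp)+
      moreover have "M * T * ((real (Suc n) * (L * x) ^ n * L) / fact (Suc n)) = L * (M * T * ((L * x) ^ n / fact n))"
        by (simp add: field_simps del: of_nat_Suc)
      ultimately show "((\<lambda>s. M * T * ((L * s) ^ Suc n / fact (Suc n))) has_vector_derivative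
         L * (M * T * ((L * x) ^ n / fact n))) (at x within {0..t})"
        by (simp only: has_real_derivative_iff_has_vector_derivative)
    qed (use Suc in auto)
    have "norm (Y (Suc (Suc n)) t - Y (Suc n) t)
        = norm (integral {0..t} (\<lambda>s. F s (Y (Suc n) s) - F s (Y n s)))"
      using Suc.prems by (subst YS, subst (2) YS) (simp add: integral_diff intY)
    also have "\<dots> \<le> integral {0..t} (\<lambda>s. L * (M * T * ((L * s) ^ n / fact n)))"
    proof (rule integral_norm_bound_integral)
      fix s assume "s \<in> {0..t}"
      then have s: "s \<in> {0..T}" using Suc by auto
      show "norm (F s (Y (Suc n) s) - F s (Y n s)) \<le> L * (M * T * ((L * s) ^ n / fact n))"
        using lip[OF s] Suc.IH[OF s] \<open>0 \<le> L\<close> by (meson mult_left_mono order_trans)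
    qed (use Suc * in \<open>auto intro!: integrable_diff intY\<close>)
    also have "\<dots> = M * T * ((L * t) ^ Suc n / fact (Suc n))"
      using integral_unique[OF *] by simp
    finally show ?case .
  qed
  have bound: "norm (Y (Suc n) t - Y n t) \<le> M * T * ((L * T) ^ n / fact n)" if t: "t \<in> {0..T}" for n t
  proof -
    have "M * T * ((L * t) ^ n / fact n) \<le> M * T * ((L * T) ^ n / fact n)"
      using t \<open>0 \<le> L\<close> \<open>0 \<le> M\<close> \<open>0 \<le> T\<close>
      by (intro mult_left_mono divide_right_mono power_mono mult_nonneg_nonneg) auto
    then show ?thesis using step[OF t, of n] by linarith
  qed
  have "summable (\<lambda>n. M * T * ((L * T) ^ n / fact n))"
    using summable_exp[of "L * T"] by (intro summable_mult) (simp add: divide_inverse mult.commute)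
  then have ul: "uniform_limit {0..T} (\<lambda>n t. \<Sum>i<n. Y (Suc i) t - Y i t)
      (\<lambda>t. \<Sum>i. Y (Suc i) t - Y i t) sequentially"
    by (intro Weierstrass_m_test[OF bound])
  define y where "y t = c + (\<Sum>i. Y (Suc i) t - Y i t)" for t
  have Ysum: "Y n t = c + (\<Sum>i<n. Y (Suc i) t - Y i t)" for n t
    by (induction n) (simp_all add: Y0)
  have "uniform_limit {0..T} (\<lambda>n t. c + (\<Sum>i<n. Y (Suc i) t - Y i t)) y sequentially"
    unfolding y_def[abs_def] by (rule uniform_limit_add[OF uniform_limit_const[where c = "\<lambda>_. c"] ul])
  then have ulY: "uniform_limit {0..T} Y y sequentially"
    by (simp only: Ysum[symmetric])
  have conty: "continuous_on {0..T} y"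
    using contY ulY by (intro uniform_limit_theorem[OF _ ulY]) auto
  show ?thesis
  proof (rule that[OF conty])
    fix t assume t: "t \<in> {0..T}"
    then have sub: "{0..t} \<subseteq> {0..T}" by auto
    have inty: "(\<lambda>s. F s (y s)) integrable_on {0..t}"
      using integrable_subinterval_real[OF int[OF conty] sub] .
    have "(\<lambda>n. integral {0..t} (\<lambda>s. F s (Y n s))) \<longlonglongrightarrow> integral {0..t} (\<lambda>s. F s (y s))"
      unfolding lim_sequentially
    proof (intro allI impI)
      fix e :: real assume "0 < e"
      \<comment> \<open>\<open>L * T + 1\<close> instead of \<open>L * T\<close> keeps the division
        legitimate when a factor is zero.\<close>
      define e' where "e' = e / (L * T + 1)"
      have "0 < L * T + 1" using \<open>0 \<le> L\<close> \<open>0 \<le> T\<close> by (simp add: add_nonneg_pos)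
      then have "0 < e'" using \<open>0 < e\<close> by (simp add: e'_def)
      then obtain n0 where n0: "\<And>n s. n \<ge> n0 \<Longrightarrow> s \<in> {0..T} \<Longrightarrow> dist (Y n s) (y s) < e'"
        using ulY unfolding uniform_limit_sequentially_iff by meson
      show "\<exists>no. \<forall>n\<ge>no. dist (integral {0..t} (\<lambda>s. F s (Y n s))) (integral {0..t} (\<lambda>s. F s (y s))) < e"
      proof (intro exI[of _ n0] allI impI)
        fix n assume n: "n \<ge> n0"
        have "dist (integral {0..t} (\<lambda>s. F s (Y n s))) (integral {0..t} (\<lambda>s. F s (y s)))
            = norm (integral {0..t} (\<lambda>s. F s (Y n s) - F s (y s)))"
          unfolding dist_norm using integral_diff[OF intY[OF t] inty] by simp
        also have "\<dots> \<le> integral {0..t} (\<lambda>s. L * e')"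
        proof (rule integral_norm_bound_integral)
          fix s assume "s \<in> {0..t}"
          then have s: "s \<in> {0..T}" using sub by auto
          show "norm (F s (Y n s) - F s (y s)) \<le> L * e'"
            using lip[OF s, of "Y n s" "y s"] n0[OF n s] \<open>0 \<le> L\<close>
            by (smt (verit) dist_norm mult_left_mono)
        qed (use intY[OF t] inty in \<open>auto intro!: integrable_diff\<close>)
        also have "\<dots> = L * t * e'" using t by simp
        also have "\<dots> \<le> (L * T) * e'" using t \<open>0 \<le> L\<close> \<open>0 < e'\<close>
          by (intro mult_right_mono mult_left_mono) auto
        also have "\<dots> < (L * T + 1) * e'" using \<open>0 < e'\<close> by (simp add: algebra_simps)
        also have "\<dots> = e" using \<open>0 < L * T + 1\<close> by (simp add: e'_def)
        finally show "dist (integral {0..t} (\<lambda>s. F s (Y n s))) (integral {0..t} (\<lambda>s. F s (y s))) < e" .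
      qed
    qed
    then have "(\<lambda>n. Y (Suc n) t) \<longlonglongrightarrow> c + integral {0..t} (\<lambda>s. F s (y s))"
      unfolding YS by (intro tendsto_intros)
    moreover have "(\<lambda>n. Y (Suc n) t) \<longlonglongrightarrow> y t"
      using tendsto_uniform_limitI[OF ulY t] LIMSEQ_Suc by blast
    ultimately have "y t = c + integral {0..t} (\<lambda>s. F s (y s))"
      using LIMSEQ_unique by blast
    then show "((\<lambda>s. F s (y s)) has_integral (y t - c)) {0..t}"
      using inty by (simp add: has_integral_iff)
  qed
qed

text \<open>Gronwall runs forward from \<open>t0\<close>; the backward half is the same argument
  applied to the time-reversed function s -> p(t0 - s).\<close>

lemma linear_growth_zero:
  fixes p :: "real \<Rightarrow> 'a::euclidean_space"
  assumes cont: "continuous_on {0..T} p" and "0 \<le> L"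
    and int: "\<And>s t. 0 \<le> s \<Longrightarrow> s \<le> t \<Longrightarrow> t \<le> T \<Longrightarrow> (f has_integral (p t - p s)) {s..t}"
    and le: "\<And>s. s \<in> {0..T} \<Longrightarrow> norm (f s) \<le> L * norm (p s)"
    and t0: "t0 \<in> {0..T}" "p t0 = 0" and t: "t \<in> {0..T}"
  shows "p t = 0"
proof -
  have bound: "norm (p b - p a) \<le> L * integral {a..b} (\<lambda>s. norm (p s))"
    if "0 \<le> a" "a \<le> b" "b \<le> T" for a b
  proof -
    have "continuous_on {a..b} (\<lambda>s. norm (p s))"
      using that by (intro continuous_intros continuous_on_subset[OF cont]) auto
    then have i: "(\<lambda>s. norm (p s)) integrable_on {a..b}" by (rule integrable_continuous_interval)
    have "norm (integral {a..b} f) \<le> integral {a..b} (\<lambda>s. L * norm (p s))"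
      using int[OF that] le that i
      by (intro integral_norm_bound_integral integrable_on_mult_right) auto
    then show ?thesis using int[OF that] by (simp add: integral_unique)
  qed
  show ?thesis
  proof (cases "t0 \<le> t")
    case True
    have "norm (p (t0 + (t - t0))) \<le> 0 * exp (L * (t - t0))"
    proof (rule gronwall[where T = "T - t0" and \<phi> = "\<lambda>s. norm (p (t0 + s))", OF _ \<open>0 \<le> L\<close>])
      show "continuous_on {0..T - t0} (\<lambda>s. norm (p (t0 + s)))"
        using t0 by (intro continuous_intros continuous_on_compose2[OF cont]) auto
      fix s assume s: "s \<in> {0..T - t0}"
      have "integral {t0..s + t0} (\<lambda>s. norm (p s)) = integral {0..s} (\<lambda>s. norm (p (t0 + s)))"
        using integral_shift_Icc_real[of 0 s "\<lambda>s. norm (p s)" t0] unfolding comp_def by simp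
      moreover have "norm (p (s + t0) - p t0) \<le> L * integral {t0..s + t0} (\<lambda>s. norm (p s))"
        using s t0 by (intro bound) auto
      ultimately show "norm (p (t0 + s)) \<le> 0 + L * integral {0..s} (\<lambda>s. norm (p (t0 + s)))"
        using t0(2) by (simp only: add.commute[of s t0]) simp
    qed (use t True in auto)
    then show ?thesis by simp
  next
    case False
    have "norm (p (t0 - (t0 - t))) \<le> 0 * exp (L * (t0 - t))"
    proof (rule gronwall[where T = t0 and \<phi> = "\<lambda>s. norm (p (t0 - s))", OF _ \<open>0 \<le> L\<close>])
      show "continuous_on {0..t0} (\<lambda>s. norm (p (t0 - s)))"
        using t0 by (intro continuous_intros continuous_on_compose2[OF cont]) auto
      fix s assume s: "s \<in> {0..t0}"
      have "integral {t0 - s..t0} (\<lambda>s. norm (p s)) = integral {0..s} (\<lambda>s. norm (p (t0 - s)))"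
        using Henstock_Kurzweil_Integration.integral_reflect_real[of "t0" "t0 - s" "\<lambda>s. norm (p s)"]
          integral_shift_Icc_real[of 0 s "\<lambda>s. norm (p (-s))" "-t0"] unfolding comp_def by simp
      then show "norm (p (t0 - s)) \<le> 0 + L * integral {0..s} (\<lambda>s. norm (p (t0 - s)))"
        using bound[of "t0 - s" t0] s t0 by (auto simp: norm_minus_commute)
    qed (use t False in auto)
    then show ?thesis by simp
  qed
qed

section \<open>Primitives of bounded measurable functions\<close>

lemma measurable_continuous_on_compose:
  assumes "g \<in> borel_measurable M" "\<And>t. t \<in> space M \<Longrightarrow> g t \<in> A" "continuous_on A h"
  shows "(\<lambda>t. h (g t)) \<in> borel_measurable M"
proof -
  have "g \<in> M \<rightarrow>\<^sub>M restrict_space borel A"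
    using assms(1,2) by (intro measurable_restrict_space2) auto
  moreover have "h \<in> borel_measurable (restrict_space borel A)"
    using assms(3) by (rule borel_measurable_continuous_on_restrict)
  ultimately show ?thesis by (rule measurable_compose)
qed

lemma bounded_measurable_integrable_on:
  fixes g :: "real \<Rightarrow> 'a::euclidean_space"
  assumes "g \<in> borel_measurable (lebesgue_on {a..b})" "\<And>t. t \<in> {a..b} \<Longrightarrow> norm (g t) \<le> B"
  shows "g integrable_on {a..b}"
  by (rule measurable_bounded_by_integrable_imp_integrable[OF assms(1) _ assms(2)]) auto

lemma primitive_has_integral:
  fixes y :: "real \<Rightarrow> 'a::euclidean_space"
  assumes y: "\<And>t. t \<in> {0..T} \<Longrightarrow> (g has_integral (y t - c)) {0..t}"
    and st: "0 \<le> s" "s \<le> t" "t \<le> T"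
  shows "(g has_integral (y t - y s)) {s..t}"
proof -
  have "g integrable_on {0..t}" using y[of t] st by auto
  then have "g integrable_on {s..t}"
    by (rule integrable_subinterval_real) (use st in auto)
  then obtain i where i: "(g has_integral i) {s..t}" by blast
  have "(g has_integral (y s - c + i)) {0..t}"
    using has_integral_combine[OF st(1,2) _ i] y[of s] st by simp
  then have "y s - c + i = y t - c"
    using y[of t] st by (intro has_integral_unique[of g]) auto
  then have "i = y t - y s" by (simp add: algebra_simps)
  then show ?thesis using i by simp
qed

lemma primitive_lipschitz_on:
  fixes y :: "real \<Rightarrow> 'a::euclidean_space"
  assumes y: "\<And>t. t \<in> {0..T} \<Longrightarrow> (g has_integral (y t - c)) {0..t}"
    and B: "\<And>t. t \<in> {0..T} \<Longrightarrow> norm (g t) \<le> B" and "0 \<le> B"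
  shows "B-lipschitz_on {0..T} y"
proof (rule lipschitz_onI)
  have *: "norm (y t - y s) \<le> B * (t - s)" if st: "0 \<le> s" "s \<le> t" "t \<le> T" for s t
  proof -
    have I: "(g has_integral (y t - y s)) {s..t}" by (rule primitive_has_integral[OF y st])
    have "norm (integral {s..t} g) \<le> integral {s..t} (\<lambda>_. B)"
      using B I st by (intro integral_norm_bound_integral) auto
    then show ?thesis using I st by (simp add: integral_unique mult.commute)
  qed
  fix s t assume "s \<in> {0..T}" "t \<in> {0..T}"
  then show "dist (y s) (y t) \<le> B * dist s t"
    using *[of s t] *[of t s] by (cases "s \<le> t") (auto simp: dist_norm norm_minus_commute)
qed (rule \<open>0 \<le> B\<close>)

lemma primitive_has_vector_derivative_AE:
  fixes y :: "real \<Rightarrow> 'a::euclidean_space"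
  assumes y: "\<And>t. t \<in> {0..T} \<Longrightarrow> (g has_integral (y t - c)) {0..t}" and "0 \<le> T"
  obtains N where "negligible N" "\<And>t. t \<in> {0..T} - N \<Longrightarrow> t \<in> {0<..<T}"
    "\<And>t. t \<in> {0..T} - N \<Longrightarrow> (y has_vector_derivative g t) (at t)"
proof -
  have "g integrable_on {0..T}" using y[of T] \<open>0 \<le> T\<close> by auto
  then obtain N where N: "negligible N" "\<And>t. t \<in> {0..T} - N \<Longrightarrow> t \<in> {0<..<T}"
    "\<And>t. t \<in> {0..T} - N \<Longrightarrow> ((\<lambda>t. integral {0..t} g) has_vector_derivative g t) (at t)"
    by (rule indefinite_integral_has_vector_derivative_AE) (rule that)
  have "(y has_vector_derivative g t) (at t)" if t: "t \<in> {0..T} - N" for t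
  proof (rule has_vector_derivative_transform_within_open[where S="{0<..<T}"])
    show "((\<lambda>t. c + integral {0..t} g) has_vector_derivative g t) (at t)"
      using has_vector_derivative_add[OF has_vector_derivative_const N(3)[OF t], of c] by simp
    fix s assume "s \<in> {0<..<T}"
    then show "c + integral {0..s} g = y s" using y[of s] by (simp add: integral_unique)
  qed (use N(2)[OF t] in auto)
  then show ?thesis using that N by blast
qed

text \<open>Integration by parts: the product of two Lipschitz functions on a compact interval is
  Lipschitz, hence the integral of its derivative, which is known almost everywhere. It is applied
  to a costate and the deviation between two trajectories.\<close>

lemma primitive_inner_has_integral:
  fixes y z :: "real \<Rightarrow> 'a::euclidean_space"
  assumes y: "\<And>t. t \<in> {0..T} \<Longrightarrow> (f has_integral (y t - c)) {0..t}"
    and z: "\<And>t. t \<in> {0..T} \<Longrightarrow> (g has_integral (z t - d)) {0..t}"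
    and B: "\<And>t. t \<in> {0..T} \<Longrightarrow> norm (f t) \<le> B" "\<And>t. t \<in> {0..T} \<Longrightarrow> norm (g t) \<le> B" and "0 \<le> T"
  shows "((\<lambda>s. f s \<bullet> z s + y s \<bullet> g s) has_integral (y T \<bullet> z T - y 0 \<bullet> z 0)) {0..T}"
proof -
  have "0 \<le> B" using B(1)[of 0] norm_ge_zero[of "f 0"] \<open>0 \<le> T\<close> by (meson atLeastAtMost_iff order_trans order_refl)
  have ly: "B-lipschitz_on {0..T} y" by (rule primitive_lipschitz_on[OF y B(1) \<open>0 \<le> B\<close>])
  have lz: "B-lipschitz_on {0..T} z" by (rule primitive_lipschitz_on[OF z B(2) \<open>0 \<le> B\<close>])
  obtain Cy where Cy: "\<And>t. t \<in> {0..T} \<Longrightarrow> norm (y t) \<le> Cy"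
    using compact_imp_bounded[OF compact_continuous_image[OF lipschitz_on_continuous_on[OF ly] compact_Icc]]
    unfolding bounded_iff by blast
  obtain Cz where Cz: "\<And>t. t \<in> {0..T} \<Longrightarrow> norm (z t) \<le> Cz"
    using compact_imp_bounded[OF compact_continuous_image[OF lipschitz_on_continuous_on[OF lz] compact_Icc]]
    unfolding bounded_iff by blast
  have "0 \<le> Cy" "0 \<le> Cz" using Cy[of 0] Cz[of 0] \<open>0 \<le> T\<close> norm_ge_zero[of "y 0"] norm_ge_zero[of "z 0"]
    by (simp_all, linarith+)
  have "(Cy * B + Cz * B)-lipschitz_on {0..T} (\<lambda>t. y t \<bullet> z t)"
  proof (rule lipschitz_onI)
    fix s t assume st: "s \<in> {0..T}" "t \<in> {0..T}"
    have "y s \<bullet> z s - y t \<bullet> z t = y s \<bullet> (z s - z t) + (y s - y t) \<bullet> z t"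
      by (simp add: inner_diff_left inner_diff_right)
    then have "dist (y s \<bullet> z s) (y t \<bullet> z t) = \<bar>y s \<bullet> (z s - z t) + (y s - y t) \<bullet> z t\<bar>"
      by (simp add: dist_real_def)
    also have "\<dots> \<le> norm (y s) * norm (z s - z t) + norm (y s - y t) * norm (z t)"
      using Cauchy_Schwarz_ineq2[of "y s" "z s - z t"] Cauchy_Schwarz_ineq2[of "y s - y t" "z t"] by linarith
    also have "\<dots> \<le> Cy * (B * dist s t) + (B * dist s t) * Cz"
      using lipschitz_onD[OF ly st] lipschitz_onD[OF lz st] Cy[OF st(1)] Cz[OF st(2)] \<open>0 \<le> Cy\<close> \<open>0 \<le> B\<close>
      by (intro add_mono mult_mono) (auto simp: dist_norm)
    finally show "dist (y s \<bullet> z s) (y t \<bullet> z t) \<le> (Cy * B + Cz * B) * dist s t"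
      by (simp add: algebra_simps)
  qed (use \<open>0 \<le> Cy\<close> \<open>0 \<le> Cz\<close> \<open>0 \<le> B\<close> in simp)
  then have ac: "abs_continuous_on (\<lambda>t. y t \<bullet> z t) {0..T}"
    by (rule lipschitz_on_imp_abs_continuous_on)
  obtain N where N: "negligible N"
    "\<And>t. t \<in> {0..T} - N \<Longrightarrow> (y has_vector_derivative f t) (at t)"
    by (rule primitive_has_vector_derivative_AE[OF y \<open>0 \<le> T\<close>], assumption, rule that)
  obtain N' where N': "negligible N'"
    "\<And>t. t \<in> {0..T} - N' \<Longrightarrow> (z has_vector_derivative g t) (at t)"
    by (rule primitive_has_vector_derivative_AE[OF z \<open>0 \<le> T\<close>], assumption, rule that)
  show ?thesis
  proof (rule abs_continuous_on_imp_has_integral[OF ac \<open>0 \<le> T\<close> negligible_Un[OF N(1) N'(1)]])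
    fix t assume t: "t \<in> {0..T} - (N \<union> N')"
    have "((\<lambda>t. y t \<bullet> z t) has_vector_derivative (y t \<bullet> g t + f t \<bullet> z t)) (at t)"
      using N(2)[of t] N'(2)[of t] t
      by (intro bounded_bilinear.has_vector_derivative[OF bounded_bilinear_inner]) auto
    then show "((\<lambda>t. y t \<bullet> z t) has_vector_derivative (f t \<bullet> z t + y t \<bullet> g t)) (at t within {0..T})"
      by (simp add: add.commute has_vector_derivative_at_within)
  qed
qed

text \<open>If \<open>d\<close> is not interior to the convex cone generated by \<open>S\<close>, a
  hyperplane separates it. Otherwise the vertices of a cross-polytope around \<open>d\<close> lie in
  the cone, and barycentric weights of d + \<eta> depend continuously on \<eta>. Brouwer's theorem
  will use this continuity; separate representations of the points would not do.\<close>

lemma cone_alternative: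
  fixes S :: "'b::euclidean_space set" and d :: 'b
  assumes "S \<noteq> {}"
  shows "(\<exists>q. q \<noteq> 0 \<and> (\<forall>g\<in>S. q \<bullet> g \<le> 0) \<and> 0 \<le> q \<bullet> d) \<or>
    (\<exists>n g \<kappa> c. 0 < \<kappa> \<and> (\<forall>i<n. g i \<in> S) \<and> (\<forall>i::nat. continuous_on (cball 0 \<kappa>) (\<lambda>\<eta>. c \<eta> i)) \<and>
       (\<forall>\<eta>\<in>cball 0 \<kappa>. (\<forall>i. 0 \<le> c \<eta> i) \<and> (\<Sum>i<n. c \<eta> i *\<^sub>R g i) = d + \<eta>))"
proof -
  define K where "K = conic hull (convex hull S)"
  have K: "K = {c *\<^sub>R x | c x. 0 \<le> c \<and> x \<in> convex hull S}"
    by (simp add: K_def conic_hull_explicit)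
  have SK: "S \<subseteq> K" unfolding K_def by (meson hull_subset order_trans)
  have "convex K" unfolding K_def by (intro convex_conic_hull convex_convex_hull)
  have scale: "c *\<^sub>R x \<in> K" if "0 \<le> c" "x \<in> K" for c x
    using that unfolding K by (auto) (metis mult_nonneg_nonneg)
  have "0 \<in> K" using scale[of 0] SK \<open>S \<noteq> {}\<close> by fastforce
  have rep: "\<exists>B w. finite B \<and> B \<subseteq> S \<and> (\<forall>v\<in>B. 0 \<le> w v) \<and> (\<Sum>v\<in>B. w v *\<^sub>R v) = y" if yK: "y \<in> K" for y
  proof -
    obtain c x where cx: "y = c *\<^sub>R x" "0 \<le> c" "x \<in> convex hull S" using yK unfolding K by blast
    then obtain B w where "finite B" "B \<subseteq> S" "\<forall>v\<in>B. 0 \<le> w v" "(\<Sum>v\<in>B. w v *\<^sub>R v) = x"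
      unfolding convex_hull_explicit by blast
    then show ?thesis using cx
      by (intro exI[of _ B] exI[of _ "\<lambda>v. c * w v"]) (auto simp: scaleR_sum_right)
  qed
  show ?thesis
  proof (cases "d \<in> interior K")
    case False
    have "\<exists>q. q \<noteq> 0 \<and> (\<forall>g\<in>K. q \<bullet> g \<le> 0) \<and> 0 \<le> q \<bullet> d"
    proof (cases "interior K = {}")
      case True
      then obtain a b where ab: "a \<noteq> 0" "K \<subseteq> {x. a \<bullet> x = b}"
        using empty_interior_subset_hyperplane[OF \<open>convex K\<close>] by metis
      \<comment> \<open>A hyperplane containing the cone passes through 0, so both signs of its
        normal are admissible; the sign is then chosen for \<open>d\<close>.\<close>
      then have "b = 0" using \<open>0 \<in> K\<close> by auto
      then show ?thesis
        using ab by (intro exI[of _ "if 0 \<le> a \<bullet> d then a else - a"]) auto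
    next
      case int: False
      have "\<exists>a b. a \<noteq> 0 \<and> (\<forall>x\<in>interior K. a \<bullet> x \<le> b) \<and> (\<forall>x\<in>{d}. b \<le> a \<bullet> x)"
        using False int \<open>convex K\<close> by (intro separating_hyperplane_sets) (auto simp: convex_interior)
      then obtain a b where ab: "a \<noteq> 0" "\<And>x. x \<in> interior K \<Longrightarrow> a \<bullet> x \<le> b" "b \<le> a \<bullet> d" by auto
      have "closure (interior K) \<subseteq> {x. a \<bullet> x \<le> b}"
        using ab(2) by (intro closure_minimal) (auto simp: closed_halfspace_le)
      then have le: "a \<bullet> x \<le> b" if "x \<in> K" for x
        using that convex_closure_interior[OF \<open>convex K\<close> int] closure_subset[of K] by auto
      have "0 \<le> b" using le[OF \<open>0 \<in> K\<close>] by simp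
      have "a \<bullet> x \<le> 0" if "x \<in> K" for x
      proof (rule ccontr)
        assume "\<not> a \<bullet> x \<le> 0"
        then have p: "0 < a \<bullet> x" by simp
        \<comment> \<open>A point of the cone with positive value could be scaled within the cone
          until its value exceeds \<open>b\<close>.\<close>
        have "a \<bullet> (((b + 1) / (a \<bullet> x)) *\<^sub>R x) \<le> b"
          using p \<open>0 \<le> b\<close> that by (intro le scale) auto
        then show False using p by simp
      qed
      then show ?thesis using ab \<open>0 \<le> b\<close> by (intro exI[of _ a]) auto
    qed
    then show ?thesis using SK by blast
  next
    case True
    then obtain \<rho> where \<rho>: "0 < \<rho>" "ball d \<rho> \<subseteq> K"
      using mem_interior by blast
    define r where "r = \<rho> / 2"
    have r: "0 < r" using \<rho> by (simp add: r_def)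
    define I where "I = (Basis :: 'b set) \<times> {1, -1 :: real}"
    define vx where "vx = (\<lambda>(e, \<sigma>). d + (\<sigma> * r) *\<^sub>R e)" for e :: 'b and \<sigma>
    have finI: "finite I" by (simp add: I_def)
    have "vx i \<in> K" if "i \<in> I" for i
    proof -
      have "vx i \<in> ball d \<rho>" using that \<rho> by (auto simp: I_def vx_def dist_norm r_def)
      then show ?thesis using \<rho> by blast
    qed
    then have "\<forall>i\<in>I. \<exists>B w. finite B \<and> B \<subseteq> S \<and> (\<forall>v\<in>B. 0 \<le> w v) \<and> (\<Sum>v\<in>B. w v *\<^sub>R v) = vx i"
      using rep by blast
    then obtain B w where Bw: "\<And>i. i \<in> I \<Longrightarrow> finite (B i) \<and> B i \<subseteq> S \<and> (\<forall>v\<in>B i. 0 \<le> w i v) \<and>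
        (\<Sum>v\<in>B i. w i v *\<^sub>R v) = vx i"
      by metis
    define N where "N = real DIM('b)"
    have N: "0 < N" by (simp add: N_def)
    define \<kappa> where "\<kappa> = r / N"
    have \<kappa>: "0 < \<kappa>" using r N by (simp add: \<kappa>_def)
    \<comment> \<open>On each axis the two weights add up to 1 / N and differ by (\<eta> \<bullet>
      e) / r. The radius r / N of the ball keeps them nonnegative, so \<open>max\<close> is inactive
      there; it makes nonnegativity hold for every \<eta>.\<close>
    define l where "l = (\<lambda>\<eta> (e :: 'b, \<sigma>). max 0 (1 / (2 * N) + \<sigma> * (\<eta> \<bullet> e) / (2 * r)))"
    define BB where "BB = (\<Union>i\<in>I. B i)"
    have finB: "finite BB" using finI Bw by (auto simp: BB_def)
    \<comment> \<open>A generator may occur in the representations of several vertices, so its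
      coefficients are added up.\<close>
    define C where "C \<eta> v = (\<Sum>i\<in>I. l \<eta> i * (if v \<in> B i then w i v else 0))" for \<eta> v
    obtain n :: nat and h where h: "bij_betw h {..<n} BB"
      using ex_bij_betw_nat_finite[OF finB] by (auto simp: atLeast0LessThan)
    have l0: "0 \<le> l \<eta> i" for \<eta> i by (simp add: l_def split: prod.split)
    have C0: "0 \<le> C \<eta> v" for \<eta> v
      unfolding C_def using l0 Bw by (intro sum_nonneg mult_nonneg_nonneg) auto
    have contl: "continuous_on UNIV (\<lambda>\<eta>. l \<eta> i)" for i
        unfolding l_def using r N by (cases i) (auto intro!: continuous_intros)
    have contC: "continuous_on A (\<lambda>\<eta>. C \<eta> v)" for v A
      unfolding C_def by (intro continuous_intros continuous_on_subset[OF contl]) auto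
    have sumC: "(\<Sum>v\<in>BB. C \<eta> v *\<^sub>R v) = d + \<eta>" if \<eta>: "\<eta> \<in> cball 0 \<kappa>" for \<eta>
    proof -
      have leq: "l \<eta> (e, \<sigma>) = 1 / (2 * N) + \<sigma> * (\<eta> \<bullet> e) / (2 * r)" if "(e, \<sigma>) \<in> I" for e \<sigma>
      proof -
        have "\<bar>\<eta> \<bullet> e\<bar> \<le> r / N"
          using Basis_le_norm[of e \<eta>] \<eta> that by (auto simp: I_def \<kappa>_def)
        then have "\<bar>\<eta> \<bullet> e\<bar> / (2 * r) \<le> 1 / (2 * N)"
          using r N by (simp add: field_simps)
        moreover have "\<bar>\<sigma> * (\<eta> \<bullet> e) / (2 * r)\<bar> = \<bar>\<eta> \<bullet> e\<bar> / (2 * r)"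
          using that r by (auto simp: I_def abs_mult)
        ultimately have "0 \<le> 1 / (2 * N) + \<sigma> * (\<eta> \<bullet> e) / (2 * r)" by linarith
        then show ?thesis by (simp add: l_def)
      qed
      have "(\<Sum>v\<in>BB. C \<eta> v *\<^sub>R v) = (\<Sum>v\<in>BB. \<Sum>i\<in>I. (l \<eta> i * (if v \<in> B i then w i v else 0)) *\<^sub>R v)"
        by (simp add: C_def scaleR_sum_left)
      also have "\<dots> = (\<Sum>i\<in>I. \<Sum>v\<in>BB. (l \<eta> i * (if v \<in> B i then w i v else 0)) *\<^sub>R v)"
        by (rule sum.swap)
      also have "\<dots> = (\<Sum>i\<in>I. l \<eta> i *\<^sub>R vx i)"
      proof (rule sum.cong[OF refl])
        fix i assume i: "i \<in> I"
        have "(\<Sum>v\<in>BB. (l \<eta> i * (if v \<in> B i then w i v else 0)) *\<^sub>R v)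
            = l \<eta> i *\<^sub>R (\<Sum>v\<in>BB. if v \<in> B i then w i v *\<^sub>R v else 0)"
          by (subst scaleR_sum_right, intro sum.cong) auto
        also have "(\<Sum>v\<in>BB. if v \<in> B i then w i v *\<^sub>R v else 0) = (\<Sum>v\<in>BB \<inter> B i. w i v *\<^sub>R v)"
          using finB by (simp add: sum.inter_restrict)
        also have "BB \<inter> B i = B i" using i by (auto simp: BB_def)
        finally show "(\<Sum>v\<in>BB. (l \<eta> i * (if v \<in> B i then w i v else 0)) *\<^sub>R v) = l \<eta> i *\<^sub>R vx i"
          using Bw[OF i] by simp
      qed
      also have "\<dots> = (\<Sum>e\<in>Basis. \<Sum>\<sigma>\<in>{1, -1}. l \<eta> (e, \<sigma>) *\<^sub>R vx (e, \<sigma>))"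
        unfolding I_def sum.cartesian_product by (simp add: case_prod_unfold)
      also have "\<dots> = (\<Sum>e\<in>Basis. (1 / N) *\<^sub>R d + (\<eta> \<bullet> e) *\<^sub>R e)"
      proof (rule sum.cong[OF refl])
        fix e :: 'b assume "e \<in> Basis"
        then have "(e, 1) \<in> I" "(e, -1) \<in> I" by (auto simp: I_def)
        have split: "(a + b) *\<^sub>R (d + r *\<^sub>R e) + (a - b) *\<^sub>R (d - r *\<^sub>R e)
            = (a + a) *\<^sub>R d + (b * r + b * r) *\<^sub>R e" for a b :: real
          by (simp only: scaleR_add_left scaleR_diff_left scaleR_add_right scaleR_diff_right scaleR_scaleR)
            (simp only: algebra_simps)
        have "l \<eta> (e, 1) *\<^sub>R vx (e, 1) + l \<eta> (e, -1) *\<^sub>R vx (e, -1)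
            = (1 / (2 * N) + 1 / (2 * N)) *\<^sub>R d + ((\<eta> \<bullet> e) / (2 * r) * r + (\<eta> \<bullet> e) / (2 * r) * r) *\<^sub>R e"
          using leq[OF \<open>(e, 1) \<in> I\<close>] leq[OF \<open>(e, -1) \<in> I\<close>]
            split[of "1 / (2 * N)" "(\<eta> \<bullet> e) / (2 * r)"] by (simp add: vx_def)
        also have "1 / (2 * N) + 1 / (2 * N) = 1 / N" by simp
        also have "(\<eta> \<bullet> e) / (2 * r) * r + (\<eta> \<bullet> e) / (2 * r) * r = \<eta> \<bullet> e" using r by simp
        finally show "(\<Sum>\<sigma>\<in>{1, -1}. l \<eta> (e, \<sigma>) *\<^sub>R vx (e, \<sigma>)) = (1 / N) *\<^sub>R d + (\<eta> \<bullet> e) *\<^sub>R e"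
          by simp
      qed
      also have "\<dots> = d + \<eta>"
        using N by (simp add: sum.distrib euclidean_representation sum_constant_scaleR flip: N_def)
      finally show ?thesis .
    qed
    have "(\<Sum>i<n. C \<eta> (h i) *\<^sub>R h i) = (\<Sum>v\<in>BB. C \<eta> v *\<^sub>R v)" for \<eta>
      using sum.reindex_bij_betw[OF h] .
    moreover have "BB \<subseteq> S" using Bw unfolding BB_def by blast
    ultimately have "0 < \<kappa> \<and> (\<forall>i<n. h i \<in> S) \<and> (\<forall>i. continuous_on (cball 0 \<kappa>) (\<lambda>\<eta>. C \<eta> (h i))) \<and>
       (\<forall>\<eta>\<in>cball 0 \<kappa>. (\<forall>i. 0 \<le> C \<eta> (h i)) \<and> (\<Sum>i<n. C \<eta> (h i) *\<^sub>R h i) = d + \<eta>)"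
      using \<kappa> sumC C0 contC bij_betwE[OF h] by auto
    then show ?thesis
      by (intro disjI2 exI[of _ n] exI[of _ h] exI[of _ \<kappa>] exI[of _ "\<lambda>\<eta> i. C \<eta> (h i)"])
  qed
qed

subsection \<open>Trajectories of control systems\<close>

text \<open>Later needles override earlier ones. On disjoint sets the order does not matter
  (\<open>needle_inside\<close>).\<close>

primrec needle :: "(nat \<Rightarrow> real set) \<Rightarrow> (nat \<Rightarrow> 'u) \<Rightarrow> (real \<Rightarrow> 'u) \<Rightarrow> nat \<Rightarrow> real \<Rightarrow> 'u" where
  "needle J w u 0 = u"
| "needle J w u (Suc n) = (\<lambda>t. if t \<in> J n then w n else needle J w u n t)"

lemma needle_outside: "(\<And>i. i < n \<Longrightarrow> t \<notin> J i) \<Longrightarrow> needle J w u n t = u t"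
  by (induction n) auto

lemma needle_inside:
  assumes "i < n" "t \<in> J i" "\<And>j. j < n \<Longrightarrow> j \<noteq> i \<Longrightarrow> t \<notin> J j"
  shows "needle J w u n t = w i"
  using assms by (induction n) (auto simp: less_Suc_eq)

lemma needle_cong_at:
  "(\<And>i. i < n \<Longrightarrow> t \<in> J i \<longleftrightarrow> t \<in> J' i) \<Longrightarrow> needle J w u n t = needle J' w u n t"
  by (induction n) auto

lemma needle_range: "(\<And>i. i < n \<Longrightarrow> w i \<in> W) \<Longrightarrow> u t \<in> W \<Longrightarrow> needle J w u n t \<in> W"
  by (induction n) auto

lemma needle_measurable:
  fixes u :: "real \<Rightarrow> 'u::euclidean_space"
  assumes "u \<in> borel_measurable (lebesgue_on S)" "\<And>i. i < n \<Longrightarrow> J i \<in> sets borel" "S \<in> sets lebesgue"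
  shows "needle J w u n \<in> borel_measurable (lebesgue_on S)"
  using assms(2)
proof (induction n)
  case 0
  then show ?case using assms(1) by simp
next
  case (Suc n)
  have "J n \<in> sets lebesgue" using Suc.prems[of n] by auto
  then have "{t \<in> space (lebesgue_on S). t \<in> J n} \<in> sets (lebesgue_on S)"
    using assms(3) by (auto simp: sets_restrict_space_iff Int_def intro!: sets.Int)
  then show ?case using Suc by (auto intro!: measurable_If)
qed

lemma abs_continuous_on_subset:
  assumes "abs_continuous_on f J" "J' \<subseteq> J"
  shows "abs_continuous_on f J'"
  unfolding abs_continuous_on_def
proof (intro allI impI)
  fix e :: real assume "0 < e"
  obtain \<delta> where \<delta>: "0 < \<delta>" "\<And>D. D division_of \<Union>D \<Longrightarrow> \<Union>D \<subseteq> J \<Longrightarrow>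
      (\<Sum>k\<in>D. Sup k - Inf k) < \<delta> \<Longrightarrow> (\<Sum>k\<in>D. norm (f (Sup k) - f (Inf k))) < e"
    by (rule abs_continuous_onE[OF assms(1) \<open>0 < e\<close>]) (rule that)
  show "\<exists>\<delta>>0. \<forall>d. d division_of \<Union>d \<and> \<Union>d \<subseteq> J' \<and> (\<Sum>k\<in>d. Sup k - Inf k) < \<delta> \<longrightarrow>
      (\<Sum>k\<in>d. norm (f (Sup k) - f (Inf k))) < e"
    using \<delta>(1) assms(2) by (intro exI[of _ \<delta>] conjI allI impI \<delta>(2)) (simp_all add: order_trans[OF _ assms(2)])
qed

text \<open>\<open>adj y p w\<close> is minus the transposed state derivative of \<open>f\<close>
  applied to p, expressed through the scalar functions p \<bullet> f. The adjoint equation thus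
  reads p' = adj x p u.\<close>

locale control_trajectory =
  fixes f :: "'a::euclidean_space \<Rightarrow> 'u::euclidean_space \<Rightarrow> 'a"
    and adj :: "'a \<Rightarrow> 'a \<Rightarrow> 'u \<Rightarrow> 'a"
    and X :: "'a set" and W :: "'u set" and T :: real
    and u :: "real \<Rightarrow> 'u" and x :: "real \<Rightarrow> 'a"
  assumes open_X: "open X" and compact_W: "compact W"
    and f_cont: "continuous_on (X \<times> W) (\<lambda>(y, w). f y w)"
    and adj_cont: "continuous_on (X \<times> UNIV \<times> W) (\<lambda>(y, p, w). adj y p w)"
    and adj_linear: "\<And>y w. y \<in> X \<Longrightarrow> w \<in> W \<Longrightarrow> linear (\<lambda>p. adj y p w)"
    and f_deriv: "\<And>y w p. y \<in> X \<Longrightarrow> w \<in> W \<Longrightarrow>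
        ((\<lambda>z. p \<bullet> f z w) has_derivative (\<lambda>d. - (adj y p w \<bullet> d))) (at y)"
    and T_pos: "0 < T"
    and u_meas: "u \<in> borel_measurable (lebesgue_on {0..T})"
    and u_W: "\<And>t. t \<in> {0..T} \<Longrightarrow> u t \<in> W"
    and x_ac: "abs_continuous_on x {0..T}"
    and x_X: "\<And>t. t \<in> {0..T} \<Longrightarrow> x t \<in> X"
    and x_ode: "AE t in lebesgue_on {0..T}. (x has_vector_derivative f (x t) (u t)) (at t)"
begin

lemma x_cont: "continuous_on {0..T} x"
  using x_ac by (rule abs_continuous_on_imp_continuous_on)

lemma x_primitive: "t \<in> {0..T} \<Longrightarrow> ((\<lambda>t. f (x t) (u t)) has_integral (x t - x 0)) {0..t}"
proof -
  assume t: "t \<in> {0..T}"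
  obtain N where N: "negligible N"
    "\<And>t. t \<in> {0..T} - N \<Longrightarrow> (x has_vector_derivative f (x t) (u t)) (at t)"
    using x_ode by (auto simp: AE_lebesgue_on_iff_negligible)
  have ac: "abs_continuous_on x {0..t}"
    by (rule abs_continuous_on_subset[OF x_ac]) (use t in auto)
  show ?thesis
  proof (rule abs_continuous_on_imp_has_integral[OF ac _ N(1)])
    fix s assume "s \<in> {0..t} - N"
    then have "s \<in> {0..T} - N" using t by auto
    from N(2)[OF this] show "(x has_vector_derivative f (x s) (u s)) (at s within {0..t})"
      by (rule has_vector_derivative_at_within)
  qed (use t in auto)
qed

text \<open>The radius of a tube around the trajectory inside \<open>X\<close>, a bound for \<open>f\<close> and a Lipschitz
  constant on the tube, with uniform continuity of \<open>adj\<close> along the trajectory.\<close>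

definition "tube_spec = (\<lambda>(\<rho>, M, L). 0 < \<rho> \<and> 0 \<le> M \<and> 0 \<le> L \<and>
   (\<forall>t\<in>{0..T}. cball (x t) \<rho> \<subseteq> X) \<and>
   (\<forall>t\<in>{0..T}. \<forall>y\<in>cball (x t) \<rho>. \<forall>w\<in>W. norm (f y w) \<le> M \<and> (\<forall>p. norm (adj y p w) \<le> L * norm p)) \<and>
   (\<forall>p_bound e. 0 < e \<longrightarrow> (\<exists>\<delta>>0. \<forall>t\<in>{0..T}. \<forall>y\<in>cball (x t) \<rho>. \<forall>w\<in>W. \<forall>p\<in>cball 0 p_bound.
       norm (y - x t) \<le> \<delta> \<longrightarrow> norm (adj y p w - adj (x t) p w) \<le> e)))"

text \<open>Everything follows from compactness of the closed neighbourhood \<open>K\<close> of the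
  trajectory and of \<open>W\<close>. The linear bound for \<open>adj\<close> comes from its bound
  for p in the unit ball by homogeneity.\<close>

lemma tube_exists: "\<exists>\<rho> M L. tube_spec (\<rho>, M, L)"
proof -
  have K0: "compact (x ` {0..T})" using x_cont by (intro compact_continuous_image) auto
  have "x ` {0..T} \<subseteq> X" using x_X by auto
  then obtain \<rho> where \<rho>: "0 < \<rho>" "(\<Union>y\<in>x ` {0..T}. cball y \<rho>) \<subseteq> X"
    using compact_subset_open_imp_cball_epsilon_subset[OF K0 open_X] by metis
  define K where "K = (\<Union>y\<in>x ` {0..T}. \<Union>d\<in>cball 0 \<rho>. {y + d})"
  have K: "compact K" unfolding K_def using K0 by (intro compact_sums' compact_cball)
  have in_K: "y \<in> K" if "t \<in> {0..T}" "y \<in> cball (x t) \<rho>" for t y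
    unfolding K_def using that by (intro UN_I[of "x t"] imageI UN_I[of "y - x t"]) (auto simp: dist_norm norm_minus_commute)
  have "K \<subseteq> X"
  proof
    fix y assume "y \<in> K"
    then obtain t d where "t \<in> {0..T}" "norm d \<le> \<rho>" "y = x t + d" by (auto simp: K_def)
    then have "y \<in> (\<Union>y\<in>x ` {0..T}. cball y \<rho>)"
      by (intro UN_I[of "x t"] imageI) (auto simp: dist_norm)
    then show "y \<in> X" using \<rho> by blast
  qed
  have "continuous_on (K \<times> W) (\<lambda>(y, w). f y w)"
    using \<open>K \<subseteq> X\<close> by (intro continuous_on_subset[OF f_cont]) auto
  then have "bounded ((\<lambda>(y, w). f y w) ` (K \<times> W))"
    using K compact_W by (intro compact_imp_bounded compact_continuous_image compact_Times)
  then obtain M where M: "\<And>y w. y \<in> K \<Longrightarrow> w \<in> W \<Longrightarrow> norm (f y w) \<le> M" "0 < M"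
    unfolding bounded_pos by fastforce
  have cadj: "continuous_on (K \<times> cball 0 P \<times> W) (\<lambda>(y, p, w). adj y p w)" for P
    using \<open>K \<subseteq> X\<close> by (intro continuous_on_subset[OF adj_cont]) auto
  then have "bounded ((\<lambda>(y, p, w). adj y p w) ` (K \<times> cball 0 1 \<times> W))"
    using K compact_W by (intro compact_imp_bounded compact_continuous_image compact_Times compact_cball)
  then obtain L where L: "\<And>y p w. y \<in> K \<Longrightarrow> w \<in> W \<Longrightarrow> norm p \<le> 1 \<Longrightarrow> norm (adj y p w) \<le> L" "0 < L"
    unfolding bounded_pos by fastforce
  have L': "norm (adj y p w) \<le> L * norm p" if "y \<in> K" "w \<in> W" for y p w
  proof (cases "p = 0")
    case True
    then show ?thesis using linear_0[OF adj_linear, of y w] that \<open>K \<subseteq> X\<close> by auto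
  next
    case False
    have "adj y p w = norm p *\<^sub>R adj y (p /\<^sub>R norm p) w"
      using linear_scale[OF adj_linear, of y w "norm p" "p /\<^sub>R norm p"] that \<open>K \<subseteq> X\<close> False by auto
    then show ?thesis using L(1)[of y w "p /\<^sub>R norm p"] that False
      by (simp add: mult.commute mult_left_mono)
  qed
  have uc: "\<exists>\<delta>>0. \<forall>t\<in>{0..T}. \<forall>y\<in>cball (x t) \<rho>. \<forall>w\<in>W. \<forall>p\<in>cball 0 P.
       norm (y - x t) \<le> \<delta> \<longrightarrow> norm (adj y p w - adj (x t) p w) \<le> e" if e: "0 < e" for P e
  proof -
    have "uniformly_continuous_on (K \<times> cball 0 P \<times> W) (\<lambda>(y, p, w). adj y p w)"
      using cadj K compact_W by (intro compact_uniformly_continuous compact_Times compact_cball)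
    then obtain \<delta> where \<delta>: "0 < \<delta>" "\<And>a b. a \<in> K \<times> cball 0 P \<times> W \<Longrightarrow> b \<in> K \<times> cball 0 P \<times> W \<Longrightarrow> dist b a < \<delta> \<Longrightarrow>
        dist ((\<lambda>(y, p, w). adj y p w) b) ((\<lambda>(y, p, w). adj y p w) a) < e"
      using e unfolding uniformly_continuous_on_def by metis
    show ?thesis
    proof (intro exI[of _ "\<delta> / 2"] conjI ballI impI)
      fix t y w p assume a: "t \<in> {0..T}" "y \<in> cball (x t) \<rho>" "w \<in> W" "p \<in> cball (0::'a) P" "norm (y - x t) \<le> \<delta> / 2"
      have "y \<in> K" "x t \<in> K" using in_K[OF a(1,2)] in_K[OF a(1), of "x t"] \<rho> by auto
      moreover have "dist (y, p, w) (x t, p, w) < \<delta>"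
        using a \<delta> by (simp add: dist_Pair_Pair dist_norm)
      ultimately have "dist (adj y p w) (adj (x t) p w) < e"
        using \<delta>(2)[of "(x t, p, w)" "(y, p, w)"] a by auto
      then show "norm (adj y p w - adj (x t) p w) \<le> e" by (simp add: dist_norm)
    qed (use \<delta> in simp)
  qed
  have "\<forall>t\<in>{0..T}. cball (x t) \<rho> \<subseteq> X" using \<rho> by blast
  then show ?thesis
    using \<rho>(1) M(2) L(2) M(1)[OF in_K] L'[OF in_K] uc
    unfolding tube_spec_def prod.case
    by (intro exI[of _ \<rho>] exI[of _ M] exI[of _ L]) (simp add: less_imp_le)
qed

definition \<rho> where "\<rho> = fst (SOME r. tube_spec r)"
definition M where "M = fst (snd (SOME r. tube_spec r))"
definition L where "L = snd (snd (SOME r. tube_spec r))"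

lemma tube: "tube_spec (\<rho>, M, L)"
proof -
  have "\<exists>r. tube_spec r" using tube_exists by blast
  from someI_ex[OF this] show ?thesis unfolding \<rho>_def M_def L_def by simp
qed

lemma \<rho>_pos: "0 < \<rho>" and M_nonneg: "0 \<le> M" and L_nonneg: "0 \<le> L"
  and tube_X: "t \<in> {0..T} \<Longrightarrow> y \<in> cball (x t) \<rho> \<Longrightarrow> y \<in> X"
  and f_bound: "t \<in> {0..T} \<Longrightarrow> y \<in> cball (x t) \<rho> \<Longrightarrow> w \<in> W \<Longrightarrow> norm (f y w) \<le> M"
  and adj_bound: "t \<in> {0..T} \<Longrightarrow> y \<in> cball (x t) \<rho> \<Longrightarrow> w \<in> W \<Longrightarrow> norm (adj y p w) \<le> L * norm p"
  using tube unfolding tube_spec_def prod.case by blast+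

lemma adj_unif:
  assumes "0 < e"
  obtains \<delta> where "0 < \<delta>" "\<And>t y w p. t \<in> {0..T} \<Longrightarrow> y \<in> cball (x t) \<rho> \<Longrightarrow> w \<in> W \<Longrightarrow> norm p \<le> P \<Longrightarrow>
       norm (y - x t) \<le> \<delta> \<Longrightarrow> norm (adj y p w - adj (x t) p w) \<le> e"
proof -
  have "\<exists>\<delta>>0. \<forall>t\<in>{0..T}. \<forall>y\<in>cball (x t) \<rho>. \<forall>w\<in>W. \<forall>p\<in>cball 0 P.
       norm (y - x t) \<le> \<delta> \<longrightarrow> norm (adj y p w - adj (x t) p w) \<le> e"
    using tube assms unfolding tube_spec_def by simp
  then obtain \<delta> where d: "0 < \<delta>" "\<forall>t\<in>{0..T}. \<forall>y\<in>cball (x t) \<rho>. \<forall>w\<in>W. \<forall>p\<in>cball 0 P.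
       norm (y - x t) \<le> \<delta> \<longrightarrow> norm (adj y p w - adj (x t) p w) \<le> e" by (elim exE conjE) (rule that)
  show ?thesis by (rule that[OF d(1)]) (use d(2) in simp)
qed

lemma x_in_tube: "x t \<in> cball (x t) \<rho>" using \<rho>_pos by simp

text \<open>The derivative is given only for the scalar functions p \<bullet> f. For p = f y w - f z
  w the mean value inequality on the convex ball gives |p|^2 <= L |p| |y - z|, and |p|
  cancels.\<close>

lemma f_lipschitz:
  assumes t: "t \<in> {0..T}" and "y \<in> cball (x t) \<rho>" "z \<in> cball (x t) \<rho>" and w: "w \<in> W"
  shows "norm (f y w - f z w) \<le> L * norm (y - z)"
proof -
  define p where "p = f y w - f z w"
  have "norm ((\<lambda>s. p \<bullet> f s w) y - (\<lambda>s. p \<bullet> f s w) z) \<le> (L * norm p) * norm (y - z)"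
  proof (rule differentiable_bound[where S = "cball (x t) \<rho>"])
    fix s assume s: "s \<in> cball (x t) \<rho>"
    show "((\<lambda>s. p \<bullet> f s w) has_derivative (\<lambda>d. - (adj s p w \<bullet> d))) (at s within cball (x t) \<rho>)"
      using f_deriv[OF tube_X[OF t s] w] by (rule has_derivative_at_withinI)
    show "onorm (\<lambda>d. - (adj s p w \<bullet> d)) \<le> L * norm p"
    proof (rule onorm_le)
      fix d
      have "norm (- (adj s p w \<bullet> d)) \<le> norm (adj s p w) * norm d"
        using Cauchy_Schwarz_ineq2 by simp
      also have "\<dots> \<le> L * norm p * norm d"
        using adj_bound[OF t s w] by (intro mult_right_mono) auto
      finally show "norm (- (adj s p w \<bullet> d)) \<le> L * norm p * norm d" .
    qed
  qed (use assms in auto)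
  moreover have "p \<bullet> f y w - p \<bullet> f z w = norm p * norm p"
    by (simp add: p_def inner_diff_right[symmetric] flip: power2_norm_eq_inner power2_eq_square)
  ultimately have "norm p * norm p \<le> (L * norm (y - z)) * norm p" by (simp add: mult_ac)
  then have "norm p \<le> L * norm (y - z)"
    using mult_right_le_imp_le[of "norm p" "norm p" "L * norm (y - z)"] L_nonneg by (cases "p = 0") auto
  then show ?thesis unfolding p_def .
qed

text \<open>The error is uniform in t, in w and in bounded p because \<open>adj\<close> is uniformly
  continuous near the trajectory. This allows linearizing under the integral although the control is
  merely measurable.\<close>

lemma f_linearization:
  assumes "0 < e"
  obtains \<delta> where "0 < \<delta>" "\<delta> \<le> \<rho>" "\<And>t d w p. t \<in> {0..T} \<Longrightarrow> norm d \<le> \<delta> \<Longrightarrow> w \<in> W \<Longrightarrow> norm p \<le> P \<Longrightarrow>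
       \<bar>p \<bullet> f (x t + d) w - p \<bullet> f (x t) w + adj (x t) p w \<bullet> d\<bar> \<le> e * norm d"
proof -
  obtain \<delta> where \<delta>: "0 < \<delta>" "\<And>t y w p. t \<in> {0..T} \<Longrightarrow> y \<in> cball (x t) \<rho> \<Longrightarrow> w \<in> W \<Longrightarrow> norm p \<le> P \<Longrightarrow>
       norm (y - x t) \<le> \<delta> \<Longrightarrow> norm (adj y p w - adj (x t) p w) \<le> e"
    by (rule adj_unif[OF assms, where P = P]) (rule that)
  define \<delta>' where "\<delta>' = min \<delta> \<rho>"
  have lin: "\<bar>p \<bullet> f (x t + d) w - p \<bullet> f (x t) w + adj (x t) p w \<bullet> d\<bar> \<le> e * norm d"
    if t: "t \<in> {0..T}" and d: "norm d \<le> \<delta>'" and w: "w \<in> W" and p: "norm p \<le> P" for t d w p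
  proof -
    have "norm (p \<bullet> f (x t + d) w - p \<bullet> f (x t) w - (- (adj (x t) p w \<bullet> (x t + d - x t))))
        \<le> norm (x t + d - x t) * e"
    proof (rule differentiable_bound_linearization[where S = "cball (x t) \<delta>'" and f' = "\<lambda>y d. - (adj y p w \<bullet> d)"
          and f = "\<lambda>y. p \<bullet> f y w"])
      fix r :: real assume r: "r \<in> {0..1}"
      have "norm (r *\<^sub>R d) \<le> 1 * norm d" using r by (simp add: mult_left_le_one_le)
      then show "x t + r *\<^sub>R (x t + d - x t) \<in> cball (x t) \<delta>'"
        using d by (simp add: dist_norm)
    next
      fix y assume y: "y \<in> cball (x t) \<delta>'"
      then have y': "y \<in> cball (x t) \<rho>" "norm (y - x t) \<le> \<delta>" by (auto simp: \<delta>'_def dist_norm norm_minus_commute)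
      show "((\<lambda>y. p \<bullet> f y w) has_derivative (\<lambda>d. - (adj y p w \<bullet> d))) (at y within cball (x t) \<delta>')"
        using f_deriv[OF tube_X[OF t y'(1)] w] by (rule has_derivative_at_withinI)
      have "onorm (\<lambda>d. - (adj y p w \<bullet> d) - - (adj (x t) p w \<bullet> d)) \<le> e"
      proof (rule onorm_le)
        fix d
        have "norm (- (adj y p w \<bullet> d) - - (adj (x t) p w \<bullet> d)) = \<bar>(adj y p w - adj (x t) p w) \<bullet> d\<bar>"
          by (simp add: inner_diff_left)
        also have "\<dots> \<le> norm (adj y p w - adj (x t) p w) * norm d" by (rule Cauchy_Schwarz_ineq2)
        also have "\<dots> \<le> e * norm d" using \<delta>(2)[OF t y'(1) w p y'(2)] by (intro mult_right_mono) auto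
        finally show "norm (- (adj y p w \<bullet> d) - - (adj (x t) p w \<bullet> d)) \<le> e * norm d" .
      qed
      then show "onorm ((\<lambda>d. - (adj y p w \<bullet> d)) - (\<lambda>d. - (adj (x t) p w \<bullet> d))) \<le> e"
        by (simp add: fun_diff_def)
    next
      show "x t \<in> cball (x t) \<delta>'" using \<delta>(1) \<rho>_pos by (simp add: \<delta>'_def)
    qed
    then show ?thesis by (simp add: mult.commute)
  qed
  show ?thesis
    by (rule that[of \<delta>']) (use \<delta>(1) \<rho>_pos lin in \<open>auto simp: \<delta>'_def\<close>)
qed

section \<open>Measurability along the trajectory; costates as solutions of the adjoint
  equation\<close>

lemma f_compose_measurable:
  assumes z: "continuous_on {0..T} z" "\<And>t. t \<in> {0..T} \<Longrightarrow> z t \<in> X"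
    and U: "U \<in> borel_measurable (lebesgue_on {0..T})" "\<And>t. t \<in> {0..T} \<Longrightarrow> U t \<in> W"
  shows "(\<lambda>t. f (z t) (U t)) \<in> borel_measurable (lebesgue_on {0..T})"
proof -
  have "(\<lambda>t. (z t, U t)) \<in> borel_measurable (lebesgue_on {0..T})"
    using U(1) continuous_imp_measurable_on_sets_lebesgue[OF z(1)] by (intro borel_measurable_Pair) auto
  from measurable_continuous_on_compose[OF this _ f_cont] show ?thesis using z(2) U(2) by auto
qed

lemma adj_compose_measurable:
  assumes p: "continuous_on {0..T} p"
  shows "(\<lambda>t. adj (x t) (p t) (u t)) \<in> borel_measurable (lebesgue_on {0..T})"
proof -
  have "(\<lambda>t. (x t, p t, u t)) \<in> borel_measurable (lebesgue_on {0..T})"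
    using u_meas continuous_imp_measurable_on_sets_lebesgue[OF p] continuous_imp_measurable_on_sets_lebesgue[OF x_cont]
    by (intro borel_measurable_Pair) auto
  from measurable_continuous_on_compose[OF this _ adj_cont] show ?thesis using x_X u_W by auto
qed

text \<open>The integral form has no exceptional null set, so linear combinations and Gronwall apply
  to it directly.\<close>

definition costate :: "(real \<Rightarrow> 'a) \<Rightarrow> bool" where
  "costate p \<longleftrightarrow> continuous_on {0..T} p \<and>
     (\<forall>t\<in>{0..T}. ((\<lambda>s. adj (x s) (p s) (u s)) has_integral (p t - p 0)) {0..t})"

lemma costate_exists: "\<exists>p. costate p \<and> p 0 = e"
proof -
  have lin: "linear (\<lambda>p. adj (x t) p (u t))" if "t \<in> {0..T}" for t
    using that by (intro adj_linear x_X u_W)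
  have bnd: "norm (adj (x t) p (u t)) \<le> L * norm p" if "t \<in> {0..T}" for t p
    using that by (intro adj_bound[OF _ x_in_tube] u_W)
  obtain p where p: "continuous_on {0..T} p"
    "\<And>t. t \<in> {0..T} \<Longrightarrow> ((\<lambda>s. adj (x s) (p s) (u s)) has_integral (p t - e)) {0..t}"
  proof (rule picard_lindelof_caratheodory[where F = "\<lambda>t p. adj (x t) p (u t)" and T = T and L = L and c = e
        and M = "L * norm e"])
    fix t :: real and y z :: 'a assume t: "t \<in> {0..T}"
    show "norm (adj (x t) y (u t) - adj (x t) z (u t)) \<le> L * norm (y - z)"
      using bnd[OF t, of "y - z"] linear_diff[OF lin[OF t]] by simp
  next
    fix p :: "real \<Rightarrow> 'a" assume p: "continuous_on {0..T} p"
    then obtain P where P: "\<And>t. t \<in> {0..T} \<Longrightarrow> norm (p t) \<le> P"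
      using compact_imp_bounded[OF compact_continuous_image[OF p compact_Icc]] unfolding bounded_iff by blast
    show "(\<lambda>t. adj (x t) (p t) (u t)) integrable_on {0..T}"
    proof (rule bounded_measurable_integrable_on[OF adj_compose_measurable[OF p]])
      fix t assume t: "t \<in> {0..T}"
      show "norm (adj (x t) (p t) (u t)) \<le> L * P"
        using bnd[OF t, of "p t"] P[OF t] L_nonneg by (meson mult_left_mono order_trans)
    qed
  qed (use T_pos L_nonneg bnd that in auto)
  have "((\<lambda>s. adj (x s) (p s) (u s)) has_integral (p 0 - e)) {0..0}" using p(2)[of 0] T_pos by simp
  then have "p 0 - e = 0" 
    using has_integral_unique[of "\<lambda>s. adj (x s) (p s) (u s)" "p 0 - e" "{0}" 0] has_integral_refl(2)
    by (metis atLeastAtMost_singleton)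
  then have "p 0 = e" by simp
  then show ?thesis using p by (intro exI[of _ p]) (auto simp: costate_def)
qed

text \<open>Evaluation at any fixed time is therefore injective on costates. A nonzero normal vector
  yields a costate without zeros, and the values at 0 and at \<open>T\<close> determine each
  other.\<close>

lemma costate_zero:
  assumes p: "costate p" and t0: "t0 \<in> {0..T}" "p t0 = 0" and t: "t \<in> {0..T}"
  shows "p t = 0"
proof (rule linear_growth_zero[where f = "\<lambda>s. adj (x s) (p s) (u s)" and p = p, OF _ L_nonneg _ _ t0 t])
  show "continuous_on {0..T} p" using p by (simp add: costate_def)
  show "((\<lambda>s. adj (x s) (p s) (u s)) has_integral (p t - p s)) {s..t}"
    if "0 \<le> s" "s \<le> t" "t \<le> T" for s t
    by (rule primitive_has_integral[where c = "p 0" and T = T]) (use p that in \<open>auto simp: costate_def\<close>)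
  show "norm (adj (x s) (p s) (u s)) \<le> L * norm (p s)" if "s \<in> {0..T}" for s
    using that by (intro adj_bound[OF _ x_in_tube] u_W)
qed

lemma costate_sum:
  assumes p: "\<And>i. i \<in> I \<Longrightarrow> costate (p i)" and "finite I"
  shows "costate (\<lambda>t. \<Sum>i\<in>I. c i *\<^sub>R p i t)"
  unfolding costate_def
proof (intro conjI ballI)
  show "continuous_on {0..T} (\<lambda>t. \<Sum>i\<in>I. c i *\<^sub>R p i t)"
    using p by (intro continuous_intros) (auto simp: costate_def)
  fix t assume t: "t \<in> {0..T}"
  have "((\<lambda>s. \<Sum>i\<in>I. c i *\<^sub>R adj (x s) (p i s) (u s)) has_integral (\<Sum>i\<in>I. c i *\<^sub>R (p i t - p i 0))) {0..t}"
    using p t \<open>finite I\<close> by (intro has_integral_sum has_integral_cmul) (auto simp: costate_def)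
  moreover have "(\<Sum>i\<in>I. c i *\<^sub>R (p i t - p i 0)) = (\<Sum>i\<in>I. c i *\<^sub>R p i t) - (\<Sum>i\<in>I. c i *\<^sub>R p i 0)"
    by (simp add: scaleR_diff_right sum_subtractf)
  moreover have "(\<Sum>i\<in>I. c i *\<^sub>R adj (x s) (p i s) (u s)) = adj (x s) (\<Sum>i\<in>I. c i *\<^sub>R p i s) (u s)"
    if s: "s \<in> {0..t}" for s
  proof -
    have lin: "linear (\<lambda>p. adj (x s) p (u s))" using s t by (intro adj_linear x_X u_W) auto
    show ?thesis by (simp add: linear_sum[OF lin] linear_scale[OF lin])
  qed
  ultimately show "((\<lambda>s. adj (x s) (\<Sum>i\<in>I. c i *\<^sub>R p i s) (u s)) has_integral
      (\<Sum>i\<in>I. c i *\<^sub>R p i t) - (\<Sum>i\<in>I. c i *\<^sub>R p i 0)) {0..t}"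
    using has_integral_cong by (smt (verit, best))
qed

end

subsection \<open>Needle variations\<close>

lemma indicator_integral_le:
  fixes S :: "real set"
  assumes "S \<in> lmeasurable"
  shows "(indicator S :: real \<Rightarrow> real) integrable_on {a..b}"
    and "integral {a..b} (indicator S :: real \<Rightarrow> real) \<le> measure lebesgue S"
proof -
  have "S \<inter> {a..b} \<in> lmeasurable" using assms by (intro fmeasurable.Int) auto
  then show "(indicator S :: real \<Rightarrow> real) integrable_on {a..b}"
    by (simp add: integrable_on_indicator)
  have "integral {a..b} (indicator S :: real \<Rightarrow> real) = measure lebesgue (S \<inter> {a..b})"
    by (rule Equivalence_Lebesgue_Henstock_Integration.integral_indicator) fact
  also have "\<dots> \<le> measure lebesgue S"
    using assms \<open>S \<inter> {a..b} \<in> lmeasurable\<close> by (intro measure_mono_fmeasurable) auto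
  finally show "integral {a..b} (indicator S :: real \<Rightarrow> real) \<le> measure lebesgue S" .
qed

text \<open>The intervals are stacked to the left of their base points \<open>\<tau> i\<close>, so that those with the
  same base point are disjoint.\<close>

definition needle_interval :: "(nat \<Rightarrow> real) \<Rightarrow> (nat \<Rightarrow> real) \<Rightarrow> nat \<Rightarrow> real set" where
  "needle_interval \<tau> \<epsilon> i = {\<tau> i - sum \<epsilon> {..<Suc i} <.. \<tau> i - sum \<epsilon> {..<i}}"

lemma sum_lessThan_mono_nat:
  fixes \<epsilon> :: "nat \<Rightarrow> real"
  assumes "\<And>i. 0 \<le> \<epsilon> i" "i \<le> j"
  shows "sum \<epsilon> {..<i} \<le> sum \<epsilon> {..<j}"
  using assms by (intro sum_mono2) auto

lemma gap_exists:
  fixes \<tau> :: "nat \<Rightarrow> real"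
  obtains d where "0 < d" "\<And>i j. i < n \<Longrightarrow> j < n \<Longrightarrow> \<tau> i \<noteq> \<tau> j \<Longrightarrow> d \<le> \<bar>\<tau> i - \<tau> j\<bar>"
proof -
  \<comment> \<open>The extra 1 gives the minimum a value when all base points coincide.\<close>
  define A where "A = insert 1 ((\<lambda>(i, j). \<bar>\<tau> i - \<tau> j\<bar>) ` {(i, j). i < n \<and> j < n \<and> \<tau> i \<noteq> \<tau> j})"
  have "finite {(i, j). i < n \<and> j < n \<and> \<tau> i \<noteq> \<tau> j}"
    by (rule finite_subset[of _ "{..<n} \<times> {..<n}"]) auto
  then have A: "finite A" "A \<noteq> {}" by (auto simp: A_def)
  have "0 < Min A" using A by (subst Min_gr_iff) (auto simp: A_def)
  moreover have "Min A \<le> \<bar>\<tau> i - \<tau> j\<bar>" if "i < n" "j < n" "\<tau> i \<noteq> \<tau> j" for i j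
    using A that by (intro Min_le) (auto simp: A_def intro!: image_eqI[of _ _ "(i, j)"])
  ultimately show ?thesis using that by blast
qed

text \<open>At a common base point the partial sums are ordered. For distinct base points, a total
  length below their gap keeps the stacks apart.\<close>

lemma needle_interval_disjoint:
  assumes \<epsilon>: "\<And>i. 0 \<le> \<epsilon> i"
    and gap: "\<And>i j. i < n \<Longrightarrow> j < n \<Longrightarrow> \<tau> i \<noteq> \<tau> j \<Longrightarrow> d \<le> \<bar>\<tau> i - \<tau> j\<bar>"
    and small: "sum \<epsilon> {..<n} < d"
    and ij: "i < n" "j < n" "i \<noteq> j" and t: "t \<in> needle_interval \<tau> \<epsilon> i"
  shows "t \<notin> needle_interval \<tau> \<epsilon> j"
proof
  assume t': "t \<in> needle_interval \<tau> \<epsilon> j"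
  have b: "0 \<le> sum \<epsilon> {..<k}" "sum \<epsilon> {..<Suc k} \<le> sum \<epsilon> {..<n}" if "k < n" for k
    using that \<epsilon> by (auto intro!: sum_nonneg sum_lessThan_mono_nat simp del: sum.lessThan_Suc)
  show False
  proof (cases "\<tau> i = \<tau> j")
    case True
    have "sum \<epsilon> {..<Suc i} \<le> sum \<epsilon> {..<j} \<or> sum \<epsilon> {..<Suc j} \<le> sum \<epsilon> {..<i}"
      using sum_lessThan_mono_nat[where \<epsilon> = \<epsilon> and i = "Suc i" and j = j, OF \<epsilon>]
        sum_lessThan_mono_nat[where \<epsilon> = \<epsilon> and i = "Suc j" and j = i, OF \<epsilon>] ij by linarith
    then show False using t t' True by (auto simp: needle_interval_def)
  next
    case False
    then have "d \<le> \<bar>\<tau> i - \<tau> j\<bar>" using gap ij by blast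
    then show False
      using t t' b[OF ij(1)] b[OF ij(2)] small unfolding needle_interval_def greaterThanAtMost_iff by linarith
  qed
qed

lemma needle_interval_measure:
  assumes "\<And>i. 0 \<le> \<epsilon> i"
  shows "(\<Union>i<n. needle_interval \<tau> \<epsilon> i) \<in> lmeasurable"
    and "measure lebesgue (\<Union>i<n. needle_interval \<tau> \<epsilon> i) \<le> sum \<epsilon> {..<n}"
proof -
  have m: "needle_interval \<tau> \<epsilon> i \<in> lmeasurable" "measure lebesgue (needle_interval \<tau> \<epsilon> i) = \<epsilon> i" for i
    using assms[of i] by (auto simp: needle_interval_def intro!: bounded_set_imp_lmeasurable)
  show "(\<Union>i<n. needle_interval \<tau> \<epsilon> i) \<in> lmeasurable" using m by (intro fmeasurable.finite_UN) auto
  have "measure lebesgue (\<Union>i<n. needle_interval \<tau> \<epsilon> i) \<le> (\<Sum>i<n. measure lebesgue (needle_interval \<tau> \<epsilon> i))"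
    using m by (intro measure_UNION_le) (auto simp: fmeasurableD)
  then show "measure lebesgue (\<Union>i<n. needle_interval \<tau> \<epsilon> i) \<le> sum \<epsilon> {..<n}" using m by simp
qed

text \<open>A stacked needle is the interval from \<tau> - \<beta> to \<tau> - \<alpha> and need not
  touch \<tau>. Its error is therefore small relative to \<beta>, not to its own length, and the
  later estimates are in terms of the total length of all needles.\<close>

lemma has_real_derivative_two_sided:
  assumes "(H has_real_derivative h) (at \<tau>)" "0 < e"
  obtains \<delta> where "0 < \<delta>" "\<And>\<alpha> \<beta>. 0 \<le> \<alpha> \<Longrightarrow> \<alpha> \<le> \<beta> \<Longrightarrow> \<beta> \<le> \<delta> \<Longrightarrow>
    \<bar>H (\<tau> - \<alpha>) - H (\<tau> - \<beta>) - (\<beta> - \<alpha>) * h\<bar> \<le> 2 * e * \<beta>"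
proof -
  have "(H has_derivative (\<lambda>x. h * x)) (at \<tau>)"
    using assms(1) by (simp add: has_field_derivative_def)
  then obtain d where d: "0 < d" "\<And>y. \<bar>y - \<tau>\<bar> < d \<Longrightarrow> \<bar>H y - H \<tau> - h * (y - \<tau>)\<bar> \<le> e * \<bar>y - \<tau>\<bar>"
    using \<open>0 < e\<close> unfolding has_derivative_within_alt by (auto simp: real_norm_def)
  show ?thesis
  proof (rule that[of "d / 2"])
    fix \<alpha> \<beta> :: real assume a: "0 \<le> \<alpha>" "\<alpha> \<le> \<beta>" "\<beta> \<le> d / 2"
    have "\<bar>H (\<tau> - \<alpha>) - H \<tau> - h * (- \<alpha>)\<bar> \<le> e * \<alpha>" "\<bar>H (\<tau> - \<beta>) - H \<tau> - h * (- \<beta>)\<bar> \<le> e * \<beta>"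
      using d(2)[of "\<tau> - \<alpha>"] d(2)[of "\<tau> - \<beta>"] a d(1) by auto
    moreover have "e * \<alpha> \<le> e * \<beta>" using a \<open>0 < e\<close> by simp
    ultimately show "\<bar>H (\<tau> - \<alpha>) - H (\<tau> - \<beta>) - (\<beta> - \<alpha>) * h\<bar> \<le> 2 * e * \<beta>"
      by (simp add: algebra_simps)
  qed (use d in simp)
qed

lemma norm_triangle_ineq3_sum:
  fixes x y z :: "'a::real_normed_vector"
  shows "norm (x + y + z) \<le> norm x + norm y + norm z"
  using norm_triangle_ineq[of "x + y" z] norm_triangle_ineq[of x y] by linarith

section \<open>Flows perturbed by needles and by a change of speed\<close>

context control_trajectory
begin

text \<open>Projecting onto the tube makes the vector field globally bounded and Lipschitz; flows that
  stay in the tube solve the original equation.\<close>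

definition clip :: "real \<Rightarrow> 'a \<Rightarrow> 'a" where
  "clip t z = x t + closest_point (cball 0 \<rho>) (z - x t)"

lemma clip_in: "clip t z \<in> cball (x t) \<rho>"
  using closest_point_in_set[of "cball (0::'a) \<rho>" "z - x t"] \<rho>_pos by (auto simp: clip_def dist_norm)

lemma clip_id: "norm (z - x t) \<le> \<rho> \<Longrightarrow> clip t z = z"
  by (simp add: clip_def closest_point_self)

lemma clip_lipschitz: "norm (clip t y - clip t z) \<le> norm (y - z)"
  using closest_point_lipschitz[of "cball (0::'a) \<rho>" "y - x t" "z - x t"] \<rho>_pos
  by (simp add: clip_def dist_norm)

lemma clip_continuous: "continuous_on {0..T} z \<Longrightarrow> continuous_on {0..T} (\<lambda>t. clip t (z t))"
  unfolding clip_def using \<rho>_pos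
  by (intro continuous_on_add x_cont continuous_on_compose2[OF continuous_on_closest_point[of "cball 0 \<rho>" UNIV]]
      continuous_on_diff) auto

definition control :: "(real \<Rightarrow> 'u) \<Rightarrow> bool" where
  "control U \<longleftrightarrow> U \<in> borel_measurable (lebesgue_on {0..T}) \<and> (\<forall>t\<in>{0..T}. U t \<in> W)"

text \<open>The speed factor encodes the final time (1 + a) T, while all flows live on the same
  interval and can be compared pointwise.\<close>

definition is_flow :: "real \<Rightarrow> (real \<Rightarrow> 'u) \<Rightarrow> (real \<Rightarrow> 'a) \<Rightarrow> bool" where
  "is_flow a U z \<longleftrightarrow> continuous_on {0..T} z \<and>
     (\<forall>t\<in>{0..T}. ((\<lambda>s. (1 + a) *\<^sub>R f (clip s (z s)) (U s)) has_integral (z t - x 0)) {0..t})"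

lemma control_u: "control u"
  using u_meas u_W by (simp add: control_def)

lemma clip_f_bound: "control U \<Longrightarrow> t \<in> {0..T} \<Longrightarrow> norm (f (clip t y) (U t)) \<le> M"
  unfolding control_def by (intro f_bound[OF _ clip_in]) auto

lemma clip_f_integrable:
  assumes "control U" "continuous_on {0..T} z"
  shows "(\<lambda>t. f (clip t (z t)) (U t)) integrable_on {0..T}"
proof (rule bounded_measurable_integrable_on[where B = M])
  show "(\<lambda>t. f (clip t (z t)) (U t)) \<in> borel_measurable (lebesgue_on {0..T})"
    using assms tube_X[OF _ clip_in] by (intro f_compose_measurable clip_continuous) (auto simp: control_def)
  show "norm (f (clip t (z t)) (U t)) \<le> M" if "t \<in> {0..T}" for t
    using that assms by (intro clip_f_bound)
qed

lemma flow_exists: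
  assumes U: "control U"
  shows "\<exists>z. is_flow a U z"
proof -
  obtain z where "continuous_on {0..T} z"
    "\<And>t. t \<in> {0..T} \<Longrightarrow> ((\<lambda>s. (1 + a) *\<^sub>R f (clip s (z s)) (U s)) has_integral (z t - x 0)) {0..t}"
  proof (rule picard_lindelof_caratheodory[where F = "\<lambda>t z. (1 + a) *\<^sub>R f (clip t z) (U t)" and T = T
        and L = "\<bar>1 + a\<bar> * L" and c = "x 0" and M = "\<bar>1 + a\<bar> * M"])
    fix t :: real and y z :: 'a assume t: "t \<in> {0..T}"
    have "norm (f (clip t y) (U t) - f (clip t z) (U t)) \<le> L * norm (clip t y - clip t z)"
      using U t by (intro f_lipschitz[OF t clip_in clip_in]) (auto simp: control_def)
    also have "\<dots> \<le> L * norm (y - z)" using L_nonneg clip_lipschitz by (intro mult_left_mono)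
    finally have "\<bar>1 + a\<bar> * norm (f (clip t y) (U t) - f (clip t z) (U t)) \<le> \<bar>1 + a\<bar> * (L * norm (y - z))"
      by (intro mult_left_mono) auto
    then show "norm ((1 + a) *\<^sub>R f (clip t y) (U t) - (1 + a) *\<^sub>R f (clip t z) (U t)) \<le> \<bar>1 + a\<bar> * L * norm (y - z)"
      by (simp flip: scaleR_diff_right)
  next
    fix t :: real assume t: "t \<in> {0..T}"
    show "norm ((1 + a) *\<^sub>R f (clip t (x 0)) (U t)) \<le> \<bar>1 + a\<bar> * M"
      using clip_f_bound[OF U t] by (simp add: mult_left_mono)
  next
    fix y :: "real \<Rightarrow> 'a" assume "continuous_on {0..T} y"
    then show "(\<lambda>t. (1 + a) *\<^sub>R f (clip t (y t)) (U t)) integrable_on {0..T}"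
      by (intro integrable_cmul clip_f_integrable U)
  qed (use T_pos L_nonneg that in auto)
  then show ?thesis unfolding is_flow_def by blast
qed

lemma x_is_flow: "is_flow 0 u x"
  using x_cont x_primitive \<rho>_pos by (simp add: is_flow_def clip_id)

text \<open>The difference of the integrands splits into a change of state (Lipschitz), of control
  (nonzero only on \<open>S\<close>) and of speed. The factors 2 and 4 come from |1 + a| <= 2 and
  from the bound 2 M for a change of control.\<close>

lemma flow_compare:
  assumes U: "control U" "control U'" and a: "\<bar>a\<bar> \<le> 1" "\<bar>a'\<bar> \<le> 1"
    and z: "is_flow a U z" "is_flow a' U' z'"
    and S: "S \<in> lmeasurable" "\<And>t. t \<in> {0..T} - S \<Longrightarrow> U t = U' t" and t: "t \<in> {0..T}"
  shows "norm (z t - z' t) \<le> (\<bar>a - a'\<bar> * M * T + 4 * M * measure lebesgue S) * exp (2 * L * t)"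
proof (rule integral_comparison[where T = T and c = "x 0" and f = "\<lambda>s. (1 + a) *\<^sub>R f (clip s (z s)) (U s)"
      and g = "\<lambda>s. (1 + a') *\<^sub>R f (clip s (z' s)) (U' s)" and e = "\<lambda>s. \<bar>a - a'\<bar> * M + 4 * M * indicator S s"])
  fix s assume s: "s \<in> {0..T}"
  let ?A = "f (clip s (z s)) (U s)" and ?B = "f (clip s (z' s)) (U s)" and ?C = "f (clip s (z' s)) (U' s)"
  have 1: "norm (?A - ?B) \<le> L * norm (z s - z' s)"
  proof -
    have "norm (?A - ?B) \<le> L * norm (clip s (z s) - clip s (z' s))"
      using U s by (intro f_lipschitz[OF s clip_in clip_in]) (auto simp: control_def)
    also have "\<dots> \<le> L * norm (z s - z' s)" using L_nonneg clip_lipschitz by (intro mult_left_mono)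
    finally show ?thesis .
  qed
  have 2: "norm (?B - ?C) \<le> 2 * M * indicator S s"
  proof (cases "s \<in> S")
    case True
    then show ?thesis
      using norm_triangle_ineq4[of ?B ?C] clip_f_bound[OF U(1) s, of "z' s"] clip_f_bound[OF U(2) s, of "z' s"] by simp
  qed (use S(2) s in simp)
  have 3: "norm ?C \<le> M" by (rule clip_f_bound[OF U(2) s])
  have "norm ((1 + a) *\<^sub>R ?A - (1 + a') *\<^sub>R ?C)
      = norm ((1 + a) *\<^sub>R (?A - ?B) + (1 + a) *\<^sub>R (?B - ?C) + (a - a') *\<^sub>R ?C)"
    by (simp add: algebra_simps)
  moreover have "norm ((1 + a) *\<^sub>R (?A - ?B) + (1 + a) *\<^sub>R (?B - ?C) + (a - a') *\<^sub>R ?C)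
      \<le> \<bar>1 + a\<bar> * norm (?A - ?B) + \<bar>1 + a\<bar> * norm (?B - ?C) + \<bar>a - a'\<bar> * norm ?C"
    using norm_triangle_ineq3_sum[of "(1 + a) *\<^sub>R (?A - ?B)" "(1 + a) *\<^sub>R (?B - ?C)" "(a - a') *\<^sub>R ?C"]
    unfolding norm_scaleR .
  moreover have "\<bar>1 + a\<bar> * norm (?A - ?B) \<le> 2 * (L * norm (z s - z' s))"
    using a 1 by (intro mult_mono) auto
  moreover have "\<bar>1 + a\<bar> * norm (?B - ?C) \<le> 2 * (2 * M * indicator S s)"
    using a 2 by (intro mult_mono) auto
  moreover have "\<bar>a - a'\<bar> * norm ?C \<le> \<bar>a - a'\<bar> * M"
    using 3 by (intro mult_left_mono) auto
  moreover have "2 * L * norm (z s - z' s) = 2 * (L * norm (z s - z' s))" "4 * M * indicator S s = 2 * (2 * M * indicator S s)"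
    by simp_all
  ultimately show "norm ((1 + a) *\<^sub>R ?A - (1 + a') *\<^sub>R ?C) \<le> 2 * L * norm (z s - z' s) + (\<bar>a - a'\<bar> * M + 4 * M * indicator S s)"
    by (simp only:)
next
  note ind = indicator_integral_le[OF S(1), of 0 T]
  show "(\<lambda>s. \<bar>a - a'\<bar> * M + 4 * M * indicator S s) integrable_on {0..T}"
    using ind(1) by (intro integrable_add integrable_on_mult_right) auto
  have "integral {0..T} (\<lambda>s. \<bar>a - a'\<bar> * M + 4 * M * indicator S s)
      = \<bar>a - a'\<bar> * M * T + 4 * M * integral {0..T} (indicator S)"
    using ind(1) T_pos by (subst integral_add) (auto intro!: integrable_on_mult_right)
  then show "integral {0..T} (\<lambda>s. \<bar>a - a'\<bar> * M + 4 * M * indicator S s) \<le> \<bar>a - a'\<bar> * M * T + 4 * M * measure lebesgue S"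
    using ind(2) M_nonneg by (simp add: mult_left_mono)
qed (use z t L_nonneg M_nonneg in \<open>auto simp: is_flow_def\<close>)

lemma flow_0: "is_flow a U z \<Longrightarrow> z 0 = x 0"
proof -
  assume "is_flow a U z"
  then have "((\<lambda>s. (1 + a) *\<^sub>R f (clip s (z s)) (U s)) has_integral (z 0 - x 0)) {0}"
    using T_pos unfolding is_flow_def by (metis atLeastAtMost_iff atLeastAtMost_singleton less_imp_le order_refl)
  from has_integral_unique[OF this has_integral_refl(2)] show "z 0 = x 0" by simp
qed

text \<open>The first-order change of \<open>p T \<bullet> x T\<close> per unit of a variation that combines the speed factor
  \<open>\<sigma>\<close> with a needle of value \<open>w\<close> at time \<open>t\<close>.\<close>

definition gain :: "(real \<Rightarrow> 'a) \<Rightarrow> real \<Rightarrow> real \<Rightarrow> 'u \<Rightarrow> real" where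
  "gain p \<sigma> t w = \<sigma> * integral {0..T} (\<lambda>r. p r \<bullet> f (x r) (u r)) + p t \<bullet> (f (x t) w - f (x t) (u t))"

definition lebesgue_point :: "(real \<Rightarrow> 'a) \<Rightarrow> real \<Rightarrow> bool" where
  "lebesgue_point p t \<longleftrightarrow> t \<in> {0<..<T} \<and>
     ((\<lambda>t. integral {0..t} (\<lambda>r. p r \<bullet> f (x r) (u r))) has_real_derivative p t \<bullet> f (x t) (u t)) (at t)"

definition needle_control :: "(nat \<Rightarrow> real) \<Rightarrow> (nat \<Rightarrow> 'u) \<Rightarrow> nat \<Rightarrow> (nat \<Rightarrow> real) \<Rightarrow> real \<Rightarrow> 'u" where
  "needle_control \<tau> w n \<epsilon> = needle (needle_interval \<tau> \<epsilon>) w u n"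

lemma needle_control: "(\<And>i. i < n \<Longrightarrow> w i \<in> W) \<Longrightarrow> control (needle_control \<tau> w n \<epsilon>)"
  unfolding control_def needle_control_def
  using u_meas u_W by (auto intro!: needle_measurable needle_range simp: needle_interval_def)

lemma inner_f_integrable:
  assumes p: "continuous_on {0..T} p" and U: "control U"
  shows "(\<lambda>r. p r \<bullet> f (x r) (U r)) integrable_on {0..T}"
proof -
  obtain P where P: "\<And>t. t \<in> {0..T} \<Longrightarrow> norm (p t) \<le> P"
    using compact_imp_bounded[OF compact_continuous_image[OF p compact_Icc]] unfolding bounded_iff by blast
  have "0 \<le> P" using order_trans[OF norm_ge_zero P[of 0]] T_pos by simp
  show ?thesis
  proof (rule bounded_measurable_integrable_on[where B = "P * M"])
    show "(\<lambda>r. p r \<bullet> f (x r) (U r)) \<in> borel_measurable (lebesgue_on {0..T})"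
      using U x_X continuous_imp_measurable_on_sets_lebesgue[OF p]
      by (intro borel_measurable_inner f_compose_measurable x_cont) (auto simp: control_def)
    fix t assume t: "t \<in> {0..T}"
    have "norm (f (x t) (U t)) \<le> M" using U t by (intro f_bound[OF _ x_in_tube]) (auto simp: control_def)
    then show "norm (p t \<bullet> f (x t) (U t)) \<le> P * M"
      using Cauchy_Schwarz_ineq2[of "p t" "f (x t) (U t)"] P[OF t] \<open>0 \<le> P\<close>
      by (smt (verit, best) mult_mono norm_ge_zero real_norm_def)
  qed
qed

lemma lebesgue_point_AE:
  assumes p: "continuous_on {0..T} p"
  obtains N where "negligible N" "\<And>t. t \<in> {0..T} - N \<Longrightarrow> lebesgue_point p t"
proof -
  obtain N where "negligible N" "\<And>t. t \<in> {0..T} - N \<Longrightarrow> t \<in> {0<..<T}"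
    "\<And>t. t \<in> {0..T} - N \<Longrightarrow> ((\<lambda>t. integral {0..t} (\<lambda>r. p r \<bullet> f (x r) (u r))) has_vector_derivative p t \<bullet> f (x t) (u t)) (at t)"
    by (rule indefinite_integral_has_vector_derivative_AE[OF inner_f_integrable[OF p control_u]]) (rule that)
  then show ?thesis
    by (intro that[of N]) (auto simp: lebesgue_point_def has_real_derivative_iff_has_vector_derivative)
qed

lemma needle_gain_derivative:
  assumes p: "continuous_on {0..T} p" and t: "lebesgue_point p t" and w: "w \<in> W"
  shows "((\<lambda>t. integral {0..t} (\<lambda>r. p r \<bullet> (f (x r) w - f (x r) (u r)))) has_real_derivative
      p t \<bullet> (f (x t) w - f (x t) (u t))) (at t)"
proof -
  have t': "0 < t" "t < T" using t by (auto simp: lebesgue_point_def)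
  have cw: "control (\<lambda>_. w)" using w by (simp add: control_def)
  note i1 = inner_f_integrable[OF p cw] and i2 = inner_f_integrable[OF p control_u]
  have "continuous_on {0..T} (\<lambda>r. (\<lambda>(y, w). f y w) (x r, w))"
    by (rule continuous_on_compose2[OF f_cont]) (use x_cont x_X w in \<open>auto intro!: continuous_intros\<close>)
  then have "continuous_on {0..T} (\<lambda>r. f (x r) w)" by simp
  then have c: "continuous_on {0..T} (\<lambda>r. p r \<bullet> f (x r) w)"
    by (intro continuous_intros p)
  have "((\<lambda>t. integral {0..t} (\<lambda>r. p r \<bullet> f (x r) w)) has_vector_derivative p t \<bullet> f (x t) w) (at t within {0..T})"
    using integral_has_vector_derivative[OF c, of t] t' by auto
  then have "((\<lambda>t. integral {0..t} (\<lambda>r. p r \<bullet> f (x r) w)) has_real_derivative p t \<bullet> f (x t) w) (at t)"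
    using t' at_within_interior[of t "{0..T}"] by (auto simp: has_real_derivative_iff_has_vector_derivative)
  from DERIV_diff[OF this] t
  have d: "((\<lambda>t. integral {0..t} (\<lambda>r. p r \<bullet> f (x r) w) - integral {0..t} (\<lambda>r. p r \<bullet> f (x r) (u r)))
      has_real_derivative p t \<bullet> (f (x t) w - f (x t) (u t))) (at t)"
    by (simp add: lebesgue_point_def inner_diff_right)
  show ?thesis
  proof (rule has_field_derivative_transform_within_open[OF d open_greaterThanLessThan[of 0 T]])
    fix s assume "s \<in> {0<..<T}"
    then have "{0..s} \<subseteq> {0..T}" by auto
    then show "integral {0..s} (\<lambda>r. p r \<bullet> f (x r) w) - integral {0..s} (\<lambda>r. p r \<bullet> f (x r) (u r))
        = integral {0..s} (\<lambda>r. p r \<bullet> (f (x r) w - f (x r) (u r)))"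
      using integral_diff[OF integrable_subinterval_real[OF i1] integrable_subinterval_real[OF i2]]
      by (simp add: inner_diff_right)
  qed (use t' in auto)
qed

lemma needle_interval_integral:
  assumes p: "continuous_on {0..T} p" and w: "w \<in> W" and "\<And>i. 0 \<le> \<epsilon> i"
    and pos: "0 \<le> \<tau> i - sum \<epsilon> {..<Suc i}" and lt: "\<tau> i \<le> T"
  shows "((\<lambda>r. if r \<in> needle_interval \<tau> \<epsilon> i then p r \<bullet> (f (x r) w - f (x r) (u r)) else 0) has_integral
    (integral {0..\<tau> i - sum \<epsilon> {..<i}} (\<lambda>r. p r \<bullet> (f (x r) w - f (x r) (u r)))
     - integral {0..\<tau> i - sum \<epsilon> {..<Suc i}} (\<lambda>r. p r \<bullet> (f (x r) w - f (x r) (u r))))) {0..T}"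
proof -
  define h where "h r = p r \<bullet> (f (x r) w - f (x r) (u r))" for r
  define lo hi where "lo = \<tau> i - sum \<epsilon> {..<Suc i}" and "hi = \<tau> i - sum \<epsilon> {..<i}"
  have "0 \<le> sum \<epsilon> {..<i}" using assms(3) by (intro sum_nonneg)
  then have lohi: "0 \<le> lo" "lo \<le> hi" "hi \<le> T"
    using assms(3)[of i] pos lt by (auto simp: lo_def hi_def)
  have cw: "control (\<lambda>_. w)" using w by (simp add: control_def)
  have h: "h integrable_on {0..T}"
    unfolding h_def inner_diff_right
    by (intro integrable_diff inner_f_integrable[OF p cw] inner_f_integrable[OF p control_u])
  have "h integrable_on {0..lo}" "h integrable_on {lo..hi}" "h integrable_on {0..hi}"
    using lohi by (auto intro!: integrable_subinterval_real[OF h])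
  then have "(h has_integral (integral {0..hi} h - integral {0..lo} h)) {lo..hi}"
    using Henstock_Kurzweil_Integration.integral_combine[of 0 lo hi h] lohi
    by (simp add: has_integral_iff algebra_simps)
  then have "((\<lambda>r. if r \<in> {lo..hi} then h r else 0) has_integral (integral {0..hi} h - integral {0..lo} h)) {0..T}"
    using lohi by (subst has_integral_restrict) auto
  then have "((\<lambda>r. if r \<in> needle_interval \<tau> \<epsilon> i then h r else 0) has_integral (integral {0..hi} h - integral {0..lo} h)) {0..T}"
    by (rule has_integral_spike[of "{lo}", rotated 2]) (auto simp: needle_interval_def lo_def hi_def)
  then show ?thesis unfolding h_def lo_def hi_def .
qed

text \<open>The speed change and the measure of the modified set are both bounded by multiples of
  the total length of the needles, which is the small parameter throughout.\<close>

lemma needle_variation_estimate: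
  assumes w: "\<forall>i<n. w i \<in> W"
  shows "\<exists>C \<delta>. 0 \<le> C \<and> 0 < \<delta> \<and>
    (\<forall>\<epsilon> z. (\<forall>i. 0 \<le> \<epsilon> i) \<longrightarrow> sum \<epsilon> {..<n} \<le> \<delta> \<longrightarrow>
       is_flow (\<Sum>i<n. \<epsilon> i * \<sigma> i) (needle_control \<tau> w n \<epsilon>) z \<longrightarrow>
       \<bar>\<Sum>i<n. \<epsilon> i * \<sigma> i\<bar> \<le> 1 / 2 \<and> (\<forall>t\<in>{0..T}. norm (z t - x t) \<le> C * sum \<epsilon> {..<n} \<and> norm (z t - x t) < \<rho>))"
proof -
  define S where "S = (\<Sum>i<n. \<bar>\<sigma> i\<bar>)"
  have "0 \<le> S" by (simp add: S_def sum_nonneg)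
  define C where "C = (S * M * T + 4 * M) * exp (2 * L * T)"
  have "0 \<le> C" using \<open>0 \<le> S\<close> M_nonneg T_pos by (simp add: C_def)
  \<comment> \<open>The first bound gives |a| <= 1/2, the second keeps the flow within \<rho> / 2 of
    \<open>x\<close>, where the clipping is inactive.\<close>
  define \<delta> where "\<delta> = min (1 / (2 * (S + 1))) (\<rho> / (2 * (C + 1)))"
  have "0 < \<delta>" using \<open>0 \<le> S\<close> \<open>0 \<le> C\<close> \<rho>_pos by (simp add: \<delta>_def)
  have est: "\<bar>\<Sum>i<n. \<epsilon> i * \<sigma> i\<bar> \<le> 1 / 2 \<and> (\<forall>t\<in>{0..T}. norm (z t - x t) \<le> C * sum \<epsilon> {..<n} \<and> norm (z t - x t) < \<rho>)"
    if \<epsilon>: "\<And>i. 0 \<le> \<epsilon> i" and E: "sum \<epsilon> {..<n} \<le> \<delta>"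
      and z: "is_flow (\<Sum>i<n. \<epsilon> i * \<sigma> i) (needle_control \<tau> w n \<epsilon>) z" for \<epsilon> z
  proof -
    define E where "E = sum \<epsilon> {..<n}"
    define a where "a = (\<Sum>i<n. \<epsilon> i * \<sigma> i)"
    have "0 \<le> E" using \<epsilon> by (simp add: E_def sum_nonneg)
    have "\<epsilon> i \<le> E" if "i < n" for i
      unfolding E_def using \<epsilon> that by (intro member_le_sum) auto
    then have "\<bar>a\<bar> \<le> (\<Sum>i<n. E * \<bar>\<sigma> i\<bar>)"
      unfolding a_def using \<epsilon> by (intro order_trans[OF sum_abs] sum_mono) (auto simp: abs_mult intro!: mult_right_mono)
    then have aE: "\<bar>a\<bar> \<le> S * E" by (simp add: S_def sum_distrib_left mult.commute)
    have "E \<le> 1 / (2 * (S + 1))" using E by (simp add: E_def \<delta>_def)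
    then have "(S + 1) * E \<le> 1 / 2" using \<open>0 \<le> S\<close> by (simp add: field_simps)
    then have a12: "\<bar>a\<bar> \<le> 1 / 2" using aE \<open>0 \<le> E\<close> by (simp add: algebra_simps)
    have "E \<le> \<rho> / (2 * (C + 1))" using E by (simp add: E_def \<delta>_def)
    then have "(C + 1) * E \<le> \<rho> / 2" using \<open>0 \<le> C\<close> by (simp add: field_simps)
    then have "C * E \<le> \<rho> / 2" using \<open>0 \<le> E\<close> by (simp add: algebra_simps)
    then have CE: "C * E < \<rho>" using \<rho>_pos by linarith
    have "norm (z t - x t) \<le> C * E" if t: "t \<in> {0..T}" for t
    proof -
      have "norm (z t - x t) \<le> (\<bar>a - 0\<bar> * M * T + 4 * M * measure lebesgue (\<Union>i<n. needle_interval \<tau> \<epsilon> i)) * exp (2 * L * t)"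
      proof (rule flow_compare[OF needle_control[OF w[rule_format]] control_u _ _ z[folded a_def] x_is_flow needle_interval_measure(1)[OF \<epsilon>] _ t])
        fix s assume "s \<in> {0..T} - (\<Union>i<n. needle_interval \<tau> \<epsilon> i)"
        then show "needle_control \<tau> w n \<epsilon> s = u s" unfolding needle_control_def by (intro needle_outside) auto
      qed (use a12 in auto)
      also have "\<dots> \<le> (S * E * M * T + 4 * M * E) * exp (2 * L * T)"
        using aE M_nonneg T_pos L_nonneg t needle_interval_measure(2)[where n = n and \<tau> = \<tau> and \<epsilon> = \<epsilon>, OF \<epsilon>] \<open>0 \<le> S\<close> \<open>0 \<le> E\<close>
        by (intro mult_mono add_mono) (auto simp: E_def intro!: mult_left_mono)
      also have "\<dots> = C * E" by (simp add: C_def algebra_simps)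
      finally show ?thesis .
    qed
    then show ?thesis using a12 CE unfolding a_def E_def by fastforce
  qed
  show ?thesis
    by (rule exI[of _ C], rule exI[of _ \<delta>], intro conjI[OF \<open>0 \<le> C\<close> conjI[OF \<open>0 < \<delta>\<close>]] allI impI est) simp_all
qed

text \<open>No variational equation is solved. The product p \<bullet> (z - x) is differentiated
  along the flow, and the adjoint term cancels the part linear in z - x. What remains is the
  integral of the needle and speed contributions, up to an error small relative to the total
  length.\<close>

lemma needle_first_order:
  assumes p: "costate p" and w: "\<And>i. i < n \<Longrightarrow> w i \<in> W"
    and \<tau>: "\<And>i. i < n \<Longrightarrow> lebesgue_point p (\<tau> i)" and "0 < e"
  shows "\<exists>\<delta>>0. \<forall>\<epsilon> z. (\<forall>i. 0 \<le> \<epsilon> i) \<longrightarrow> sum \<epsilon> {..<n} \<le> \<delta> \<longrightarrow>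
       is_flow (\<Sum>i<n. \<epsilon> i * \<sigma> i) (needle_control \<tau> w n \<epsilon>) z \<longrightarrow>
       \<bar>p T \<bullet> (z T - x T) - (\<Sum>i<n. \<epsilon> i * gain p (\<sigma> i) (\<tau> i) (w i))\<bar> \<le> e * sum \<epsilon> {..<n}"
proof -
  have pc: "continuous_on {0..T} p" using p by (simp add: costate_def)
  have \<tau>': "\<tau> i \<in> {0<..<T}" if "i < n" for i using \<tau>[OF that] by (simp add: lebesgue_point_def)
  obtain P0 where P0: "\<And>t. t \<in> {0..T} \<Longrightarrow> norm (p t) \<le> P0"
    using compact_imp_bounded[OF compact_continuous_image[OF pc compact_Icc]] unfolding bounded_iff by blast
  define P where "P = max 0 P0"
  have P: "0 \<le> P" "\<And>t. t \<in> {0..T} \<Longrightarrow> norm (p t) \<le> P" using P0 by (auto simp: P_def le_max_iff_disj)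
  have w': "\<forall>i<n. w i \<in> W" using w by blast
  obtain C \<delta>1 where C: "0 \<le> C" "0 < \<delta>1" and C_est: "\<forall>\<epsilon> z. (\<forall>i. 0 \<le> \<epsilon> i) \<longrightarrow> sum \<epsilon> {..<n} \<le> \<delta>1 \<longrightarrow>
       is_flow (\<Sum>i<n. \<epsilon> i * \<sigma> i) (needle_control \<tau> w n \<epsilon>) z \<longrightarrow>
       \<bar>\<Sum>i<n. \<epsilon> i * \<sigma> i\<bar> \<le> 1 / 2 \<and> (\<forall>t\<in>{0..T}. norm (z t - x t) \<le> C * sum \<epsilon> {..<n} \<and> norm (z t - x t) < \<rho>)"
    using needle_variation_estimate[where n = n and w = w and \<tau> = \<tau> and \<sigma> = \<sigma>, OF w'] by (elim exE conjE) (rule that)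
  define S where "S = (\<Sum>i<n. \<bar>\<sigma> i\<bar>)"
  have "0 \<le> S" by (simp add: S_def sum_nonneg)
  \<comment> \<open>The allowed error is divided into thirds: linearization over
    \<open>{0..T}\<close>, averages over the needles (\<open>\<eta>2\<close>), and terms quadratic
    in the total length (\<open>K\<close>).\<close>
  define \<eta>1 where "\<eta>1 = e / (3 * (T * C + 1))"
  have TC: "0 \<le> T * C" using T_pos C(1) by simp
  have \<eta>1: "0 < \<eta>1" "T * \<eta>1 * C \<le> e / 3" using TC \<open>0 < e\<close> by (simp_all add: \<eta>1_def field_simps)
  obtain \<delta>2 where \<delta>2: "0 < \<delta>2" "\<delta>2 \<le> \<rho>" and lin: "\<And>t d w p. t \<in> {0..T} \<Longrightarrow> norm d \<le> \<delta>2 \<Longrightarrow> w \<in> W \<Longrightarrow> norm p \<le> P \<Longrightarrow>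
       \<bar>p \<bullet> f (x t + d) w - p \<bullet> f (x t) w + adj (x t) p w \<bullet> d\<bar> \<le> \<eta>1 * norm d"
    by (rule f_linearization[OF \<eta>1(1), where P = P]) (rule that)
  define \<eta>2 where "\<eta>2 = e / (3 * (2 * real n + 1))"
  have \<eta>2: "0 < \<eta>2" "2 * real n * \<eta>2 \<le> e / 3" using \<open>0 < e\<close> by (simp_all add: \<eta>2_def field_simps)
  define h where "h i r = p r \<bullet> (f (x r) (w i) - f (x r) (u r))" for i r
  define H where "H i t = integral {0..t} (h i)" for i t
  have "\<exists>d>0. \<forall>\<alpha> \<beta>. 0 \<le> \<alpha> \<longrightarrow> \<alpha> \<le> \<beta> \<longrightarrow> \<beta> \<le> d \<longrightarrow>
      \<bar>H i (\<tau> i - \<alpha>) - H i (\<tau> i - \<beta>) - (\<beta> - \<alpha>) * h i (\<tau> i)\<bar> \<le> 2 * \<eta>2 * \<beta> \<and> 0 \<le> \<tau> i - \<beta>" if i: "i < n" for i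
  proof -
    have "(H i has_real_derivative h i (\<tau> i)) (at (\<tau> i))"
      using needle_gain_derivative[OF pc \<tau>[OF i] w[OF i]] unfolding H_def h_def .
    then obtain d where d: "0 < d" "\<And>\<alpha> \<beta>. 0 \<le> \<alpha> \<Longrightarrow> \<alpha> \<le> \<beta> \<Longrightarrow> \<beta> \<le> d \<Longrightarrow>
        \<bar>H i (\<tau> i - \<alpha>) - H i (\<tau> i - \<beta>) - (\<beta> - \<alpha>) * h i (\<tau> i)\<bar> \<le> 2 * \<eta>2 * \<beta>"
      by (rule has_real_derivative_two_sided[OF _ \<eta>2(1)]) (rule that)
    \<comment> \<open>The bound by \<open>\<tau> i\<close> keeps the needles inside
      \<open>{0..T}\<close>.\<close>
    show ?thesis using d \<tau>'[OF i] by (intro exI[of _ "min d (\<tau> i)"]) auto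
  qed
  then obtain dd where dd: "\<And>i. i < n \<Longrightarrow> 0 < dd i" "\<And>i \<alpha> \<beta>. i < n \<Longrightarrow> 0 \<le> \<alpha> \<Longrightarrow> \<alpha> \<le> \<beta> \<Longrightarrow> \<beta> \<le> dd i \<Longrightarrow>
      \<bar>H i (\<tau> i - \<alpha>) - H i (\<tau> i - \<beta>) - (\<beta> - \<alpha>) * h i (\<tau> i)\<bar> \<le> 2 * \<eta>2 * \<beta> \<and> 0 \<le> \<tau> i - \<beta>"
    by metis
  define \<delta>3 where "\<delta>3 = Min (insert 1 (dd ` {..<n}))"
  have \<delta>3: "0 < \<delta>3" "\<And>i. i < n \<Longrightarrow> \<delta>3 \<le> dd i"
    unfolding \<delta>3_def using dd(1) by (auto simp: Min_gr_iff intro!: Min_le)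
  obtain gap where gap: "0 < gap" "\<And>i j. i < n \<Longrightarrow> j < n \<Longrightarrow> \<tau> i \<noteq> \<tau> j \<Longrightarrow> gap \<le> \<bar>\<tau> i - \<tau> j\<bar>"
    by (rule gap_exists[where n = n and \<tau> = \<tau>]) (rule that)
  \<comment> \<open>The coefficient of E^2 in \<open>c1 * T + c2 * E\<close> below.\<close>
  define K where "K = 2 * P * L * C + S * P * (L * C * T + 2 * M)"
  have "0 \<le> K" using P(1) L_nonneg C(1) \<open>0 \<le> S\<close> M_nonneg T_pos by (simp add: K_def)
  \<comment> \<open>Half of the gap, because disjointness of the needles needs a strict
    inequality.\<close>
  define \<delta> where "\<delta> = Min {\<delta>1, \<delta>2 / (C + 1), e / (3 * (K + 1)), \<delta>3, gap / 2}"
  have "0 < \<delta>" using C \<delta>2 \<open>0 < e\<close> \<open>0 \<le> K\<close> \<delta>3 gap by (auto simp: \<delta>_def)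
  have main: "\<bar>p T \<bullet> (z T - x T) - (\<Sum>i<n. \<epsilon> i * gain p (\<sigma> i) (\<tau> i) (w i))\<bar> \<le> e * sum \<epsilon> {..<n}"
    if \<epsilon>: "\<And>i. 0 \<le> \<epsilon> i" and small: "sum \<epsilon> {..<n} \<le> \<delta>"
      and z: "is_flow (\<Sum>i<n. \<epsilon> i * \<sigma> i) (needle_control \<tau> w n \<epsilon>) z" for \<epsilon> z
  proof -
    define E where "E = sum \<epsilon> {..<n}"
    define a where "a = (\<Sum>i<n. \<epsilon> i * \<sigma> i)"
    define U where "U = needle_control \<tau> w n \<epsilon>"
    define D where "D = (\<Union>i<n. needle_interval \<tau> \<epsilon> i)"
    have z: "is_flow a U z" using z by (simp add: a_def U_def)
    have "0 \<le> E" using \<epsilon> by (simp add: E_def sum_nonneg)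
    have "E \<le> \<delta>" using small by (simp add: E_def)
    then have E: "E \<le> \<delta>1" "E \<le> \<delta>2 / (C + 1)" "E \<le> e / (3 * (K + 1))" "E \<le> \<delta>3" "E < gap"
      using gap(1) unfolding \<delta>_def by (auto simp: Min_le_iff)
    have U: "control U" unfolding U_def by (rule needle_control[OF w])
    have \<epsilon>E: "\<epsilon> i \<le> E" if "i < n" for i
      unfolding E_def using \<epsilon> that by (intro member_le_sum) auto
    then have "\<bar>a\<bar> \<le> (\<Sum>i<n. E * \<bar>\<sigma> i\<bar>)"
      unfolding a_def using \<epsilon> by (intro order_trans[OF sum_abs] sum_mono) (auto simp: abs_mult intro!: mult_right_mono)
    then have aE: "\<bar>a\<bar> \<le> S * E" by (simp add: S_def sum_distrib_left mult.commute)
    have a12: "\<bar>a\<bar> \<le> 1 / 2" and yE: "\<And>t. t \<in> {0..T} \<Longrightarrow> norm (z t - x t) \<le> C * E" "\<And>t. t \<in> {0..T} \<Longrightarrow> norm (z t - x t) < \<rho>"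
      using C_est[rule_format, OF \<epsilon> E(1)[unfolded E_def]] z unfolding a_def U_def E_def by blast+
    have "(C + 1) * E \<le> \<delta>2" using E(2) C(1) by (simp add: field_simps)
    then have CE: "C * E \<le> \<delta>2" using \<open>0 \<le> E\<close> by (simp add: algebra_simps)
    have clipz: "clip t (z t) = z t" if "t \<in> {0..T}" for t using yE(2)[OF that] by (intro clip_id) simp
    have z_tube: "z t \<in> cball (x t) \<rho>" if "t \<in> {0..T}" for t
      using yE(2)[OF that] by (simp add: dist_norm norm_minus_commute)
    have UW: "U t \<in> W" if "t \<in> {0..T}" for t using U that by (simp add: control_def)
    define F where "F r = (1 + a) *\<^sub>R f (z r) (U r) - f (x r) (u r)" for r
    have Fint: "(F has_integral (z t - x t) - 0) {0..t}" if t: "t \<in> {0..T}" for t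
    proof -
      have "((\<lambda>s. (1 + a) *\<^sub>R f (clip s (z s)) (U s)) has_integral (z t - x 0)) {0..t}"
        using z t by (simp add: is_flow_def)
      then have "((\<lambda>s. (1 + a) *\<^sub>R f (z s) (U s)) has_integral (z t - x 0)) {0..t}"
        by (rule has_integral_eq[rotated]) (use t clipz in auto)
      from has_integral_diff[OF this x_primitive[OF t]] show ?thesis by (simp add: F_def[abs_def])
    qed
    \<comment> \<open>The derivative of p \<bullet> (z - x). Its leading part is \<open>R0\<close>
      below, whose integral is explicit.\<close>
    define R where "R r = adj (x r) (p r) (u r) \<bullet> (z r - x r) + p r \<bullet> F r" for r
    have Rint: "(R has_integral (p T \<bullet> (z T - x T))) {0..T}"
    proof -
      have "((\<lambda>s. adj (x s) (p s) (u s) \<bullet> (z s - x s) + p s \<bullet> F s) has_integral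
          (p T \<bullet> (z T - x T) - p 0 \<bullet> (z 0 - x 0))) {0..T}"
      proof (rule primitive_inner_has_integral[where z = "\<lambda>s. z s - x s" and c = "p 0" and d = 0 and B = "L * P + 3 * M"])
        fix t assume t: "t \<in> {0..T}"
        show "((\<lambda>s. adj (x s) (p s) (u s)) has_integral p t - p 0) {0..t}" using p t by (simp add: costate_def)
        show "(F has_integral z t - x t - 0) {0..t}" using Fint[OF t] by simp
        have "norm (adj (x t) (p t) (u t)) \<le> L * norm (p t)"
          using t by (intro adj_bound[OF _ x_in_tube] u_W)
        also have "\<dots> \<le> L * P" using P(2)[OF t] L_nonneg by (intro mult_left_mono)
        finally show "norm (adj (x t) (p t) (u t)) \<le> L * P + 3 * M" using M_nonneg by simp
        have "norm (F t) \<le> norm ((1 + a) *\<^sub>R f (z t) (U t)) + norm (f (x t) (u t))"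
          unfolding F_def by (rule norm_triangle_ineq4)
        also have "\<dots> \<le> 2 * M + M"
          unfolding norm_scaleR using a12 f_bound[OF t z_tube[OF t] UW[OF t]] f_bound[OF t x_in_tube u_W[OF t]] M_nonneg
          by (intro add_mono mult_mono) auto
        finally show "norm (F t) \<le> L * P + 3 * M" using L_nonneg P(1) by (simp add: add_increasing)
      qed (use T_pos in simp)
      then show ?thesis using flow_0[OF z] by (simp add: R_def[abs_def])
    qed
    define I0 where "I0 = integral {0..T} (\<lambda>r. p r \<bullet> f (x r) (u r))"
    define R0 where "R0 r = (\<Sum>i<n. if r \<in> needle_interval \<tau> \<epsilon> i then h i r else 0) + a * (p r \<bullet> f (x r) (u r))" for r
    define \<alpha> \<beta> where "\<alpha> i = sum \<epsilon> {..<i}" and "\<beta> i = sum \<epsilon> {..<Suc i}" for i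
    have \<alpha>\<beta>: "0 \<le> \<alpha> i" "\<alpha> i \<le> \<beta> i" "\<beta> i - \<alpha> i = \<epsilon> i" for i
      using \<epsilon> by (auto simp: \<alpha>_def \<beta>_def sum_nonneg)
    have \<beta>E: "\<beta> i \<le> E" if "i < n" for i
      unfolding \<beta>_def E_def using that \<epsilon> by (intro sum_lessThan_mono_nat) auto
    have Hest: "\<bar>H i (\<tau> i - \<alpha> i) - H i (\<tau> i - \<beta> i) - \<epsilon> i * h i (\<tau> i)\<bar> \<le> 2 * \<eta>2 * E" "0 \<le> \<tau> i - \<beta> i" if i: "i < n" for i
    proof -
      have "\<beta> i \<le> dd i" using \<beta>E[OF i] E(4) \<delta>3(2)[OF i] by linarith
      from dd(2)[OF i \<alpha>\<beta>(1,2) this] have *: "\<bar>H i (\<tau> i - \<alpha> i) - H i (\<tau> i - \<beta> i) - \<epsilon> i * h i (\<tau> i)\<bar> \<le> 2 * \<eta>2 * \<beta> i"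
        and "0 \<le> \<tau> i - \<beta> i" by (auto simp: \<alpha>\<beta>(3))
      have "2 * \<eta>2 * \<beta> i \<le> 2 * \<eta>2 * E" using \<beta>E[OF i] \<eta>2(1) by simp
      with * show "\<bar>H i (\<tau> i - \<alpha> i) - H i (\<tau> i - \<beta> i) - \<epsilon> i * h i (\<tau> i)\<bar> \<le> 2 * \<eta>2 * E" by linarith
      show "0 \<le> \<tau> i - \<beta> i" by fact
    qed
    have R0int: "(R0 has_integral (\<Sum>i<n. H i (\<tau> i - \<alpha> i) - H i (\<tau> i - \<beta> i)) + a * I0) {0..T}"
      unfolding R0_def[abs_def]
    proof (intro has_integral_add has_integral_sum has_integral_mult_right)
      fix i assume "i \<in> {..<n}"
      then have i: "i < n" by simp
      have "0 \<le> \<tau> i - sum \<epsilon> {..<Suc i}" using Hest(2)[OF i] unfolding \<beta>_def .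
      moreover have "\<tau> i \<le> T" using \<tau>'[OF i] by simp
      ultimately show "((\<lambda>r. if r \<in> needle_interval \<tau> \<epsilon> i then h i r else 0) has_integral
          H i (\<tau> i - \<alpha> i) - H i (\<tau> i - \<beta> i)) {0..T}"
        unfolding H_def h_def[abs_def] \<alpha>_def \<beta>_def by (rule needle_interval_integral[OF pc w[OF i] \<epsilon>])
    next
      show "((\<lambda>r. p r \<bullet> f (x r) (u r)) has_integral I0) {0..T}"
        unfolding I0_def by (rule integrable_integral[OF inner_f_integrable[OF pc control_u]])
    qed simp
    have Dm: "D \<in> lmeasurable" "measure lebesgue D \<le> E"
      unfolding D_def E_def by (rule needle_interval_measure[OF \<epsilon>])+
    have diff: "\<bar>R r - R0 r\<bar> \<le> (\<eta>1 * (C * E) + S * E * P * (L * (C * E))) + (2 * P * L * (C * E) + S * E * P * (2 * M)) * indicator D r"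
      if r: "r \<in> {0..T}" for r
    proof -
      let ?q = "p r" and ?x = "x r" and ?z = "z r"
      \<comment> \<open>\<open>A1\<close> is the linearization error, \<open>A2\<close> the effect
        of evaluating the needles along \<open>z\<close> instead of \<open>x\<close>, and
        \<open>A3\<close> the interaction of the speed change with the other variations.\<close>
      define A1 where "A1 = adj ?x ?q (u r) \<bullet> (?z - ?x) + ?q \<bullet> f ?z (u r) - ?q \<bullet> f ?x (u r)"
      define A2 where "A2 = ?q \<bullet> (f ?z (U r) - f ?z (u r)) - (\<Sum>i<n. if r \<in> needle_interval \<tau> \<epsilon> i then h i r else 0)"
      define A3 where "A3 = a * (?q \<bullet> (f ?z (U r) - f ?x (u r)))"
      have q: "norm ?q \<le> P" using P(2)[OF r] .
      have RR: "R r - R0 r = A1 + A2 + A3"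
        by (simp add: R_def R0_def F_def A1_def A2_def A3_def algebra_simps inner_diff_right inner_add_right)
      have y: "norm (?z - ?x) \<le> C * E" by (rule yE(1)[OF r])
      have lip: "norm (f ?z v - f ?x v) \<le> L * (C * E)" if "v \<in> W" for v
        using f_lipschitz[OF r z_tube[OF r] x_in_tube that] y L_nonneg by (meson mult_left_mono order_trans)
      have "\<bar>A1\<bar> \<le> \<eta>1 * norm (?z - ?x)"
        using lin[OF r _ u_W[OF r] q, of "?z - ?x"] y CE by (simp add: A1_def algebra_simps)
      then have B1: "\<bar>A1\<bar> \<le> \<eta>1 * (C * E)" using y \<eta>1(1) by (meson less_imp_le mult_left_mono order_trans)
      have ip: "\<bar>?q \<bullet> v\<bar> \<le> P * c" if "norm v \<le> c" for v c
      proof -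
        have "\<bar>?q \<bullet> v\<bar> \<le> norm ?q * norm v" by (rule Cauchy_Schwarz_ineq2)
        also have "\<dots> \<le> P * c" using q that P(1) by (intro mult_mono) auto
        finally show ?thesis .
      qed
      show ?thesis
      \<comment> \<open>On \<open>D\<close> the error is only of order E, but \<open>D\<close> has
        measure at most E. Off \<open>D\<close> the error must be small compared with E.\<close>
      proof (cases "r \<in> D")
        case False
        then have out: "r \<notin> needle_interval \<tau> \<epsilon> i" if "i < n" for i using that by (auto simp: D_def)
        have Uu: "U r = u r" unfolding U_def needle_control_def by (rule needle_outside[OF out])
        have "A2 = 0" unfolding A2_def Uu using out by simp
        have "\<bar>A3\<bar> \<le> (S * E) * (P * (L * (C * E)))"
          unfolding A3_def Uu abs_mult using aE ip[OF lip[OF u_W[OF r]]] \<open>0 \<le> S\<close> \<open>0 \<le> E\<close> by (intro mult_mono) auto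
        then have "\<bar>A3\<bar> \<le> S * E * P * (L * (C * E))" by (simp add: mult.assoc)
        then show ?thesis unfolding RR \<open>A2 = 0\<close> using B1 False by simp
      next
        case True
        then obtain i where i: "i < n" "r \<in> needle_interval \<tau> \<epsilon> i" by (auto simp: D_def)
        have other: "r \<notin> needle_interval \<tau> \<epsilon> j" if "j < n" "j \<noteq> i" for j
          using needle_interval_disjoint[OF \<epsilon> gap(2) E(5)[unfolded E_def] i(1) that(1) that(2)[symmetric] i(2)] by simp
        have Uw: "U r = w i" unfolding U_def needle_control_def using i other by (intro needle_inside) auto
        have "(\<Sum>j<n. if r \<in> needle_interval \<tau> \<epsilon> j then h j r else 0) = (\<Sum>j\<in>{i}. if r \<in> needle_interval \<tau> \<epsilon> j then h j r else 0)"
          using i other by (intro sum.mono_neutral_right) auto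
        then have "A2 = ?q \<bullet> (f ?z (w i) - f ?x (w i)) - ?q \<bullet> (f ?z (u r) - f ?x (u r))"
          using i by (simp add: A2_def Uw h_def inner_diff_right)
        then have B2: "\<bar>A2\<bar> \<le> 2 * (P * (L * (C * E)))"
          using ip[OF lip[OF w[OF i(1)]]] ip[OF lip[OF u_W[OF r]]] by linarith
        have "norm (f ?z (U r) - f ?x (u r)) \<le> 2 * M"
          using norm_triangle_ineq4[of "f ?z (U r)" "f ?x (u r)"] f_bound[OF r z_tube[OF r] UW[OF r]] f_bound[OF r x_in_tube u_W[OF r]] by linarith
        then have "\<bar>A3\<bar> \<le> (S * E) * (P * (2 * M))"
          unfolding A3_def abs_mult using aE ip \<open>0 \<le> S\<close> \<open>0 \<le> E\<close> by (intro mult_mono) auto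
        moreover have "0 \<le> S * E * P * (L * (C * E))"
          using \<open>0 \<le> S\<close> \<open>0 \<le> E\<close> P(1) L_nonneg C(1) by simp
        ultimately show ?thesis unfolding RR using B1 B2 True by (simp add: algebra_simps)
      qed
    qed
    define c1 c2 where "c1 = \<eta>1 * (C * E) + S * E * P * (L * (C * E))" and "c2 = 2 * P * L * (C * E) + S * E * P * (2 * M)"
    have "0 \<le> c2" using \<open>0 \<le> S\<close> \<open>0 \<le> E\<close> P(1) L_nonneg C(1) M_nonneg by (simp add: c2_def)
    note ind = indicator_integral_le[OF Dm(1), of 0 T]
    have "norm (integral {0..T} (\<lambda>r. R r - R0 r)) \<le> integral {0..T} (\<lambda>r. c1 + c2 * indicator D r)"
    proof (rule integral_norm_bound_integral)
      show "(\<lambda>r. R r - R0 r) integrable_on {0..T}" using has_integral_diff[OF Rint R0int] by blast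
      show "(\<lambda>r. c1 + c2 * indicator D r) integrable_on {0..T}" using ind(1) by (intro integrable_add integrable_on_mult_right) auto
      show "norm (R r - R0 r) \<le> c1 + c2 * indicator D r" if "r \<in> {0..T}" for r
        using diff[OF that] unfolding c1_def c2_def real_norm_def .
    qed
    also have "integral {0..T} (\<lambda>r. R r - R0 r) = p T \<bullet> (z T - x T) - ((\<Sum>i<n. H i (\<tau> i - \<alpha> i) - H i (\<tau> i - \<beta> i)) + a * I0)"
      using has_integral_diff[OF Rint R0int] by (rule integral_unique)
    also have "integral {0..T} (\<lambda>r. c1 + c2 * indicator D r) = c1 * T + c2 * integral {0..T} (indicator D)"
      using ind(1) T_pos by (subst integral_add) (auto intro!: integrable_on_mult_right)
    finally have first: "\<bar>p T \<bullet> (z T - x T) - ((\<Sum>i<n. H i (\<tau> i - \<alpha> i) - H i (\<tau> i - \<beta> i)) + a * I0)\<bar>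
        \<le> c1 * T + c2 * integral {0..T} (indicator D)" by simp
    have "c2 * integral {0..T} (indicator D) \<le> c2 * E"
      using ind(2) Dm(2) \<open>0 \<le> c2\<close> by (intro mult_left_mono) auto
    moreover have "c1 * T + c2 * E = (T * \<eta>1 * C) * E + (K * E) * E"
      by (simp add: c1_def c2_def K_def algebra_simps)
    moreover have "(T * \<eta>1 * C) * E \<le> e / 3 * E" using \<eta>1(2) \<open>0 \<le> E\<close> by (rule mult_right_mono)
    moreover have "(K * E) * E \<le> e / 3 * E"
    proof (rule mult_right_mono[OF _ \<open>0 \<le> E\<close>])
      have "(K + 1) * E \<le> e / 3" using E(3) \<open>0 \<le> K\<close> by (simp add: field_simps)
      then show "K * E \<le> e / 3" using \<open>0 \<le> E\<close> by (simp add: algebra_simps)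
    qed
    moreover have "\<bar>(\<Sum>i<n. H i (\<tau> i - \<alpha> i) - H i (\<tau> i - \<beta> i)) - (\<Sum>i<n. \<epsilon> i * h i (\<tau> i))\<bar> \<le> e / 3 * E"
    proof -
      have "\<bar>\<Sum>i<n. H i (\<tau> i - \<alpha> i) - H i (\<tau> i - \<beta> i) - \<epsilon> i * h i (\<tau> i)\<bar> \<le> (\<Sum>i<n. 2 * \<eta>2 * E)"
        using Hest(1) by (intro order_trans[OF sum_abs] sum_mono) auto
      also have "\<dots> = (2 * real n * \<eta>2) * E" by simp
      also have "\<dots> \<le> e / 3 * E" using \<eta>2(2) \<open>0 \<le> E\<close> by (rule mult_right_mono)
      finally show ?thesis by (simp add: sum_subtractf)
    qed
    moreover have "(\<Sum>i<n. \<epsilon> i * gain p (\<sigma> i) (\<tau> i) (w i)) = a * I0 + (\<Sum>i<n. \<epsilon> i * h i (\<tau> i))"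
      by (simp add: gain_def a_def h_def I0_def sum_distrib_right distrib_left sum.distrib mult.assoc)
    moreover have "e * E = e / 3 * E + e / 3 * E + e / 3 * E" by simp
    ultimately show ?thesis using first unfolding E_def[symmetric] by linarith
  qed
  show ?thesis
    by (rule exI[of _ \<delta>], intro conjI[OF \<open>0 < \<delta>\<close>] allI impI main) simp_all
qed

end

subsection \<open>Reachable directions\<close>

lemma negligible_scaling_image:
  fixes N :: "real set"
  assumes "negligible N"
  shows "negligible ((\<lambda>t. c * t) ` N)"
  using assms by (intro negligible_differentiable_image_negligible) (auto intro!: derivative_intros)

lemma measurable_lebesgue_on_scaling:
  fixes U :: "real \<Rightarrow> 'u::euclidean_space"
  assumes U: "U \<in> borel_measurable (lebesgue_on {0..T})" and k: "0 < k"
  shows "(\<lambda>t. U (t / k)) \<in> borel_measurable (lebesgue_on {0..k * T})"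
proof -
  have "(\<lambda>t. (1 / k) *\<^sub>R t) \<in> lebesgue \<rightarrow>\<^sub>M (lebesgue :: real measure)"
    by (rule lebesgue_measurable_scaling)
  then have "(\<lambda>t. t / k) \<in> lebesgue \<rightarrow>\<^sub>M (lebesgue :: real measure)" by simp
  then have "(\<lambda>t. t / k) \<in> lebesgue_on {0..k * T} \<rightarrow>\<^sub>M (lebesgue :: real measure)"
    by (rule measurable_restrict_space1)
  then have "(\<lambda>t. t / k) \<in> lebesgue_on {0..k * T} \<rightarrow>\<^sub>M lebesgue_on {0..T}"
    using k by (intro measurable_restrict_space2) (auto simp: field_simps)
  then show ?thesis using U by (rule measurable_compose)
qed

lemma lipschitz_on_scaling:
  fixes z :: "real \<Rightarrow> 'a::metric_space"
  assumes z: "B-lipschitz_on {0..T} z" and k: "0 < k"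
  shows "(B / k)-lipschitz_on {0..k * T} (\<lambda>t. z (t / k))"
proof (rule lipschitz_onI)
  show "0 \<le> B / k" using lipschitz_on_nonneg[OF z] k by simp
  fix s t assume "s \<in> {0..k * T}" "t \<in> {0..k * T}"
  then have "s / k \<in> {0..T}" "t / k \<in> {0..T}" using k by (auto simp: field_simps)
  then have "dist (z (s / k)) (z (t / k)) \<le> B * dist (s / k) (t / k)" by (rule lipschitz_onD[OF z])
  also have "dist (s / k) (t / k) = dist s t / k"
    using k by (simp add: dist_real_def flip: diff_divide_distrib)
  finally show "dist (z (s / k)) (z (t / k)) \<le> B / k * dist s t" by simp
qed

text \<open>The two controls can differ only between corresponding endpoints, so they agree off a
  set whose measure is bounded by the endpoint shifts. This feeds
  \<open>flow_compare\<close>.\<close>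

lemma needle_interval_change:
  assumes t: "\<And>i. i < n \<Longrightarrow> t \<notin> closed_segment (\<tau> i - sum \<epsilon> {..<Suc i}) (\<tau> i - sum \<epsilon>' {..<Suc i})"
    "\<And>i. i < n \<Longrightarrow> t \<notin> closed_segment (\<tau> i - sum \<epsilon> {..<i}) (\<tau> i - sum \<epsilon>' {..<i})"
  shows "needle (needle_interval \<tau> \<epsilon>) w u n t = needle (needle_interval \<tau> \<epsilon>') w u n t"
proof (rule needle_cong_at)
  fix i assume "i < n"
  from t(1)[OF this] t(2)[OF this]
  show "t \<in> needle_interval \<tau> \<epsilon> i \<longleftrightarrow> t \<in> needle_interval \<tau> \<epsilon>' i"
    unfolding needle_interval_def closed_segment_eq_real_ivl greaterThanAtMost_iff
    by (smt (verit) atLeastAtMost_iff)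
qed

context control_trajectory
begin

text \<open>The final point is prescribed exactly. In the application it lies on a curve inside the
  target, which makes the trajectory a competitor.\<close>

definition reachable :: "real \<Rightarrow> 'a \<Rightarrow> bool" where
  "reachable T' y \<longleftrightarrow> 0 < T' \<and> (\<exists>U z. U \<in> borel_measurable (lebesgue_on {0..T'}) \<and> (\<forall>t\<in>{0..T'}. U t \<in> W) \<and>
     abs_continuous_on z {0..T'} \<and> (\<forall>t\<in>{0..T'}. z t \<in> X) \<and>
     (AE t in lebesgue_on {0..T'}. (z has_vector_derivative f (z t) (U t)) (at t)) \<and> z 0 = x 0 \<and> z T' = y)"

text \<open>A flow with speed factor \<open>1 + a\<close> on \<open>[0, T]\<close> is a trajectory on \<open>[0, (1 + a) T]\<close> after
  reparametrization.\<close>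

lemma flow_reachable:
  assumes U: "control U" and z: "is_flow a U z" and a: "\<bar>a\<bar> \<le> 1 / 2"
    and near: "\<And>t. t \<in> {0..T} \<Longrightarrow> norm (z t - x t) < \<rho>"
  shows "reachable ((1 + a) * T) (z T)"
proof -
  define k where "k = 1 + a"
  have k: "0 < k" using a by (simp add: k_def)
  have clipz: "clip t (z t) = z t" if "t \<in> {0..T}" for t using near[OF that] by (intro clip_id) simp
  have zint: "((\<lambda>s. k *\<^sub>R f (clip s (z s)) (U s)) has_integral (z t - x 0)) {0..t}" if "t \<in> {0..T}" for t
    using z that by (simp add: is_flow_def k_def)
  have bnd: "norm (k *\<^sub>R f (clip s (z s)) (U s)) \<le> k * M" if "s \<in> {0..T}" for s
    using clip_f_bound[OF U that] k by (simp add: mult_left_mono)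
  have "0 \<le> k * M" using k M_nonneg by simp
  have lip: "(k * M)-lipschitz_on {0..T} z"
    by (rule primitive_lipschitz_on[OF zint bnd \<open>0 \<le> k * M\<close>])
  obtain N where N: "negligible N"
    "\<And>t. t \<in> {0..T} - N \<Longrightarrow> (z has_vector_derivative k *\<^sub>R f (clip t (z t)) (U t)) (at t)"
    by (rule primitive_has_vector_derivative_AE[OF zint]) (use T_pos in auto)
  define U' z' where "U' t = U (t / k)" and "z' t = z (t / k)" for t
  have in_dom: "t / k \<in> {0..T}" if "t \<in> {0..k * T}" for t using that k by (auto simp: field_simps)
  have "U' \<in> borel_measurable (lebesgue_on {0..k * T})"
    unfolding U'_def[abs_def] using U k by (intro measurable_lebesgue_on_scaling) (auto simp: control_def)
  moreover have "\<forall>t\<in>{0..k * T}. U' t \<in> W"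
    using U in_dom by (auto simp: U'_def control_def)
  moreover have "abs_continuous_on z' {0..k * T}"
    unfolding z'_def[abs_def] by (rule lipschitz_on_imp_abs_continuous_on[OF lipschitz_on_scaling[OF lip k]])
  moreover have "\<forall>t\<in>{0..k * T}. z' t \<in> X"
  proof
    fix t assume "t \<in> {0..k * T}"
    from in_dom[OF this] near[OF in_dom[OF this]] show "z' t \<in> X"
      unfolding z'_def by (intro tube_X[of "t / k"]) (auto simp: dist_norm norm_minus_commute less_imp_le)
  qed
  moreover have sets: "{0..k * T} \<in> sets lebesgue" by simp
  have "AE t in lebesgue_on {0..k * T}. (z' has_vector_derivative f (z' t) (U' t)) (at t)"
    unfolding AE_lebesgue_on_iff_negligible[OF sets]
  proof (intro exI[of _ "(\<lambda>t. k * t) ` N"] conjI ballI negligible_scaling_image N(1))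
    fix t assume t: "t \<in> {0..k * T} - (\<lambda>t. k * t) ` N"
    have "t / k \<notin> N" using t k by (auto simp: image_iff)
    then have d: "(z has_vector_derivative k *\<^sub>R f (z (t / k)) (U (t / k))) (at (t / k))"
      using N(2)[of "t / k"] in_dom[of t] t clipz[of "t / k"] by auto
    have "((\<lambda>t. t / k) has_vector_derivative 1 / k) (at t)"
      using k by (auto intro!: derivative_eq_intros simp: has_real_derivative_iff_has_vector_derivative[symmetric])
    then have "((z \<circ> (\<lambda>t. t / k)) has_vector_derivative (1 / k) *\<^sub>R (k *\<^sub>R f (z (t / k)) (U (t / k)))) (at t)"
      using d by (rule vector_diff_chain_at)
    then show "(z' has_vector_derivative f (z' t) (U' t)) (at t)"
      using k by (simp add: z'_def[abs_def] U'_def comp_def)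
  qed
  moreover have "z' 0 = x 0" "z' (k * T) = z T" using flow_0[OF z] k by (simp_all add: z'_def)
  ultimately show ?thesis
    unfolding reachable_def k_def[symmetric] using k T_pos by (intro conjI exI[of _ U'] exI[of _ z']) auto
qed

text \<open>Brouwer's theorem requires the endpoint to be continuous in the coefficients.
  \<open>flow_compare\<close> bounds its change by the explicit modulus \<open>bd\<close>, which is
  continuous and vanishes at \<open>\<eta>0\<close>.\<close>

lemma needle_flow_continuous:
  assumes w: "\<And>i. i < n \<Longrightarrow> w i \<in> W"
    and c: "\<And>i. continuous_on A (\<lambda>\<eta>. c \<eta> i :: real)"
    and z: "\<And>\<eta>. \<eta> \<in> A \<Longrightarrow> is_flow (\<Sum>i<n. c \<eta> i * \<sigma> i) (needle_control \<tau> w n (c \<eta>)) (z \<eta>)"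
    and a: "\<And>\<eta>. \<eta> \<in> A \<Longrightarrow> \<bar>\<Sum>i<n. c \<eta> i * \<sigma> i\<bar> \<le> 1"
  shows "continuous_on A (\<lambda>\<eta>. z \<eta> T)"
  unfolding continuous_on_def
proof
  fix \<eta>0 assume \<eta>0: "\<eta>0 \<in> A"
  define lo hi where "lo \<eta> i = sum (c \<eta>) {..<Suc i}" and "hi \<eta> i = sum (c \<eta>) {..<i}" for \<eta> i
  define bd where "bd \<eta> = (\<bar>(\<Sum>i<n. c \<eta> i * \<sigma> i) - (\<Sum>i<n. c \<eta>0 i * \<sigma> i)\<bar> * M * T
      + 4 * M * (\<Sum>i<n. \<bar>lo \<eta> i - lo \<eta>0 i\<bar> + \<bar>hi \<eta> i - hi \<eta>0 i\<bar>)) * exp (2 * L * T)" for \<eta>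
  have le: "dist (z \<eta> T) (z \<eta>0 T) \<le> bd \<eta>" if \<eta>: "\<eta> \<in> A" for \<eta>
  proof -
    define S where "S = (\<Union>i<n. closed_segment (\<tau> i - lo \<eta> i) (\<tau> i - lo \<eta>0 i) \<union> closed_segment (\<tau> i - hi \<eta> i) (\<tau> i - hi \<eta>0 i))"
    have seg: "closed_segment p q \<in> lmeasurable" "measure lebesgue (closed_segment p q) = \<bar>p - q\<bar>" for p q :: real
      by (auto simp: closed_segment_eq_real_ivl)
    have S: "S \<in> lmeasurable" unfolding S_def using seg by (intro fmeasurable.finite_UN fmeasurable.Un) auto
    have "measure lebesgue S \<le> (\<Sum>i<n. measure lebesgue (closed_segment (\<tau> i - lo \<eta> i) (\<tau> i - lo \<eta>0 i) \<union> closed_segment (\<tau> i - hi \<eta> i) (\<tau> i - hi \<eta>0 i)))"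
      unfolding S_def using seg by (intro measure_UNION_le) (auto intro!: fmeasurableD fmeasurable.Un)
    also have "\<dots> \<le> (\<Sum>i<n. \<bar>lo \<eta> i - lo \<eta>0 i\<bar> + \<bar>hi \<eta> i - hi \<eta>0 i\<bar>)"
    proof (rule sum_mono)
      fix i
      show "measure lebesgue (closed_segment (\<tau> i - lo \<eta> i) (\<tau> i - lo \<eta>0 i) \<union> closed_segment (\<tau> i - hi \<eta> i) (\<tau> i - hi \<eta>0 i))
          \<le> \<bar>lo \<eta> i - lo \<eta>0 i\<bar> + \<bar>hi \<eta> i - hi \<eta>0 i\<bar>"
        using measure_Un_le[OF fmeasurableD[OF seg(1)] fmeasurableD[OF seg(1)],
            of "\<tau> i - lo \<eta> i" "\<tau> i - lo \<eta>0 i" "\<tau> i - hi \<eta> i" "\<tau> i - hi \<eta>0 i"]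
        by (simp add: seg(2) abs_minus_commute)
    qed
    finally have mS: "measure lebesgue S \<le> (\<Sum>i<n. \<bar>lo \<eta> i - lo \<eta>0 i\<bar> + \<bar>hi \<eta> i - hi \<eta>0 i\<bar>)" .
    have "norm (z \<eta> T - z \<eta>0 T) \<le> (\<bar>(\<Sum>i<n. c \<eta> i * \<sigma> i) - (\<Sum>i<n. c \<eta>0 i * \<sigma> i)\<bar> * M * T + 4 * M * measure lebesgue S) * exp (2 * L * T)"
    proof (rule flow_compare[OF needle_control[OF w] needle_control[OF w] a[OF \<eta>] a[OF \<eta>0] z[OF \<eta>] z[OF \<eta>0] S])
      fix t assume "t \<in> {0..T} - S"
      then show "needle_control \<tau> w n (c \<eta>) t = needle_control \<tau> w n (c \<eta>0) t"
        unfolding needle_control_def S_def lo_def hi_def by (intro needle_interval_change) auto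
    qed (use T_pos in auto)
    also have "\<dots> \<le> bd \<eta>"
      unfolding bd_def using mS M_nonneg by (intro mult_right_mono add_mono mult_left_mono) auto
    finally show ?thesis by (simp add: dist_norm)
  qed
  have "continuous_on A bd"
    unfolding bd_def[abs_def] lo_def hi_def by (intro continuous_intros c)
  then have "(bd \<longlongrightarrow> bd \<eta>0) (at \<eta>0 within A)" using \<eta>0 by (simp add: continuous_on_def)
  moreover have "bd \<eta>0 = 0" by (simp add: bd_def)
  ultimately have lim: "(bd \<longlongrightarrow> 0) (at \<eta>0 within A)" by simp
  have "((\<lambda>\<eta>. dist (z \<eta> T) (z \<eta>0 T)) \<longlongrightarrow> 0) (at \<eta>0 within A)"
  proof (rule tendsto_sandwich[OF _ _ tendsto_const lim])
    show "\<forall>\<^sub>F \<eta> in at \<eta>0 within A. dist (z \<eta> T) (z \<eta>0 T) \<le> bd \<eta>"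
      unfolding eventually_at_topological by (intro exI[of _ UNIV]) (auto intro: le)
  qed simp
  then show "((\<lambda>\<eta>. z \<eta> T) \<longlongrightarrow> z \<eta>0 T) (at \<eta>0 within A)"
    by (rule tendsto_dist_iff[THEN iffD2])
qed

text \<open>Turns an inequality for a normal vector, in the coordinates given by the basis costates,
  into one for a single combined costate.\<close>

lemma costate_gain_sum:
  assumes p: "\<And>e. e \<in> I \<Longrightarrow> costate (p e)" and "finite I"
  shows "gain (\<lambda>t. \<Sum>e\<in>I. c e *\<^sub>R p e t) \<sigma> t w = (\<Sum>e\<in>I. c e * gain (p e) \<sigma> t w)"
proof -
  have i: "(\<lambda>r. p e r \<bullet> f (x r) (u r)) integrable_on {0..T}" if "e \<in> I" for e
    using p[OF that] by (intro inner_f_integrable control_u) (simp add: costate_def)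
  have "integral {0..T} (\<lambda>r. (\<Sum>e\<in>I. c e *\<^sub>R p e r) \<bullet> f (x r) (u r)) = integral {0..T} (\<lambda>r. \<Sum>e\<in>I. c e * (p e r \<bullet> f (x r) (u r)))"
    by (simp add: inner_sum_left)
  also have "\<dots> = (\<Sum>e\<in>I. c e * integral {0..T} (\<lambda>r. p e r \<bullet> f (x r) (u r)))"
    using i \<open>finite I\<close> by (subst integral_sum) (auto intro!: integrable_on_mult_right)
  finally show ?thesis
    by (simp add: gain_def inner_sum_left sum_distrib_left sum.distrib[symmetric] algebra_simps)
qed

text \<open>Either the direction \<open>(\<tau>', d)\<close> is interior to the cone generated by the variations, and
  Brouwer's theorem hits every nearby point of the curve exactly, or a hyperplane separates it from
  the cone; the normal, propagated as a costate, satisfies the maximum condition.\<close>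

theorem reachability_alternative:
  assumes \<xi>: "(\<xi> has_vector_derivative d) (at 0 within {0..})" and \<xi>0: "\<xi> 0 = x T"
  shows "(\<exists>q0 p. costate p \<and> (q0 \<noteq> 0 \<or> p 0 \<noteq> 0) \<and>
      (\<exists>N. negligible N \<and> (\<forall>t\<in>{0..T} - N. \<forall>w\<in>W. p t \<bullet> f (x t) w \<le> p t \<bullet> f (x t) (u t))) \<and>
      q0 * T + integral {0..T} (\<lambda>t. p t \<bullet> f (x t) (u t)) = 0 \<and> 0 \<le> q0 * \<tau>' + p T \<bullet> d)
    \<or> (\<exists>s0>0. \<forall>s. 0 < s \<and> s < s0 \<longrightarrow> reachable (T + s * \<tau>') (\<xi> s))"
proof -
  define pe where "pe e = (SOME p. costate p \<and> p 0 = e)" for e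
  have pe: "costate (pe e)" "pe e 0 = e" for e
    using someI_ex[OF costate_exists[of e]] by (auto simp: pe_def)
  \<comment> \<open>Displacements of the endpoint are measured by their products with the basis
    costates at \<open>T\<close>, the quantities that \<open>needle_first_order\<close> controls. By
    \<open>V0\<close> these coordinates lose nothing.\<close>
  define V where "V y = (\<Sum>e\<in>Basis. (pe e T \<bullet> y) *\<^sub>R e)" for y
  have linV: "linear V"
    by (rule linearI) (auto simp: V_def inner_add_right scaleR_add_left sum.distrib scaleR_sum_right)
  have V_inner: "q \<bullet> V y = (\<Sum>e\<in>Basis. (q \<bullet> e) *\<^sub>R pe e T) \<bullet> y" for q y
    by (simp add: V_def inner_sum_right inner_sum_left mult.commute)
  define comb where "comb q t = (\<Sum>e\<in>Basis. (q \<bullet> e) *\<^sub>R pe e t)" for q t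
  have comb: "costate (comb q)" "comb q 0 = q" for q
    unfolding comb_def by (intro costate_sum pe(1) finite_Basis) (simp add: pe(2) euclidean_representation)
  have V0: "y = 0" if "V y = 0" for y
  proof -
    have lin: "linear (\<lambda>q. comb q T)"
      by (rule linearI) (auto simp: comb_def inner_add_left scaleR_add_left sum.distrib scaleR_sum_right)
    have "inj (\<lambda>q. comb q T)"
      unfolding linear_injective_0[OF lin]
    proof (intro allI impI)
      fix q assume "comb q T = 0"
      then have "comb q 0 = 0" using costate_zero[OF comb(1), of T q 0] T_pos by auto
      then show "q = 0" by (simp add: comb(2))
    qed
    then have "surj (\<lambda>q. comb q T)" by (rule linear_inj_imp_surj[OF lin])
    then obtain q where "y = comb q T" by (rule surjE)
    moreover have "comb q T \<bullet> y = 0" using V_inner[of q y] that by (simp add: comb_def)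
    ultimately show ?thesis by simp
  qed
  \<comment> \<open>Needle times have to be suitable for all basis costates at once.\<close>
  define LP where "LP = {t. \<forall>e\<in>Basis. lebesgue_point (pe e) t}"
  have "\<exists>N. negligible N \<and> {0..T} - N \<subseteq> LP"
  proof -
    have "\<exists>N. negligible N \<and> (\<forall>t\<in>{0..T} - N. lebesgue_point (pe e) t)" for e
      using lebesgue_point_AE[of "pe e"] pe(1)[of e] unfolding costate_def by metis
    then obtain N where N: "\<And>e. negligible (N e)" "\<And>e t. t \<in> {0..T} - N e \<Longrightarrow> lebesgue_point (pe e) t" by metis
    then show ?thesis
      by (intro exI[of _ "\<Union>e\<in>Basis. N e"] conjI negligible_Union) (auto simp: LP_def)
  qed
  then obtain NL where NL: "negligible NL" "{0..T} - NL \<subseteq> LP" by blast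
  have LPT: "t \<in> {0<..<T}" if "t \<in> LP" for t
    using that SOME_Basis unfolding LP_def lebesgue_point_def by blast
  have "LP \<noteq> {}"
  proof
    assume "LP = {}"
    then have "negligible {0..T}" using NL negligible_subset by (metis Diff_eq_empty_iff subset_empty)
    then show False using T_pos negligible_interval(1)[of 0 T] by simp
  qed
  then obtain t1 where t1: "t1 \<in> LP" by blast
  \<comment> \<open>First-order effect of a unit variation: the change of the final time, and the
    change of the endpoint in the coordinates \<open>V\<close>.\<close>
  define gv where "gv = (\<lambda>(\<sigma>, t, w). (\<sigma> * T, \<Sum>e\<in>Basis. gain (pe e) \<sigma> t w *\<^sub>R e))"
  define S where "S = gv ` (UNIV \<times> LP \<times> W)"
  have "S \<noteq> {}" using t1 LPT[OF t1] u_W[of t1] by (auto simp: S_def)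
  from cone_alternative[OF this, of "(\<tau>', V d)"] show ?thesis
  proof
    assume "\<exists>q. q \<noteq> 0 \<and> (\<forall>g\<in>S. q \<bullet> g \<le> 0) \<and> 0 \<le> q \<bullet> (\<tau>', V d)"
    then obtain q0 q where q: "(q0, q) \<noteq> (0 :: real \<times> 'a)" "\<And>g. g \<in> S \<Longrightarrow> (q0, q) \<bullet> g \<le> 0" "0 \<le> (q0, q) \<bullet> (\<tau>', V d)"
      by fastforce
    define I where "I = integral {0..T} (\<lambda>t. comb q t \<bullet> f (x t) (u t))"
    have le: "q0 * (\<sigma> * T) + gain (comb q) \<sigma> t w \<le> 0" if "t \<in> LP" "w \<in> W" for \<sigma> t w
    proof -
      have "gv (\<sigma>, t, w) \<in> S" using that by (auto simp: S_def)
      from q(2)[OF this] show ?thesis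
        unfolding comb_def[abs_def] costate_gain_sum[OF pe(1) finite_Basis]
        by (simp add: gv_def inner_Pair inner_sum_right mult.commute)
    qed
    \<comment> \<open>The speed change takes both signs, so the inequality becomes an
      equation.\<close>
    have "\<sigma> * (q0 * T + I) \<le> 0" for \<sigma>
      using le[OF t1 u_W[of t1], of \<sigma>] LPT[OF t1] by (simp add: gain_def I_def algebra_simps)
    from this[of 1] this[of "-1"] have I0: "q0 * T + I = 0" by simp
    have max: "comb q t \<bullet> f (x t) w \<le> comb q t \<bullet> f (x t) (u t)" if "t \<in> {0..T} - NL" "w \<in> W" for t w
      using le[of t w 0] that NL(2) by (auto simp: gain_def inner_diff_right)
    have "0 \<le> q0 * \<tau>' + comb q T \<bullet> d"
      using q(3) V_inner[of q d] by (simp add: inner_Pair comb_def)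
    moreover have "q0 \<noteq> 0 \<or> comb q 0 \<noteq> 0" using q(1) by (auto simp: comb(2) zero_prod_def)
    ultimately show ?thesis
      using comb(1)[of q] max I0 NL(1) unfolding I_def by (intro disjI1) blast
  next
    assume "\<exists>n g \<kappa> c. 0 < \<kappa> \<and> (\<forall>i<n. g i \<in> S) \<and> (\<forall>i::nat. continuous_on (cball 0 \<kappa>) (\<lambda>\<eta>. c \<eta> i)) \<and>
       (\<forall>\<eta>\<in>cball 0 \<kappa>. (\<forall>i. 0 \<le> c \<eta> i) \<and> (\<Sum>i<n. c \<eta> i *\<^sub>R g i) = (\<tau>', V d) + \<eta>)"
    then obtain n g \<kappa> c where \<kappa>: "0 < \<kappa>" and gS: "\<forall>i<n. g i \<in> S"
      and contc: "\<forall>i::nat. continuous_on (cball 0 \<kappa>) (\<lambda>\<eta>. c \<eta> i)"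
      and csum': "\<forall>\<eta>\<in>cball 0 \<kappa>. (\<forall>i. 0 \<le> c \<eta> i) \<and> (\<Sum>i<n. c \<eta> i *\<^sub>R g i) = (\<tau>', V d) + \<eta>"
      by (elim exE conjE) (rule that)
    have c: "continuous_on (cball 0 \<kappa>) (\<lambda>\<eta>. c \<eta> i)" "\<eta> \<in> cball 0 \<kappa> \<Longrightarrow> 0 \<le> c \<eta> i"
      and csum: "\<eta> \<in> cball 0 \<kappa> \<Longrightarrow> (\<Sum>i<n. c \<eta> i *\<^sub>R g i) = (\<tau>', V d) + \<eta>" for i \<eta>
      using contc csum' by blast+
    have "\<forall>i. \<exists>\<sigma> t w. i < n \<longrightarrow> t \<in> LP \<and> w \<in> W \<and> g i = gv (\<sigma>, t, w)"
      using gS unfolding S_def by fastforce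
    then obtain \<sigma> \<tau> w where gi: "\<And>i. i < n \<Longrightarrow> \<tau> i \<in> LP \<and> w i \<in> W \<and> g i = gv (\<sigma> i, \<tau> i, w i)"
      by metis
    have w: "w i \<in> W" if "i < n" for i using gi[OF that] by simp
    obtain B where B: "0 < B" "\<And>\<eta>. \<eta> \<in> cball 0 \<kappa> \<Longrightarrow> sum (c \<eta>) {..<n} \<le> B"
    proof -
      have "continuous_on (cball 0 \<kappa>) (\<lambda>\<eta>. sum (c \<eta>) {..<n})" by (intro continuous_intros c)
      then have "bounded ((\<lambda>\<eta>. sum (c \<eta>) {..<n}) ` cball 0 \<kappa>)"
        by (intro compact_imp_bounded compact_continuous_image compact_cball)
      then obtain B where "0 < B" "\<And>\<eta>. \<eta> \<in> cball 0 \<kappa> \<Longrightarrow> \<bar>sum (c \<eta>) {..<n}\<bar> \<le> B"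
        unfolding bounded_pos by auto
      then show ?thesis by (intro that[of B]) (auto simp: abs_le_iff)
    qed
    \<comment> \<open>Summed over all coordinates, the first-order error is then at most \<kappa> s
      / 2. The remainder of the curve \<open>\<xi>\<close> gets the other half, see
      \<open>s1\<close>.\<close>
    define e where "e = \<kappa> / (2 * real DIM('a) * B)"
    have e: "0 < e" using \<kappa> B by (simp add: e_def)
    obtain K where K: "0 < K" "\<And>y. norm (V y) \<le> K * norm y"
      using linear_bounded_pos[OF linV] by (auto simp: mult.commute)
    have w': "\<forall>i<n. w i \<in> W" using w by blast
    obtain C \<delta>1 where \<delta>1: "0 < \<delta>1" and est: "\<forall>\<epsilon> z. (\<forall>i. 0 \<le> \<epsilon> i) \<longrightarrow> sum \<epsilon> {..<n} \<le> \<delta>1 \<longrightarrow>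
       is_flow (\<Sum>i<n. \<epsilon> i * \<sigma> i) (needle_control \<tau> w n \<epsilon>) z \<longrightarrow>
       \<bar>\<Sum>i<n. \<epsilon> i * \<sigma> i\<bar> \<le> 1 / 2 \<and> (\<forall>t\<in>{0..T}. norm (z t - x t) \<le> C * sum \<epsilon> {..<n} \<and> norm (z t - x t) < \<rho>)"
      using needle_variation_estimate[where n = n and w = w and \<tau> = \<tau> and \<sigma> = \<sigma>, OF w'] by (elim exE conjE) (rule that)
    have "\<forall>b\<in>Basis. \<exists>\<delta>>0. \<forall>\<epsilon> z. (\<forall>i. 0 \<le> \<epsilon> i) \<longrightarrow> sum \<epsilon> {..<n} \<le> \<delta> \<longrightarrow>
       is_flow (\<Sum>i<n. \<epsilon> i * \<sigma> i) (needle_control \<tau> w n \<epsilon>) z \<longrightarrow>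
       \<bar>pe b T \<bullet> (z T - x T) - (\<Sum>i<n. \<epsilon> i * gain (pe b) (\<sigma> i) (\<tau> i) (w i))\<bar> \<le> e * sum \<epsilon> {..<n}"
      using gi by (intro ballI needle_first_order pe(1) e) (auto simp: LP_def)
    from bchoice[OF this] obtain \<delta>b where \<delta>b': "\<forall>b\<in>Basis. 0 < \<delta>b b \<and> (\<forall>\<epsilon> z. (\<forall>i. 0 \<le> \<epsilon> i) \<longrightarrow> sum \<epsilon> {..<n} \<le> \<delta>b b \<longrightarrow>
       is_flow (\<Sum>i<n. \<epsilon> i * \<sigma> i) (needle_control \<tau> w n \<epsilon>) z \<longrightarrow>
       \<bar>pe b T \<bullet> (z T - x T) - (\<Sum>i<n. \<epsilon> i * gain (pe b) (\<sigma> i) (\<tau> i) (w i))\<bar> \<le> e * sum \<epsilon> {..<n})" ..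
    have \<delta>b: "b \<in> Basis \<Longrightarrow> 0 < \<delta>b b" "b \<in> Basis \<Longrightarrow> (\<forall>\<epsilon> z. (\<forall>i. 0 \<le> \<epsilon> i) \<longrightarrow> sum \<epsilon> {..<n} \<le> \<delta>b b \<longrightarrow>
       is_flow (\<Sum>i<n. \<epsilon> i * \<sigma> i) (needle_control \<tau> w n \<epsilon>) z \<longrightarrow>
       \<bar>pe b T \<bullet> (z T - x T) - (\<Sum>i<n. \<epsilon> i * gain (pe b) (\<sigma> i) (\<tau> i) (w i))\<bar> \<le> e * sum \<epsilon> {..<n})" for b
      using \<delta>b' by blast+
    define \<delta>2 where "\<delta>2 = Min (\<delta>b ` Basis)"
    have \<delta>2: "0 < \<delta>2" "\<And>b. b \<in> Basis \<Longrightarrow> \<delta>2 \<le> \<delta>b b"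
      unfolding \<delta>2_def using \<delta>b(1) by (auto simp: Min_gr_iff)
    obtain s1 where s1: "0 < s1" "\<And>s. 0 < s \<Longrightarrow> s < s1 \<Longrightarrow> norm (\<xi> s - x T - s *\<^sub>R d) \<le> \<kappa> / (2 * K) * s"
    proof -
      have pos: "0 < \<kappa> / (2 * K)" using \<kappa> K(1) by simp
      have "\<exists>d'>0. \<forall>y\<in>{0..}. norm (y - 0) < d' \<longrightarrow> norm (\<xi> y - \<xi> 0 - (y - 0) *\<^sub>R d) \<le> \<kappa> / (2 * K) * norm (y - 0)"
        using \<xi>[unfolded has_vector_derivative_def has_derivative_within_alt, THEN conjunct2, THEN spec, THEN mp, OF pos] .
      then obtain d' where "0 < d'" "\<forall>y\<in>{0..}. norm (y - 0) < d' \<longrightarrow> norm (\<xi> y - \<xi> 0 - (y - 0) *\<^sub>R d) \<le> \<kappa> / (2 * K) * norm (y - 0)"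
        by (elim exE conjE) (rule that)
      then show ?thesis by (intro that[of d']) (auto simp: \<xi>0)
    qed
    define s0 where "s0 = min s1 (min (\<delta>1 / B) (\<delta>2 / B))"
    have "0 < s0" using s1 \<delta>1 \<delta>2 B by (simp add: s0_def)
    moreover have "reachable (T + s * \<tau>') (\<xi> s)" if s: "0 < s" "s < s0" for s
    proof -
      define \<epsilon> where "\<epsilon> \<eta> i = s * c \<eta> i" for \<eta> i
      have \<epsilon>0: "\<forall>i. 0 \<le> \<epsilon> \<eta> i" and \<epsilon>B: "sum (\<epsilon> \<eta>) {..<n} \<le> s * B" if "\<eta> \<in> cball 0 \<kappa>" for \<eta>
        using c(2)[OF that] B(2)[OF that] s(1) by (simp_all add: \<epsilon>_def sum_distrib_left[symmetric])
      have "s * B \<le> \<delta>1" "s * B \<le> \<delta>2" using s B(1) by (simp_all add: s0_def field_simps)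
      then have \<epsilon>1: "sum (\<epsilon> \<eta>) {..<n} \<le> \<delta>1" and \<epsilon>2: "b \<in> Basis \<Longrightarrow> sum (\<epsilon> \<eta>) {..<n} \<le> \<delta>b b" if "\<eta> \<in> cball 0 \<kappa>" for \<eta> b
        using \<epsilon>B[OF that] \<delta>2(2)[of b] by linarith+
      define a where "a \<eta> = (\<Sum>i<n. \<epsilon> \<eta> i * \<sigma> i)" for \<eta>
      \<comment> \<open>A flow is chosen for each \<eta> separately; continuity in \<eta> comes from
        the comparison of flows, not from the choice.\<close>
      define z where "z \<eta> = (SOME z. is_flow (a \<eta>) (needle_control \<tau> w n (\<epsilon> \<eta>)) z)" for \<eta>
      have z: "is_flow (a \<eta>) (needle_control \<tau> w n (\<epsilon> \<eta>)) (z \<eta>)" for \<eta>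
        unfolding z_def by (rule someI_ex[OF flow_exists[OF needle_control[OF w]]])
      have a12: "\<bar>a \<eta>\<bar> \<le> 1 / 2" and near: "\<And>t. t \<in> {0..T} \<Longrightarrow> norm (z \<eta> t - x t) < \<rho>" if "\<eta> \<in> cball 0 \<kappa>" for \<eta>
        using est[rule_format, OF \<epsilon>0[OF that, rule_format] \<epsilon>1[OF that]] z[of \<eta>] unfolding a_def by blast+
      have contz: "continuous_on (cball 0 \<kappa>) (\<lambda>\<eta>. z \<eta> T)"
      proof (rule needle_flow_continuous[OF w])
        show "continuous_on (cball 0 \<kappa>) (\<lambda>\<eta>. \<epsilon> \<eta> i)" for i unfolding \<epsilon>_def by (intro continuous_intros c)
        show "is_flow (\<Sum>i<n. \<epsilon> \<eta> i * \<sigma> i) (needle_control \<tau> w n (\<epsilon> \<eta>)) (z \<eta>)" for \<eta> using z[of \<eta>] by (simp add: a_def)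
        show "\<bar>\<Sum>i<n. \<epsilon> \<eta> i * \<sigma> i\<bar> \<le> 1" if "\<eta> \<in> cball 0 \<kappa>" for \<eta> using a12[OF that] by (simp add: a_def)
      qed
      \<comment> \<open>The rescaled miss between the endpoint of the variation with parameter
        \<eta> and the point to be hit. To first order it equals \<eta>, so \<eta> - N \<eta> maps
        the ball into itself, and a fixed point of that map is a zero of \<open>N\<close>.\<close>
      define N where "N \<eta> = (1 / s) *\<^sub>R (a \<eta> * T - s * \<tau>', V (z \<eta> T - \<xi> s))" for \<eta>
      have conta: "continuous_on (cball 0 \<kappa>) a" unfolding a_def[abs_def] \<epsilon>_def by (intro continuous_intros c)
      have contN: "continuous_on (cball 0 \<kappa>) N"
        unfolding N_def[abs_def]
        by (intro continuous_intros conta contz linear_continuous_on_compose[OF _ linV])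
      have small: "norm (\<eta> - N \<eta>) \<le> \<kappa>" if \<eta>: "\<eta> \<in> cball 0 \<kappa>" for \<eta>
      proof -
        have g_sum: "(\<Sum>i<n. \<epsilon> \<eta> i *\<^sub>R g i) = s *\<^sub>R ((\<tau>', V d) + \<eta>)"
          using csum[OF \<eta>] by (simp add: \<epsilon>_def scaleR_sum_right[symmetric] flip: scaleR_scaleR)
        have "fst (\<Sum>i<n. \<epsilon> \<eta> i *\<^sub>R g i) = (\<Sum>i<n. \<epsilon> \<eta> i * (\<sigma> i * T))"
          using gi by (simp add: fst_sum gv_def)
        then have "a \<eta> * T = s * (\<tau>' + fst \<eta>)"
          unfolding g_sum by (simp add: a_def sum_distrib_right mult.assoc)
        \<comment> \<open>The final time is exactly linear in the coefficients, so this component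
          carries no error.\<close>
        then have 1: "fst (N \<eta>) = fst \<eta>" using s by (simp add: N_def algebra_simps)
        have "snd (\<Sum>i<n. \<epsilon> \<eta> i *\<^sub>R g i) = (\<Sum>i<n. \<epsilon> \<eta> i *\<^sub>R (\<Sum>b\<in>Basis. gain (pe b) (\<sigma> i) (\<tau> i) (w i) *\<^sub>R b))"
          using gi by (simp add: snd_sum gv_def)
        also have "\<dots> = (\<Sum>b\<in>Basis. (\<Sum>i<n. \<epsilon> \<eta> i * gain (pe b) (\<sigma> i) (\<tau> i) (w i)) *\<^sub>R b)"
          by (simp add: scaleR_sum_right scaleR_sum_left) (rule sum.swap)
        finally have "V (z \<eta> T - x T) - s *\<^sub>R (V d + snd \<eta>)
            = (\<Sum>b\<in>Basis. (pe b T \<bullet> (z \<eta> T - x T) - (\<Sum>i<n. \<epsilon> \<eta> i * gain (pe b) (\<sigma> i) (\<tau> i) (w i))) *\<^sub>R b)"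
          unfolding g_sum by (simp add: V_def scaleR_diff_left sum_subtractf)
        also have "norm \<dots> \<le> (\<Sum>b\<in>(Basis::'a set). e * (s * B))"
        proof (rule sum_norm_le)
          fix b :: 'a assume b: "b \<in> Basis"
          have "\<bar>pe b T \<bullet> (z \<eta> T - x T) - (\<Sum>i<n. \<epsilon> \<eta> i * gain (pe b) (\<sigma> i) (\<tau> i) (w i))\<bar> \<le> e * sum (\<epsilon> \<eta>) {..<n}"
            using \<delta>b(2)[OF b, rule_format, OF \<epsilon>0[OF \<eta>, rule_format] \<epsilon>2[OF \<eta> b]] z[of \<eta>] by (simp add: a_def)
          also have "\<dots> \<le> e * (s * B)" using \<epsilon>B[OF \<eta>] e by (intro mult_left_mono) auto
          finally show "norm ((pe b T \<bullet> (z \<eta> T - x T) - (\<Sum>i<n. \<epsilon> \<eta> i * gain (pe b) (\<sigma> i) (\<tau> i) (w i))) *\<^sub>R b) \<le> e * (s * B)"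
            using b by simp
        qed
        also have "\<dots> = \<kappa> / 2 * s" using B(1) by (simp add: e_def)
        finally have E1: "norm (V (z \<eta> T - x T) - s *\<^sub>R (V d + snd \<eta>)) \<le> \<kappa> / 2 * s" .
        have "norm (V (\<xi> s - x T - s *\<^sub>R d)) \<le> K * (\<kappa> / (2 * K) * s)"
          using K s1(2)[of s] s by (intro order_trans[OF K(2)] mult_left_mono) (auto simp: s0_def)
        then have E2: "norm (V (\<xi> s - x T - s *\<^sub>R d)) \<le> \<kappa> / 2 * s" using K(1) by simp
        have "V (z \<eta> T - \<xi> s) - s *\<^sub>R snd \<eta> = (V (z \<eta> T - x T) - s *\<^sub>R (V d + snd \<eta>)) - V (\<xi> s - x T - s *\<^sub>R d)"
          unfolding linear_diff[OF linV] linear_scale[OF linV] by (simp add: algebra_simps)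
        then have E: "norm (V (z \<eta> T - \<xi> s) - s *\<^sub>R snd \<eta>) \<le> \<kappa> * s"
          using norm_triangle_ineq4 E1 E2 by (smt (verit) field_sum_of_halves distrib_right)
        have "snd \<eta> - snd (N \<eta>) = - ((1 / s) *\<^sub>R (V (z \<eta> T - \<xi> s) - s *\<^sub>R snd \<eta>))"
          using s by (simp add: N_def scaleR_diff_right)
        then have "norm (snd \<eta> - snd (N \<eta>)) = norm (V (z \<eta> T - \<xi> s) - s *\<^sub>R snd \<eta>) / s"
          using s(1) by (simp only: norm_minus_cancel norm_scaleR) simp
        also have "\<dots> \<le> \<kappa>" using E s(1) by (simp add: divide_le_eq)
        finally have 2: "norm (snd \<eta> - snd (N \<eta>)) \<le> \<kappa>" .
        have "norm (\<eta> - N \<eta>) = norm (snd \<eta> - snd (N \<eta>))"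
          using 1 by (simp add: norm_prod_def)
        then show ?thesis using 2 by simp
      qed
      obtain \<eta> where \<eta>: "\<eta> \<in> cball 0 \<kappa>" "\<eta> - N \<eta> = \<eta>"
        by (rule brouwer_ball[OF \<kappa>, where f = "\<lambda>\<eta>. \<eta> - N \<eta>" and a = 0])
          (use contN small in \<open>auto intro!: continuous_intros\<close>)
      then have "N \<eta> = 0" by simp
      then have "a \<eta> * T = s * \<tau>'" "V (z \<eta> T - \<xi> s) = 0"
        using s by (auto simp: N_def zero_prod_def)
      moreover have "reachable ((1 + a \<eta>) * T) (z \<eta> T)"
        by (rule flow_reachable[OF needle_control[OF w] z a12[OF \<eta>(1)] near[OF \<eta>(1)]])
      ultimately show ?thesis using V0[of "z \<eta> T - \<xi> s"] by (simp add: algebra_simps)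
    qed
    ultimately show ?thesis by blast
  qed
qed

end

subsection \<open>The spacecraft system\<close>

lemma gderiv_of_has_derivative:
  fixes f :: "'a::euclidean_space \<Rightarrow> real"
  assumes "(f has_derivative F) (at x)"
  shows "GDERIV f x :> (\<Sum>e\<in>Basis. F e *\<^sub>R e)"
proof -
  have lin: "linear F" using assms has_derivative_linear by blast
  have "F h = h \<bullet> (\<Sum>e\<in>Basis. F e *\<^sub>R e)" for h
  proof -
    have "F h = F (\<Sum>e\<in>Basis. (h \<bullet> e) *\<^sub>R e)" by (simp add: euclidean_representation)
    also have "\<dots> = (\<Sum>e\<in>Basis. (h \<bullet> e) * F e)" by (simp add: linear_sum[OF lin] linear_scale[OF lin])
    finally show ?thesis by (simp add: inner_sum_right mult.commute)
  qed
  then have "F = (\<lambda>h. h \<bullet> (\<Sum>e\<in>Basis. F e *\<^sub>R e))" by (rule ext)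
  then show ?thesis using assms unfolding gderiv_def by simp
qed

lemma gradient_eqI:
  assumes "GDERIV f x :> d"
  shows "gradient f x = d"
  unfolding gradient_def
proof (rule the_equality)
  show "GDERIV f x :> d" by (rule assms)
next
  fix d' assume "GDERIV f x :> d'"
  then have "(\<lambda>h. h \<bullet> d') = (\<lambda>h. h \<bullet> d)"
    using assms has_derivative_unique unfolding gderiv_def by blast
  then have "h \<bullet> (d' - d) = 0" for h by (simp add: fun_eq_iff inner_diff_right)
  from this[of "d' - d"] show "d' = d" by simp
qed

lemma gradient_of_has_derivative:
  fixes f :: "'a::euclidean_space \<Rightarrow> real"
  assumes "(f has_derivative F) (at x)"
  shows "gradient f x = (\<Sum>e\<in>Basis. F e *\<^sub>R e)" "gradient f x \<bullet> h = F h"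
proof -
  note d = gderiv_of_has_derivative[OF assms]
  show eq: "gradient f x = (\<Sum>e\<in>Basis. F e *\<^sub>R e)" by (rule gradient_eqI[OF d])
  have "(\<lambda>h. h \<bullet> gradient f x) = F"
    using has_derivative_unique[OF assms d[unfolded gderiv_def]] by (simp add: eq)
  then show "gradient f x \<bullet> h = F h" by (metis inner_commute)
qed

section \<open>Smoothness of the spacecraft dynamics and of its adjoint\<close>

locale rocket =
  fixes D :: "vec3 \<Rightarrow> vec3 \<Rightarrow> real" and g :: "vec3 \<Rightarrow> vec3" and b C :: real and Q :: "vec3 set"
  assumes open_Q: "open Q" and b_pos: "0 < b" and C_pos: "0 < C"
    and D_C1: "C1_on (\<lambda>(y, w). D y w) (Q \<times> - {0})"
    and g_C1: "C1_on g Q"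
begin

definition D' :: "vec3 \<times> vec3 \<Rightarrow> (vec3 \<times> vec3) \<Rightarrow>\<^sub>L real" where
  "D' = (SOME f'. (\<forall>z\<in>Q \<times> - {0}. ((\<lambda>(y, w). D y w) has_derivative blinfun_apply (f' z)) (at z)) \<and>
     continuous_on (Q \<times> - {0}) f')"

definition g' :: "vec3 \<Rightarrow> vec3 \<Rightarrow>\<^sub>L vec3" where
  "g' = (SOME f'. (\<forall>z\<in>Q. (g has_derivative blinfun_apply (f' z)) (at z)) \<and> continuous_on Q f')"

lemma D': "z \<in> Q \<times> - {0} \<Longrightarrow> ((\<lambda>(y, w). D y w) has_derivative blinfun_apply (D' z)) (at z)"
  "continuous_on (Q \<times> - {0}) D'"
  using someI_ex[OF D_C1[unfolded C1_on_def]] unfolding D'_def by blast+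

lemma g': "z \<in> Q \<Longrightarrow> (g has_derivative blinfun_apply (g' z)) (at z)" "continuous_on Q g'"
  using someI_ex[OF g_C1[unfolded C1_on_def]] unfolding g'_def by blast+

lemma D_cont: "continuous_on (Q \<times> - {0}) (\<lambda>(y, w). D y w)"
  by (rule has_derivative_continuous_on[where f' = "\<lambda>z. blinfun_apply (D' z)"])
    (rule has_derivative_at_withinI[OF D'(1)])

lemma g_cont: "continuous_on Q g"
  by (rule has_derivative_continuous_on[where f' = "\<lambda>z. blinfun_apply (g' z)"])
    (rule has_derivative_at_withinI[OF g'(1)])

lemma D_deriv:
  assumes "r \<in> Q" "v \<noteq> 0" "(\<rho> has_derivative \<rho>') (at x)" "(\<nu> has_derivative \<nu>') (at x)" "\<rho> x = r" "\<nu> x = v"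
  shows "((\<lambda>z. D (\<rho> z) (\<nu> z)) has_derivative (\<lambda>h. D' (r, v) (\<rho>' h, \<nu>' h))) (at x)"
proof -
  have "((\<lambda>(y, w). D y w) has_derivative blinfun_apply (D' (r, v))) (at ((\<lambda>z. (\<rho> z, \<nu> z)) x))"
    using D'(1)[of "(r, v)"] assms by simp
  from has_derivative_compose[OF has_derivative_Pair[OF assms(3,4)] this] show ?thesis by simp
qed

lemma gradient_D_r:
  assumes "r \<in> Q" "v \<noteq> 0"
  shows "gradient (\<lambda>y. D y v) r = (\<Sum>e\<in>Basis. D' (r, v) (e, 0) *\<^sub>R e)" "gradient (\<lambda>y. D y v) r \<bullet> h = D' (r, v) (h, 0)"
proof -
  have "((\<lambda>y. D y v) has_derivative (\<lambda>h. D' (r, v) (h, 0))) (at r)"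
    by (rule D_deriv[OF assms]) (auto intro!: derivative_eq_intros)
  from gradient_of_has_derivative[OF this] show
    "gradient (\<lambda>y. D y v) r = (\<Sum>e\<in>Basis. D' (r, v) (e, 0) *\<^sub>R e)" "gradient (\<lambda>y. D y v) r \<bullet> h = D' (r, v) (h, 0)"
    by auto
qed

lemma gradient_D_v:
  assumes "r \<in> Q" "v \<noteq> 0"
  shows "gradient (D r) v = (\<Sum>e\<in>Basis. D' (r, v) (0, e) *\<^sub>R e)" "gradient (D r) v \<bullet> h = D' (r, v) (0, h)"
proof -
  have "((\<lambda>w. D r w) has_derivative (\<lambda>h. D' (r, v) (0, h))) (at v)"
    by (rule D_deriv[OF assms]) (auto intro!: derivative_eq_intros)
  from gradient_of_has_derivative[OF this] show
    "gradient (D r) v = (\<Sum>e\<in>Basis. D' (r, v) (0, e) *\<^sub>R e)" "gradient (D r) v \<bullet> h = D' (r, v) (0, h)"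
    by auto
qed

lemma gradient_g:
  assumes "r \<in> Q"
  shows "gradient (\<lambda>y. p \<bullet> g y) r = (\<Sum>e\<in>Basis. (p \<bullet> g' r e) *\<^sub>R e)" "gradient (\<lambda>y. p \<bullet> g y) r \<bullet> h = p \<bullet> g' r h"
proof -
  have "((\<lambda>y. p \<bullet> g y) has_derivative (\<lambda>h. p \<bullet> g' r h)) (at r)"
    by (intro has_derivative_inner_right g'(1) assms)
  from gradient_of_has_derivative[OF this] show
    "gradient (\<lambda>y. p \<bullet> g y) r = (\<Sum>e\<in>Basis. (p \<bullet> g' r e) *\<^sub>R e)" "gradient (\<lambda>y. p \<bullet> g y) r \<bullet> h = p \<bullet> g' r h"
    by auto
qed

definition adjoint_rhs :: "state \<Rightarrow> state \<Rightarrow> vec3 \<Rightarrow> state" where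
  "adjoint_rhs x p u = (adjoint_r D g x p, adjoint_v D x p, adjoint_m D C x p u)"

lemma open_state_space: "open (state_space Q)"
proof -
  have "state_space Q = Q \<times> (- {0}) \<times> {0<..}" by (auto simp: state_space_def)
  then show ?thesis using open_Q by (auto intro!: open_Times)
qed

lemma state_spaceD: "(r, v, m) \<in> state_space Q \<Longrightarrow> r \<in> Q \<and> v \<noteq> 0 \<and> 0 < m"
  by (simp add: state_space_def)

lemma D_cont_on:
  assumes "continuous_on S \<rho>" "continuous_on S \<nu>" "\<And>z. z \<in> S \<Longrightarrow> \<rho> z \<in> Q" "\<And>z. z \<in> S \<Longrightarrow> \<nu> z \<noteq> 0"
  shows "continuous_on S (\<lambda>z. D (\<rho> z) (\<nu> z))"
proof -
  have "continuous_on S (\<lambda>z. (\<lambda>(y, w). D y w) (\<rho> z, \<nu> z))"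
    by (rule continuous_on_compose2[OF D_cont]) (use assms in \<open>auto intro!: continuous_intros\<close>)
  then show ?thesis by simp
qed

lemma D'_cont_on:
  assumes "continuous_on S \<rho>" "continuous_on S \<nu>" "\<And>z. z \<in> S \<Longrightarrow> \<rho> z \<in> Q" "\<And>z. z \<in> S \<Longrightarrow> \<nu> z \<noteq> 0"
  shows "continuous_on S (\<lambda>z. D' (\<rho> z, \<nu> z))"
  by (rule continuous_on_compose2[OF D'(2)]) (use assms in \<open>auto intro!: continuous_intros\<close>)

lemma gradient_D_v_cont_on:
  assumes "continuous_on S \<rho>" "continuous_on S \<nu>" "\<And>z. z \<in> S \<Longrightarrow> \<rho> z \<in> Q" "\<And>z. z \<in> S \<Longrightarrow> \<nu> z \<noteq> 0"
  shows "continuous_on S (\<lambda>z. gradient (D (\<rho> z)) (\<nu> z))"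
proof -
  have "continuous_on S (\<lambda>z. \<Sum>e\<in>Basis. D' (\<rho> z, \<nu> z) (0, e) *\<^sub>R e)"
    by (intro continuous_intros D'_cont_on assms)
  then show ?thesis by (rule continuous_on_eq) (use assms in \<open>simp add: gradient_D_v\<close>)
qed

lemma gradient_D_r_cont_on:
  assumes "continuous_on S \<rho>" "continuous_on S \<nu>" "\<And>z. z \<in> S \<Longrightarrow> \<rho> z \<in> Q" "\<And>z. z \<in> S \<Longrightarrow> \<nu> z \<noteq> 0"
  shows "continuous_on S (\<lambda>z. gradient (\<lambda>y. D y (\<nu> z)) (\<rho> z))"
proof -
  have "continuous_on S (\<lambda>z. \<Sum>e\<in>Basis. D' (\<rho> z, \<nu> z) (e, 0) *\<^sub>R e)"
    by (intro continuous_intros D'_cont_on assms)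
  then show ?thesis by (rule continuous_on_eq) (use assms in \<open>simp add: gradient_D_r\<close>)
qed

lemma gradient_g_cont_on:
  assumes "continuous_on S \<rho>" "continuous_on S p" "\<And>z. z \<in> S \<Longrightarrow> \<rho> z \<in> Q"
  shows "continuous_on S (\<lambda>z. gradient (\<lambda>y. p z \<bullet> g y) (\<rho> z))"
proof -
  have "continuous_on S (\<lambda>z. g' (\<rho> z))"
    by (rule continuous_on_compose2[OF g'(2)]) (use assms in auto)
  then have "continuous_on S (\<lambda>z. \<Sum>e\<in>Basis. (p z \<bullet> g' (\<rho> z) e) *\<^sub>R e)"
    by (intro continuous_intros assms)
  then show ?thesis by (rule continuous_on_eq) (use assms in \<open>simp add: gradient_g\<close>)
qed

lemma dynamics_cont: "continuous_on (state_space Q \<times> W) (\<lambda>(y, w). dynamics D g b C y w)"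
proof -
  have "continuous_on (state_space Q \<times> W) (\<lambda>z. (fst (snd (fst z)),
      - (D (fst (fst z)) (fst (snd (fst z))) / snd (snd (fst z))) *\<^sub>R (fst (snd (fst z)) /\<^sub>R norm (fst (snd (fst z))))
      - g (fst (fst z)) + C *\<^sub>R (snd z /\<^sub>R snd (snd (fst z))), - b * norm (snd z)))"
    by (intro continuous_intros D_cont_on continuous_on_compose2[OF g_cont])
      (auto simp: state_space_def)
  then show ?thesis by (rule continuous_on_eq) auto
qed

lemma adjoint_cont: "continuous_on (state_space Q \<times> UNIV \<times> W) (\<lambda>(y, p, w). adjoint_rhs y p w)"
proof -
  define r v m pr pv w where "r = (\<lambda>z :: state \<times> state \<times> vec3. fst (fst z))"
    and "v = (\<lambda>z :: state \<times> state \<times> vec3. fst (snd (fst z)))"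
    and "m = (\<lambda>z :: state \<times> state \<times> vec3. snd (snd (fst z)))"
    and "pr = (\<lambda>z :: state \<times> state \<times> vec3. fst (fst (snd z)))"
    and "pv = (\<lambda>z :: state \<times> state \<times> vec3. fst (snd (fst (snd z))))"
    and "w = (\<lambda>z :: state \<times> state \<times> vec3. snd (snd z))"
  have c: "continuous_on A r" "continuous_on A v" "continuous_on A m" "continuous_on A pr" "continuous_on A pv" "continuous_on A w" for A
    unfolding r_def v_def m_def pr_def pv_def w_def by (intro continuous_intros)+
  have n: "z \<in> state_space Q \<times> UNIV \<times> W \<Longrightarrow> r z \<in> Q" "z \<in> state_space Q \<times> UNIV \<times> W \<Longrightarrow> v z \<noteq> 0"
    "z \<in> state_space Q \<times> UNIV \<times> W \<Longrightarrow> m z \<noteq> 0" for z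
    by (auto simp: r_def v_def m_def state_space_def)
  have "continuous_on (state_space Q \<times> UNIV \<times> W) (\<lambda>z.
     (((1 / m z) * ((pv z \<bullet> v z) / norm (v z))) *\<^sub>R gradient (\<lambda>y. D y (v z)) (r z) + gradient (\<lambda>y. pv z \<bullet> g y) (r z),
      - pr z + ((1 / m z) * ((pv z \<bullet> v z) / norm (v z))) *\<^sub>R gradient (D (r z)) (v z)
       + (D (r z) (v z) / m z) *\<^sub>R (pv z /\<^sub>R norm (v z)) - ((D (r z) (v z) / m z) * (pv z \<bullet> v z)) *\<^sub>R (v z /\<^sub>R norm (v z) ^ 3),
      (1 / m z) * (pv z \<bullet> (- (D (r z) (v z) / m z) *\<^sub>R (v z /\<^sub>R norm (v z)) + C *\<^sub>R (w z /\<^sub>R m z)))))"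
    by (intro continuous_intros c D_cont_on gradient_D_v_cont_on gradient_D_r_cont_on gradient_g_cont_on)
      (auto simp: n)
  then show ?thesis
    by (rule continuous_on_eq) (auto simp: adjoint_rhs_def r_def v_def m_def pr_def pv_def w_def)
qed

lemma adjoint_linear:
  assumes "y \<in> state_space Q"
  shows "linear (\<lambda>p. adjoint_rhs y p w)"
proof -
  obtain r v m where y: "y = (r, v, m)" "r \<in> Q" "v \<noteq> 0" "0 < m" using assms by (cases y) (auto simp: state_space_def)
  show ?thesis
  proof (rule linearI)
    fix p q :: state
    obtain pr pv pm qr qv qm where p: "p = (pr, pv, pm)" and q: "q = (qr, qv, qm)" by (metis prod.exhaust)
    have "gradient (\<lambda>y. (pv + qv) \<bullet> g y) r = gradient (\<lambda>y. pv \<bullet> g y) r + gradient (\<lambda>y. qv \<bullet> g y) r"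
      unfolding gradient_g(1)[OF y(2)] by (simp add: inner_add_left scaleR_add_left sum.distrib)
    then show "adjoint_rhs y (p + q) w = adjoint_rhs y p w + adjoint_rhs y q w"
      unfolding adjoint_rhs_def y p q
      by (simp add: inner_add_left add_divide_distrib distrib_left distrib_right scaleR_add_left scaleR_add_right algebra_simps)
  next
    fix c :: real and p :: state
    obtain pr pv pm where p: "p = (pr, pv, pm)" by (metis prod.exhaust)
    have "gradient (\<lambda>y. (c *\<^sub>R pv) \<bullet> g y) r = c *\<^sub>R gradient (\<lambda>y. pv \<bullet> g y) r"
      unfolding gradient_g(1)[OF y(2)] by (simp add: scaleR_sum_right)
    then show "adjoint_rhs y (c *\<^sub>R p) w = c *\<^sub>R adjoint_rhs y p w"
      unfolding adjoint_rhs_def y p by (simp add: algebra_simps)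
  qed
qed

lemma hamiltonian_eq:
  "p \<bullet> dynamics D g b C y w = hamiltonian D g b C y p w"
  by (cases y; cases p) (simp add: inner_Pair)

text \<open>Together with \<open>hamiltonian_eq\<close> this identifies the explicit adjoint
  right-hand side with minus the state gradient of the Hamiltonian.\<close>

lemma dynamics_deriv:
  assumes "y \<in> state_space Q"
  shows "((\<lambda>z. p \<bullet> dynamics D g b C z w) has_derivative (\<lambda>d. - (adjoint_rhs y p w \<bullet> d))) (at y)"
proof -
  obtain r v m where y: "y = (r, v, m)" "r \<in> Q" "v \<noteq> 0" "0 < m" using assms by (cases y) (auto simp: state_space_def)
  obtain pr pv pm where p: "p = (pr, pv, pm)" by (metis prod.exhaust)
  let ?r = "\<lambda>z :: state. fst z" and ?v = "\<lambda>z :: state. fst (snd z)" and ?m = "\<lambda>z :: state. snd (snd z)"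
  \<comment> \<open>The drag term is written as a single quotient, so that one application of the
    quotient rule differentiates it.\<close>
  have eq: "p \<bullet> dynamics D g b C z w = pr \<bullet> ?v z - D (?r z) (?v z) * (pv \<bullet> ?v z) / (?m z * norm (?v z)) - pv \<bullet> g (?r z)
      + C * (pv \<bullet> w) / ?m z - pm * b * norm w" for z
    by (cases z) (simp add: p inner_Pair inner_add_right inner_diff_right field_simps)
  have dD: "((\<lambda>z. D (?r z) (?v z)) has_derivative (\<lambda>h. D' (r, v) (?r h, ?v h))) (at y)"
    using y by (intro D_deriv) (auto intro!: derivative_eq_intros)
  have dg: "((\<lambda>z. g (?r z)) has_derivative (\<lambda>h. g' r (?r h))) (at y)"
    using has_derivative_compose[OF bounded_linear_imp_has_derivative[OF bounded_linear_fst], of g "blinfun_apply (g' r)" y UNIV]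
      g'(1)[OF y(2)] y(1) by simp
  have dn: "((\<lambda>z. norm (?v z)) has_derivative (\<lambda>h. ?v h \<bullet> sgn v)) (at y)"
    using has_derivative_compose[OF bounded_linear_imp_has_derivative[OF bounded_linear_compose[OF bounded_linear_fst bounded_linear_snd]],
        of norm "\<lambda>h. h \<bullet> sgn v" y UNIV]
      has_derivative_norm[OF y(3)] y(1) by simp
  have Dsplit: "D' (r, v) (a, c) = gradient (\<lambda>y. D y v) r \<bullet> a + gradient (D r) v \<bullet> c" for a c
    unfolding gradient_D_r(2)[OF y(2,3)] gradient_D_v(2)[OF y(2,3)]
    by (simp flip: blinfun.add_right)
  have dv: "(?v has_derivative ?v) (at y)" and dm: "(?m has_derivative ?m) (at y)"
    by (intro bounded_linear_imp_has_derivative bounded_linear_compose[OF bounded_linear_fst bounded_linear_snd]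
        bounded_linear_compose[OF bounded_linear_snd bounded_linear_snd])+
  have nz: "m * norm v \<noteq> 0" "m \<noteq> 0" "norm v \<noteq> 0" using y by auto
  have d1: "((\<lambda>z. pr \<bullet> ?v z) has_derivative (\<lambda>h. pr \<bullet> ?v h)) (at y)"
    and d1': "((\<lambda>z. pv \<bullet> ?v z) has_derivative (\<lambda>h. pv \<bullet> ?v h)) (at y)"
    and d3: "((\<lambda>z. pv \<bullet> g (?r z)) has_derivative (\<lambda>h. pv \<bullet> g' r (?r h))) (at y)"
    by (intro has_derivative_inner_right dv dg)+
  have d2: "((\<lambda>z. D (?r z) (?v z) * (pv \<bullet> ?v z) / (?m z * norm (?v z))) has_derivative
      (\<lambda>h. ((D r v * (pv \<bullet> ?v h) + D' (r, v) (?r h, ?v h) * (pv \<bullet> v)) * (m * norm v)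
        - D r v * (pv \<bullet> v) * (m * (?v h \<bullet> sgn v) + ?m h * norm v)) / (m * norm v * (m * norm v)))) (at y)"
    using has_derivative_divide'[OF has_derivative_mult[OF dD d1'] has_derivative_mult[OF dm dn]] nz y by simp
  have d4: "((\<lambda>z. C * (pv \<bullet> w) / ?m z) has_derivative (\<lambda>h. (0 * m - C * (pv \<bullet> w) * ?m h) / (m * m))) (at y)"
    using has_derivative_divide'[OF has_derivative_const dm, of "C * (pv \<bullet> w)"] nz y by simp
  have main: "((\<lambda>z. p \<bullet> dynamics D g b C z w) has_derivative (\<lambda>h. pr \<bullet> ?v h -
      ((D r v * (pv \<bullet> ?v h) + D' (r, v) (?r h, ?v h) * (pv \<bullet> v)) * (m * norm v)
        - D r v * (pv \<bullet> v) * (m * (?v h \<bullet> sgn v) + ?m h * norm v)) / (m * norm v * (m * norm v))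
      - pv \<bullet> g' r (?r h) + (0 * m - C * (pv \<bullet> w) * ?m h) / (m * m) - 0)) (at y)"
    unfolding eq by (intro has_derivative_add has_derivative_diff d1 d2 d3 d4 has_derivative_const)
  show ?thesis
  proof (rule has_derivative_eq_rhs[OF main], rule ext)
    fix h :: state
    obtain a c e where h: "h = (a, c, e)" by (metis prod.exhaust)
    \<comment> \<open>With every inner product named, what is left is an identity of rational
      functions.\<close>
    define Ga Gc s s' k N \<gamma> where "Ga = gradient (\<lambda>y. D y v) r \<bullet> a" and "Gc = gradient (D r) v \<bullet> c"
      and "s = pv \<bullet> v" and "s' = pv \<bullet> c" and "k = v \<bullet> c" and "N = norm v" and "\<gamma> = pv \<bullet> g' r a"
    have "adjoint_rhs y p w \<bullet> h = (1 / m * (s / N)) * Ga + \<gamma> + (- (pr \<bullet> c) + (1 / m * (s / N)) * Gc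
        + (D r v / m) * (s' / N) - (D r v / m * s) * (k / N ^ 3)) + (1 / m * (- (D r v / m) * (s / N) + C * ((pv \<bullet> w) / m))) * e"
      unfolding adjoint_rhs_def y p h Ga_def Gc_def s_def s'_def k_def N_def \<gamma>_def
      by (simp add: inner_Pair inner_add_left inner_diff_left inner_add_right inner_diff_right gradient_g(2)[OF y(2)] divide_inverse)
    moreover have "c \<bullet> sgn v = k / N" by (simp add: k_def N_def sgn_div_norm inner_commute divide_inverse)
    moreover have "D' (r, v) (a, c) = Ga + Gc" by (simp add: Dsplit Ga_def Gc_def)
    moreover have "pr \<bullet> c - ((D r v * s' + (Ga + Gc) * s) * (m * N) - D r v * s * (m * (k / N) + e * N)) / (m * N * (m * N))
      - \<gamma> + (0 * m - C * (pv \<bullet> w) * e) / (m * m) - 0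
      = - ((1 / m * (s / N)) * Ga + \<gamma> + (- (pr \<bullet> c) + (1 / m * (s / N)) * Gc
        + (D r v / m) * (s' / N) - (D r v / m * s) * (k / N ^ 3)) + (1 / m * (- (D r v / m) * (s / N) + C * ((pv \<bullet> w) / m))) * e)"
      using nz unfolding N_def[symmetric] by (simp add: field_simps power3_eq_cube)
    ultimately show "pr \<bullet> ?v h - ((D r v * (pv \<bullet> ?v h) + D' (r, v) (?r h, ?v h) * (pv \<bullet> v)) * (m * norm v)
        - D r v * (pv \<bullet> v) * (m * (?v h \<bullet> sgn v) + ?m h * norm v)) / (m * norm v * (m * norm v))
      - pv \<bullet> g' r (?r h) + (0 * m - C * (pv \<bullet> w) * ?m h) / (m * m) - 0 = - (adjoint_rhs y p w \<bullet> h)"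
      unfolding h s_def[symmetric] N_def[symmetric] fst_conv snd_conv s'_def[symmetric] \<gamma>_def[symmetric] by simp
  qed
qed

end

text \<open>An isolated point owns a basic open set that meets \<open>Z\<close> in that point alone,
  so a countable basis can serve only countably many of them.\<close>

lemma countable_isolated_points:
  fixes Z :: "'a::second_countable_topology set"
  shows "countable {t \<in> Z. \<not> t islimpt Z}"
proof -
  obtain B :: "'a set set" where B: "countable B" "topological_basis B" using ex_countable_basis by blast
  have "\<exists>S. t \<in> Z \<and> \<not> t islimpt Z \<longrightarrow> S \<in> B \<and> t \<in> S \<and> S \<inter> Z \<subseteq> {t}" for t
  proof (cases "t \<in> Z \<and> \<not> t islimpt Z")
    case True
    then obtain O' where O': "open O'" "t \<in> O'" "\<forall>y\<in>Z. y \<in> O' \<longrightarrow> y = t" unfolding islimpt_def by blast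
    then obtain S where "S \<in> B" "t \<in> S" "S \<subseteq> O'" using topological_basisE[OF B(2)] by metis
    then show ?thesis using O' by blast
  qed auto
  then obtain S where S: "\<And>t. t \<in> Z \<and> \<not> t islimpt Z \<Longrightarrow> S t \<in> B \<and> t \<in> S t \<and> S t \<inter> Z \<subseteq> {t}" by metis
  have "inj_on S {t \<in> Z. \<not> t islimpt Z}"
  proof (rule inj_onI)
    fix s t assume "s \<in> {t \<in> Z. \<not> t islimpt Z}" "t \<in> {t \<in> Z. \<not> t islimpt Z}" "S s = S t"
    then show "s = t" using S[of s] S[of t] by blast
  qed
  moreover have "S ` {t \<in> Z. \<not> t islimpt Z} \<subseteq> B" using S by blast
  then have "countable (S ` {t \<in> Z. \<not> t islimpt Z})" using B(1) countable_subset by blast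
  ultimately show ?thesis by (rule countable_image_inj_on[rotated])
qed

lemma negligible_isolated_points:
  fixes Z :: "real set"
  shows "negligible {t \<in> Z. \<not> t islimpt Z}"
  unfolding negligible_iff_null_sets
  by (intro null_sets_completionI countable_imp_null_set_lborel countable_isolated_points)

text \<open>At a limit point of \<open>Z\<close> the derivative within \<open>Z\<close> is unique,
  and on \<open>Z\<close> the function coincides with the constant 0.\<close>

lemma derivative_zero_at_limit_of_zeros:
  assumes f: "(f has_vector_derivative f') (at t)" and lim: "t islimpt Z" and t: "t \<in> Z"
    and zero: "\<And>s. s \<in> Z \<Longrightarrow> f s = 0"
  shows "f' = 0"
proof -
  have "(f has_vector_derivative 0) (at t within Z)"
    by (rule has_vector_derivative_transform[OF t _ has_vector_derivative_const[of 0]]) (simp add: zero)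
  moreover have "(f has_vector_derivative f') (at t within Z)"
    using f by (rule has_vector_derivative_at_within)
  moreover have "at t within Z \<noteq> bot" using lim by (simp add: trivial_limit_within)
  ultimately show ?thesis using vector_derivative_unique_within by blast
qed

lemma lipschitz_on_mult_real:
  fixes f h :: "'a::metric_space \<Rightarrow> real"
  assumes f: "A-lipschitz_on S f" and h: "B-lipschitz_on S h"
    and bd: "\<And>x. x \<in> S \<Longrightarrow> \<bar>f x\<bar> \<le> F" "\<And>x. x \<in> S \<Longrightarrow> \<bar>h x\<bar> \<le> H" and "0 \<le> F" "0 \<le> H"
  shows "(F * B + H * A)-lipschitz_on S (\<lambda>x. f x * h x)"
proof (rule lipschitz_onI)
  have AB: "0 \<le> A" "0 \<le> B" using lipschitz_on_nonneg f h by blast+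
  then show "0 \<le> F * B + H * A" using assms by simp
  fix x y assume xy: "x \<in> S" "y \<in> S"
  have "f x * h x - f y * h y = f x * (h x - h y) + h y * (f x - f y)" by (simp add: algebra_simps)
  then have "dist (f x * h x) (f y * h y) \<le> \<bar>f x\<bar> * \<bar>h x - h y\<bar> + \<bar>h y\<bar> * \<bar>f x - f y\<bar>"
    unfolding dist_real_def by (metis abs_mult abs_triangle_ineq)
  also have "\<dots> \<le> F * (B * dist x y) + H * (A * dist x y)"
    using bd(1)[OF xy(1)] bd(2)[OF xy(2)] lipschitz_onD[OF f xy] lipschitz_onD[OF h xy] assms AB
    by (intro add_mono mult_mono) (auto simp: dist_real_def)
  finally show "dist (f x * h x) (f y * h y) \<le> (F * B + H * A) * dist x y" by (simp add: algebra_simps)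
qed

lemma lipschitz_on_inverse_real:
  fixes f :: "'a::metric_space \<Rightarrow> real"
  assumes f: "A-lipschitz_on S f" and \<mu>: "0 < \<mu>" "\<And>x. x \<in> S \<Longrightarrow> \<mu> \<le> f x"
  shows "(A / (\<mu> * \<mu>))-lipschitz_on S (\<lambda>x. 1 / f x)"
proof (rule lipschitz_onI)
  have A: "0 \<le> A" using lipschitz_on_nonneg f by blast
  then show "0 \<le> A / (\<mu> * \<mu>)" using \<mu> by simp
  fix x y assume xy: "x \<in> S" "y \<in> S"
  have pos: "0 < f x" "0 < f y" using \<mu>(1) \<mu>(2)[OF xy(1)] \<mu>(2)[OF xy(2)] by linarith+
  have "1 / f x - 1 / f y = (f y - f x) / (f x * f y)" using pos by (simp add: field_simps)
  then have "dist (1 / f x) (1 / f y) = dist (f x) (f y) / (f x * f y)"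
    using pos by (simp add: dist_real_def abs_mult abs_minus_commute)
  also have "\<dots> \<le> (A * dist x y) / (\<mu> * \<mu>)"
    using lipschitz_onD[OF f xy] \<mu>(1) \<mu>(2)[OF xy(1)] \<mu>(2)[OF xy(2)] pos A
    by (intro frac_le mult_mono) auto
  finally show "dist (1 / f x) (1 / f y) \<le> A / (\<mu> * \<mu>) * dist x y" by simp
qed

section \<open>Maximization of the Hamiltonian and the switching function\<close>

context rocket
begin

text \<open>As a function of w the Hamiltonian is (C/m) pv \<bullet> w - b pm |w| up to a constant.
  In the direction of \<open>pv\<close> it is linear in |w| with the switching function as slope,
  and Cauchy-Schwarz shows that other directions do worse. The alignment persists for slope 0
  because C/m > 0.\<close>

lemma maximizing_thrust:
  assumes m: "0 < m" and pv: "pv \<noteq> 0" and u: "norm u \<le> 1"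
    and max: "\<And>w. norm w \<le> 1 \<Longrightarrow> (pr, pv, pm) \<bullet> dynamics D g b C (r, v, m) w \<le> (pr, pv, pm) \<bullet> dynamics D g b C (r, v, m) u"
  shows "u = norm u *\<^sub>R (pv /\<^sub>R norm pv)" (is ?form)
    and "C / m * norm pv - b * pm < 0 \<Longrightarrow> u = 0"
    and "C / m * norm pv - b * pm > 0 \<Longrightarrow> u = pv /\<^sub>R norm pv"
proof -
  define \<kappa> P \<beta> where "\<kappa> = C / m" and "P = norm pv" and "\<beta> = b * pm"
  have \<kappa>: "0 < \<kappa>" and P: "0 < P" using m C_pos pv by (auto simp: \<kappa>_def P_def)
  have max': "\<kappa> * (pv \<bullet> w) - \<beta> * norm w \<le> \<kappa> * (pv \<bullet> u) - \<beta> * norm u" if "norm w \<le> 1" for w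
    using max[OF that] by (simp add: inner_Pair inner_add_right \<kappa>_def \<beta>_def divide_inverse mult_ac)
  have cs: "pv \<bullet> u \<le> P * norm u" unfolding P_def by (rule norm_cauchy_schwarz)
  \<comment> \<open>Competitors of norm \<open>l\<close> in the direction of \<open>pv\<close>; the
    values 0 and 1 are the ones used.\<close>
  have dir: "l * (\<kappa> * P - \<beta>) \<le> \<kappa> * (pv \<bullet> u) - \<beta> * norm u" if "0 \<le> l" "l \<le> 1" for l
  proof -
    have "pv \<bullet> ((l / P) *\<^sub>R pv) = l * P" using P by (simp add: P_def dot_square_norm power2_eq_square)
    moreover have "norm ((l / P) *\<^sub>R pv) = l" using P that by (simp add: P_def)
    ultimately show ?thesis using max'[of "(l / P) *\<^sub>R pv"] that by (simp add: algebra_simps)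
  qed
  have up: "\<kappa> * (pv \<bullet> u) - \<beta> * norm u \<le> (\<kappa> * P - \<beta>) * norm u"
    using mult_left_mono[OF cs, of \<kappa>] \<kappa> by (simp add: algebra_simps)
  have neg: "u = 0" if "\<kappa> * P - \<beta> < 0"
  proof (rule ccontr)
    assume "u \<noteq> 0"
    then have "(\<kappa> * P - \<beta>) * norm u < 0" using that by (simp add: mult_neg_pos)
    then show False using dir[of 0] up by simp
  qed
  have eq: "pv \<bullet> u = P * norm u"
  proof (cases "\<kappa> * P - \<beta> < 0")
    case True
    then show ?thesis using neg by simp
  next
    case False
    then have "(\<kappa> * P - \<beta>) * norm u \<le> (\<kappa> * P - \<beta>)" using u by (simp add: mult_left_le)
    then have "(\<kappa> * P - \<beta>) * norm u \<le> \<kappa> * (pv \<bullet> u) - \<beta> * norm u"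
      using dir[of 1] by simp
    then have "\<kappa> * (P * norm u) \<le> \<kappa> * (pv \<bullet> u)" by (simp add: algebra_simps)
    then have "P * norm u \<le> pv \<bullet> u" using \<kappa> by simp
    then show ?thesis using cs by simp
  qed
  have "P *\<^sub>R u = norm u *\<^sub>R pv" using eq norm_cauchy_schwarz_eq[of pv u] by (simp add: P_def)
  then have "(1 / P) *\<^sub>R (P *\<^sub>R u) = (1 / P) *\<^sub>R (norm u *\<^sub>R pv)" by simp
  then show form: ?form using P by (simp add: P_def divide_inverse mult.commute)
  show "u = 0" if "C / m * norm pv - b * pm < 0" using neg that by (simp add: \<kappa>_def P_def \<beta>_def)
  show "u = pv /\<^sub>R norm pv" if "C / m * norm pv - b * pm > 0"
  proof -
    have pos: "0 < \<kappa> * P - \<beta>" using that by (simp add: \<kappa>_def P_def \<beta>_def)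
    have "(\<kappa> * P - \<beta>) * 1 \<le> (\<kappa> * P - \<beta>) * norm u" using dir[of 1] up by simp
    then have "1 \<le> norm u" using pos by (simp only: mult_le_cancel_left_pos)
    then have "norm u = 1" using u by simp
    then show ?thesis using form by simp
  qed
qed

text \<open>The control drops out: with \<open>u\<close> along \<open>pv\<close>, the contribution C
  b |u| |pv| / m^2 of m' cancels the contribution - b C (pv \<bullet> u) / m^2 of pm'.\<close>

lemma switching_derivative:
  assumes v: "v t \<noteq> 0" and m: "0 < m t" and pv: "pv t \<noteq> 0" and u: "u = norm u *\<^sub>R (pv t /\<^sub>R norm (pv t))"
    and dm: "(m has_real_derivative - b * norm u) (at t)"
    and dpv: "(pv has_vector_derivative adjoint_v D (r t, v t, m t) (pr t, pv t, pm t)) (at t)"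
    and dpm: "(pm has_real_derivative adjoint_m D C (r t, v t, m t) (pr t, pv t, pm t) u) (at t)"
  shows "(switching b C m pv pm has_real_derivative Xi D b C ((r t, v t, m t), (pr t, pv t, pm t))) (at t)"
proof -
  define \<pi> where "\<pi> = adjoint_v D (r t, v t, m t) (pr t, pv t, pm t)"
  define P where "P = norm (pv t)"
  have P: "0 < P" using pv by (simp add: P_def)
  have "((\<lambda>s. norm (pv s)) has_derivative (\<lambda>h. (h *\<^sub>R \<pi>) \<bullet> sgn (pv t))) (at t)"
    using has_derivative_compose[OF dpv[unfolded has_vector_derivative_def] has_derivative_norm[OF pv]]
    by (simp add: \<pi>_def)
  then have dn: "((\<lambda>s. norm (pv s)) has_real_derivative \<pi> \<bullet> sgn (pv t)) (at t)"
    by (simp add: has_field_derivative_def mult_commute_abs)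
  have pvu: "pv t \<bullet> u = P * norm u"
    by (subst u) (use P in \<open>simp add: P_def dot_square_norm power2_eq_square\<close>)
  define \<alpha> M V s N where "\<alpha> = norm u" and "M = m t" and "V = norm (v t)" and "s = pv t \<bullet> v t" and "N = D (r t) (v t)"
  have nz: "M \<noteq> 0" "V \<noteq> 0" using v m by (auto simp: M_def V_def)
  have am: "adjoint_m D C (r t, v t, m t) (pr t, pv t, pm t) u = (1 / M) * (- (N / M) * (s / V) + C * (P * \<alpha> / M))"
    using pvu by (simp add: M_def N_def s_def V_def \<alpha>_def inner_add_right inner_diff_right divide_inverse mult.commute)
  have "\<pi> \<bullet> sgn (pv t) = (pv t \<bullet> \<pi>) / P"
    by (simp add: sgn_div_norm P_def inner_commute divide_inverse)
  also have "pv t \<bullet> \<pi> = - (pv t \<bullet> pr t) + (1 / M * (s / V)) * (gradient (D (r t)) (v t) \<bullet> pv t)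
      + (N / M) * (P * P / V) - (N / M * s) * (s / V ^ 3)"
    unfolding \<pi>_def by (simp add: M_def N_def s_def V_def P_def inner_add_right inner_diff_right inner_commute
        dot_square_norm power2_eq_square divide_inverse)
  finally have n': "\<pi> \<bullet> sgn (pv t) = (- (pv t \<bullet> pr t) + (1 / M * (s / V)) * (gradient (D (r t)) (v t) \<bullet> pv t)
      + (N / M) * (P * P / V) - (N / M * s) * (s / V ^ 3)) / P" .
  have "((\<lambda>s. C / m s * norm (pv s) - b * pm s) has_real_derivative
      (0 * m t - C * (- b * norm u)) / (m t * m t) * norm (pv t) + (\<pi> \<bullet> sgn (pv t)) * (C / m t)
      - b * adjoint_m D C (r t, v t, m t) (pr t, pv t, pm t) u) (at t)"
    using m by (intro DERIV_diff DERIV_mult DERIV_divide DERIV_const dm dn DERIV_cmult[OF dpm]) auto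
  moreover have "(0 * m t - C * (- b * norm u)) / (m t * m t) * norm (pv t) + (\<pi> \<bullet> sgn (pv t)) * (C / m t)
      - b * adjoint_m D C (r t, v t, m t) (pr t, pv t, pm t) u = Xi D b C ((r t, v t, m t), (pr t, pv t, pm t))"
    unfolding am n' Xi.simps
    unfolding M_def[symmetric] V_def[symmetric] s_def[symmetric] N_def[symmetric] P_def[symmetric] \<alpha>_def[symmetric]
    using nz P by (simp add: field_simps power2_eq_square power3_eq_cube)
  ultimately show ?thesis by (simp add: switching_def[abs_def])
qed

lemma Xi_cont:
  assumes z: "continuous_on S r" "continuous_on S v" "continuous_on S m" "continuous_on S pr" "continuous_on S pv"
    and n: "\<And>s. s \<in> S \<Longrightarrow> r s \<in> Q" "\<And>s. s \<in> S \<Longrightarrow> v s \<noteq> 0" "\<And>s. s \<in> S \<Longrightarrow> m s \<noteq> 0" "\<And>s. s \<in> S \<Longrightarrow> pv s \<noteq> 0"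
  shows "continuous_on S (\<lambda>s. Xi D b C ((r s, v s, m s), (pr s, pv s, pm s)))"
  unfolding Xi.simps
  by (intro continuous_intros z D_cont_on gradient_D_v_cont_on) (auto simp: n)

text \<open>\<open>Xi\<close> contains the velocity gradient of \<open>D\<close>, and
  \<open>D\<close> is only C1. Differentiability of that gradient is therefore a separate
  hypothesis, and the relation for \<alpha> is conditional on it.\<close>

lemma Xi_differentiable:
  assumes n: "r \<in> Q" "v \<noteq> 0" "m \<noteq> 0" "pv \<noteq> 0"
    and G: "(\<lambda>(y, w). gradient (D y) w) differentiable (at (r, v))"
  shows "Xi D b C differentiable (at ((r, v, m), (pr, pv, pm)))"
proof -
  let ?z = "((r, v, m), (pr, pv, pm))"
  let ?r = "\<lambda>z :: state \<times> state. fst (fst z)" and ?v = "\<lambda>z :: state \<times> state. fst (snd (fst z))"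
    and ?m = "\<lambda>z :: state \<times> state. snd (snd (fst z))" and ?pr = "\<lambda>z :: state \<times> state. fst (snd z)"
    and ?pv = "\<lambda>z :: state \<times> state. fst (snd (snd z))"
  have p: "?r differentiable (at ?z)" "?v differentiable (at ?z)" "?m differentiable (at ?z)" "?pr differentiable (at ?z)" "?pv differentiable (at ?z)"
    by (rule bounded_linear_imp_differentiable, intro bounded_linear_intros)+
  have rv: "(\<lambda>z. (?r z, ?v z)) differentiable (at ?z)" using p by (intro differentiable_Pair)
  have "(\<lambda>z. (\<lambda>(y, w). D y w) (?r z, ?v z)) differentiable (at ?z)"
    using D'(1)[of "(r, v)"] n by (intro differentiable_compose[OF _ rv]) (auto simp: differentiable_def)
  then have dD: "(\<lambda>z. D (?r z) (?v z)) differentiable (at ?z)" by simp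
  have "(\<lambda>z. (\<lambda>(y, w). gradient (D y) w) (?r z, ?v z)) differentiable (at ?z)"
    using G by (intro differentiable_compose[OF _ rv]) auto
  then have dG: "(\<lambda>z. gradient (D (?r z)) (?v z)) differentiable (at ?z)" by simp
  have nv: "(\<lambda>z. norm (?v z)) differentiable (at ?z)" and np: "(\<lambda>z. norm (?pv z)) differentiable (at ?z)"
    using differentiable_compose[of norm ?v ?z UNIV, OF _ p(2)] differentiable_compose[of norm ?pv ?z UNIV, OF _ p(5)] n
    by simp_all
  have "Xi D b C = (\<lambda>z. D (?r z) (?v z) * b / ((?m z)\<^sup>2 * norm (?v z)) * (?pv z \<bullet> ?v z)
     + C / (?m z * norm (?pv z)) *
       (- (?pv z \<bullet> ?pr z) + (?pv z \<bullet> ?v z) / (?m z * norm (?v z)) * (gradient (D (?r z)) (?v z) \<bullet> ?pv z)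
        + D (?r z) (?v z) * (norm (?pv z))\<^sup>2 / (?m z * norm (?v z)) - D (?r z) (?v z) / ?m z * (?pv z \<bullet> ?v z)\<^sup>2 / norm (?v z) ^ 3))"
    by (rule ext) (auto simp: Xi.simps)
  then show ?thesis
    using n by (simp only:) (intro differentiable_add differentiable_mult differentiable_divide differentiable_diff
      differentiable_minus differentiable_power differentiable_inner differentiable_const p dD dG nv np; simp)
qed

end

subsection \<open>Nondegenerate extremals\<close>

lemma has_vector_derivative_triple:
  assumes "((\<lambda>t. (r t, v t, m t)) has_vector_derivative (r', v', m')) (at t)"
  shows "(r has_vector_derivative r') (at t)" "(v has_vector_derivative v') (at t)" "(m has_vector_derivative m') (at t)"
  using bounded_linear.has_vector_derivative[OF bounded_linear_fst assms]
    bounded_linear.has_vector_derivative[OF bounded_linear_compose[OF bounded_linear_fst bounded_linear_snd] assms]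
    bounded_linear.has_vector_derivative[OF bounded_linear_compose[OF bounded_linear_snd bounded_linear_snd] assms]
  by simp_all

lemma lipschitz_on_triple:
  assumes "B-lipschitz_on S (\<lambda>t. (r t, v t, m t))"
  shows "B-lipschitz_on S r" "B-lipschitz_on S v" "B-lipschitz_on S m"
proof -
  have B: "0 \<le> B" and d: "\<And>s t. s \<in> S \<Longrightarrow> t \<in> S \<Longrightarrow> dist (r s, v s, m s) (r t, v t, m t) \<le> B * dist s t"
    using assms lipschitz_on_nonneg lipschitz_onD by blast+
  have c: "dist a a' \<le> dist (a, a2, a3) (a', a2', a3')" "dist a2 a2' \<le> dist (a, a2, a3) (a', a2', a3')"
    "dist a3 a3' \<le> dist (a, a2, a3) (a', a2', a3')" for a a' :: 'b and a2 a2' :: 'c and a3 a3' :: 'd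
    using dist_fst_le[of "(a, a2, a3)" "(a', a2', a3')"] dist_snd_le[of "(a, a2, a3)" "(a', a2', a3')"]
      dist_fst_le[of "(a2, a3)" "(a2', a3')"] dist_snd_le[of "(a2, a3)" "(a2', a3')"] by simp_all
  show "B-lipschitz_on S r" by (rule lipschitz_onI[OF _ B], rule order_trans[OF c(1) d])
  show "B-lipschitz_on S v" by (rule lipschitz_onI[OF _ B], rule order_trans[OF c(2) d])
  show "B-lipschitz_on S m" by (rule lipschitz_onI[OF _ B], rule order_trans[OF c(3) d])
qed

locale rocket_trajectory = rocket D g b C Q +
    control_trajectory "dynamics D g b C" "rocket.adjoint_rhs D g C" "state_space Q" "cball 0 1" T u "\<lambda>t. (r t, v t, m t)"
  for D g b C Q T u r v m

lemma (in rocket) rocket_trajectoryI: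
  assumes "admissible D g b C Q x\<^sub>0 M\<^sub>1 T u (\<lambda>t. (r t, v t, m t))"
  shows "rocket_trajectory D g b C Q T u r v m"
proof -
  interpret control_trajectory "dynamics D g b C" adjoint_rhs "state_space Q" "cball 0 1" T u "\<lambda>t. (r t, v t, m t)"
  proof (rule control_trajectory.intro)
    show "linear (\<lambda>p. adjoint_rhs y p w)" if "y \<in> state_space Q" for y w using that by (rule adjoint_linear)
    show "((\<lambda>z. p \<bullet> dynamics D g b C z w) has_derivative (\<lambda>d. - (adjoint_rhs y p w \<bullet> d))) (at y)"
      if "y \<in> state_space Q" for y w p using that by (rule dynamics_deriv)
    show "u t \<in> cball 0 1" if "t \<in> {0..T}" for t using assms that by (simp add: admissible_def)
    show "(r t, v t, m t) \<in> state_space Q" if "t \<in> {0..T}" for t using assms that by (simp add: admissible_def)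
  qed (use assms in \<open>simp_all only: admissible_def open_state_space dynamics_cont adjoint_cont compact_cball\<close>)
  show ?thesis by unfold_locales
qed

context rocket_trajectory
begin

lemma state_at: "t \<in> {0..T} \<Longrightarrow> r t \<in> Q \<and> v t \<noteq> 0 \<and> 0 < m t"
  using x_X by (auto dest: state_spaceD)

lemma adjoint_rhs_mass_only:
  assumes "t \<in> {0..T}"
  shows "adjoint_rhs (r t, v t, m t) (0, 0, c) w = 0"
  using gradient_g(1)[of "r t" 0] state_at[OF assms] by (simp add: adjoint_rhs_def zero_prod_def)

lemma costate_const: "costate (\<lambda>t. (0, 0, c))"
  unfolding costate_def
proof (intro conjI ballI)
  fix t assume t: "t \<in> {0..T}"
  have "((\<lambda>s. adjoint_rhs (r s, v s, m s) (0, 0, c) (u s)) has_integral 0) {0..t}"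
    by (rule has_integral_is_0) (use t in \<open>auto intro!: adjoint_rhs_mass_only\<close>)
  then show "((\<lambda>s. adjoint_rhs (r s, v s, m s) (0, 0, c) (u s)) has_integral (0, 0, c) - (0, 0, c)) {0..t}"
    by (simp only: diff_self)
qed simp

text \<open>Subtracting the constant costate (0, 0, c) leaves a costate with a zero.\<close>

lemma costate_mass_only:
  assumes p: "costate p" and t: "t \<in> {0..T}" "p t = (0, 0, c)" and s: "s \<in> {0..T}"
  shows "p s = (0, 0, c)"
proof -
  have "costate (\<lambda>t. \<Sum>i\<in>{0, 1::nat}. (if i = 0 then 1 else - 1) *\<^sub>R (if i = 0 then p else (\<lambda>t. (0, 0, c))) t)"
    by (rule costate_sum) (auto simp: p costate_const)
  then have "costate (\<lambda>t. p t + (0, 0, - c))" by simp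
  from costate_zero[OF this t(1) _ s] t(2) have "p s + (0, 0, - c) = 0" by (simp add: zero_prod_def)
  then have "p s = - (0, 0, - c)" by (simp only: eq_neg_iff_add_eq_0)
  then show ?thesis by simp
qed

lemma costate_lipschitz:
  assumes p: "costate p"
  obtains B where "B-lipschitz_on {0..T} p"
proof -
  have pc: "continuous_on {0..T} p" using p by (simp add: costate_def)
  obtain P where P: "\<And>t. t \<in> {0..T} \<Longrightarrow> norm (p t) \<le> P"
    using compact_imp_bounded[OF compact_continuous_image[OF pc compact_Icc]] unfolding bounded_iff by blast
  have "0 \<le> P" using order_trans[OF norm_ge_zero P[of 0]] T_pos by simp
  have "(L * P)-lipschitz_on {0..T} p"
  proof (rule primitive_lipschitz_on)
    show "((\<lambda>s. adjoint_rhs (r s, v s, m s) (p s) (u s)) has_integral p t - p 0) {0..t}" if "t \<in> {0..T}" for t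
      using p that by (simp add: costate_def)
    show "norm (adjoint_rhs (r t, v t, m t) (p t) (u t)) \<le> L * P" if t: "t \<in> {0..T}" for t
      using adj_bound[OF t x_in_tube u_W[OF t], of "p t"] P[OF t] L_nonneg by (meson mult_left_mono order_trans)
  qed (use L_nonneg \<open>0 \<le> P\<close> in simp)
  then show ?thesis by (rule that)
qed

lemma x_lipschitz: obtains B where "B-lipschitz_on {0..T} (\<lambda>t. (r t, v t, m t))"
proof -
  have "M-lipschitz_on {0..T} (\<lambda>t. (r t, v t, m t))"
    by (rule primitive_lipschitz_on[OF x_primitive f_bound[OF _ x_in_tube u_W] M_nonneg])
  then show ?thesis by (rule that)
qed

lemma costate_AE:
  assumes p: "costate p"
  obtains N where "negligible N" "\<And>t. t \<in> {0..T} - N \<Longrightarrow> t \<in> {0<..<T} \<and>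
    (p has_vector_derivative adjoint_rhs (r t, v t, m t) (p t) (u t)) (at t)"
proof -
  have int: "((\<lambda>s. adjoint_rhs (r s, v s, m s) (p s) (u s)) has_integral p t - p 0) {0..t}" if "t \<in> {0..T}" for t
    using p that by (simp add: costate_def)
  obtain N where "negligible N" "\<And>t. t \<in> {0..T} - N \<Longrightarrow> t \<in> {0<..<T}"
    "\<And>t. t \<in> {0..T} - N \<Longrightarrow> (p has_vector_derivative adjoint_rhs (r t, v t, m t) (p t) (u t)) (at t)"
    by (rule primitive_has_vector_derivative_AE[OF int]) (use T_pos in auto)
  then show ?thesis by (intro that[of N]) auto
qed

end

locale rocket_extremal = rocket_trajectory +
  fixes pr pv :: "real \<Rightarrow> vec3" and pm :: "real \<Rightarrow> real"
  assumes p_costate: "costate (\<lambda>t. (pr t, pv t, pm t))"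
    and p_max: "\<exists>N. negligible N \<and> (\<forall>t\<in>{0..T} - N. \<forall>w\<in>cball 0 1.
      (pr t, pv t, pm t) \<bullet> dynamics D g b C (r t, v t, m t) w \<le> (pr t, pv t, pm t) \<bullet> dynamics D g b C (r t, v t, m t) (u t))"
    and p_nondegenerate: "\<not> (\<forall>t\<in>{0..T}. pr t = 0 \<and> pv t = 0)"
begin

abbreviation "z t \<equiv> ((r t, v t, m t), (pr t, pv t, pm t))"

abbreviation "\<Psi> \<equiv> switching b C m pv pm"

text \<open>Collects the almost everywhere properties at a single time, so that the arguments about
  the control and the switching function become pointwise.\<close>

definition good :: "real \<Rightarrow> bool" where
  "good t \<longleftrightarrow> t \<in> {0<..<T} \<and>
     ((\<lambda>t. (r t, v t, m t)) has_vector_derivative dynamics D g b C (r t, v t, m t) (u t)) (at t) \<and>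
     ((\<lambda>t. (pr t, pv t, pm t)) has_vector_derivative adjoint_rhs (r t, v t, m t) (pr t, pv t, pm t) (u t)) (at t) \<and>
     (\<forall>w\<in>cball 0 1. (pr t, pv t, pm t) \<bullet> dynamics D g b C (r t, v t, m t) w
        \<le> (pr t, pv t, pm t) \<bullet> dynamics D g b C (r t, v t, m t) (u t)) \<and>
     pv t \<noteq> 0"

lemma good_AE: "\<exists>N. negligible N \<and> (\<forall>t\<in>{0..T} - N. good t)"
proof -
  obtain N1 where N1: "negligible N1" "\<And>t. t \<in> {0..T} - N1 \<Longrightarrow>
      ((\<lambda>t. (r t, v t, m t)) has_vector_derivative dynamics D g b C (r t, v t, m t) (u t)) (at t)"
    using x_ode by (auto simp: AE_lebesgue_on_iff_negligible)
  obtain N2 where N2: "negligible N2" "\<And>t. t \<in> {0..T} - N2 \<Longrightarrow> t \<in> {0<..<T} \<and>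
      ((\<lambda>t. (pr t, pv t, pm t)) has_vector_derivative adjoint_rhs (r t, v t, m t) (pr t, pv t, pm t) (u t)) (at t)"
    by (rule costate_AE[OF p_costate]) (rule that)
  obtain N3 where N3: "negligible N3" "\<And>t w. t \<in> {0..T} - N3 \<Longrightarrow> w \<in> cball 0 1 \<Longrightarrow>
      (pr t, pv t, pm t) \<bullet> dynamics D g b C (r t, v t, m t) w \<le> (pr t, pv t, pm t) \<bullet> dynamics D g b C (r t, v t, m t) (u t)"
    using p_max by blast
  define Z where "Z = {t \<in> {0..T}. pv t = 0}"
  \<comment> \<open>Zeros of \<open>pv\<close> that remain outside \<open>N\<close> are limit points
    of zeros, where the derivative of \<open>pv\<close> must vanish as well.\<close>
  define N where "N = N1 \<union> N2 \<union> N3 \<union> {t \<in> Z. \<not> t islimpt Z}"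
  have "negligible N" unfolding N_def using N1(1) N2(1) N3(1) negligible_isolated_points by (intro negligible_Un)
  moreover have "good t" if t: "t \<in> {0..T} - N" for t
  proof -
    have dp: "((\<lambda>t. (pr t, pv t, pm t)) has_vector_derivative
        (adjoint_r D g (r t, v t, m t) (pr t, pv t, pm t), adjoint_v D (r t, v t, m t) (pr t, pv t, pm t),
         adjoint_m D C (r t, v t, m t) (pr t, pv t, pm t) (u t))) (at t)"
      using N2(2)[of t] t by (simp add: N_def adjoint_rhs_def)
    have "pv t \<noteq> 0"
    proof
      assume pv0: "pv t = 0"
      then have tZ: "t \<in> Z" "t islimpt Z" using t by (auto simp: Z_def N_def)
      have "adjoint_v D (r t, v t, m t) (pr t, pv t, pm t) = 0"
        by (rule derivative_zero_at_limit_of_zeros[OF has_vector_derivative_triple(2)[OF dp] tZ(2,1)]) (simp add: Z_def)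
      then have "pr t = 0" by (simp add: pv0)
      then have "(pr t, pv t, pm t) = (0, 0, pm t)" using pv0 by simp
      then have "(pr s, pv s, pm s) = (0, 0, pm t)" if "s \<in> {0..T}" for s
        using costate_mass_only[OF p_costate, of t "pm t" s] t that by auto
      then show False using p_nondegenerate by blast
    qed
    then show ?thesis using N1(2)[of t] N2(2)[of t] N3(2)[of t] t by (auto simp: good_def N_def)
  qed
  ultimately show ?thesis by blast
qed

lemma good_derivatives:
  assumes "good t"
  shows "(m has_real_derivative - b * norm (u t)) (at t)"
    "(pr has_vector_derivative adjoint_r D g (r t, v t, m t) (pr t, pv t, pm t)) (at t)"
    "(pv has_vector_derivative adjoint_v D (r t, v t, m t) (pr t, pv t, pm t)) (at t)"
    "(pm has_real_derivative adjoint_m D C (r t, v t, m t) (pr t, pv t, pm t) (u t)) (at t)"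
proof -
  have dx: "((\<lambda>t. (r t, v t, m t)) has_vector_derivative (v t,
      - (D (r t) (v t) / m t) *\<^sub>R (v t /\<^sub>R norm (v t)) - g (r t) + C *\<^sub>R (u t /\<^sub>R m t), - b * norm (u t))) (at t)"
    using assms by (simp add: good_def)
  have dp: "((\<lambda>t. (pr t, pv t, pm t)) has_vector_derivative
        (adjoint_r D g (r t, v t, m t) (pr t, pv t, pm t), adjoint_v D (r t, v t, m t) (pr t, pv t, pm t),
         adjoint_m D C (r t, v t, m t) (pr t, pv t, pm t) (u t))) (at t)"
    using assms by (simp add: good_def adjoint_rhs_def)
  show "(m has_real_derivative - b * norm (u t)) (at t)"
    using has_vector_derivative_triple(3)[OF dx] by (simp add: has_real_derivative_iff_has_vector_derivative)
  show "(pr has_vector_derivative adjoint_r D g (r t, v t, m t) (pr t, pv t, pm t)) (at t)"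
    "(pv has_vector_derivative adjoint_v D (r t, v t, m t) (pr t, pv t, pm t)) (at t)"
    by (rule has_vector_derivative_triple[OF dp])+
  show "(pm has_real_derivative adjoint_m D C (r t, v t, m t) (pr t, pv t, pm t) (u t)) (at t)"
    using has_vector_derivative_triple(3)[OF dp] by (simp only: has_real_derivative_iff_has_vector_derivative)
qed

lemma good_control:
  assumes "good t"
  shows "u t = norm (u t) *\<^sub>R (pv t /\<^sub>R norm (pv t))" "\<Psi> t < 0 \<Longrightarrow> u t = 0" "\<Psi> t > 0 \<Longrightarrow> u t = pv t /\<^sub>R norm (pv t)"
    "norm (u t) \<le> 1"
proof -
  have t: "t \<in> {0..T}" "pv t \<noteq> 0" using assms by (auto simp: good_def)
  show u1: "norm (u t) \<le> 1" using u_W[OF t(1)] by simp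
  have max: "(pr t, pv t, pm t) \<bullet> dynamics D g b C (r t, v t, m t) w \<le> (pr t, pv t, pm t) \<bullet> dynamics D g b C (r t, v t, m t) (u t)"
    if "norm w \<le> 1" for w using assms that by (simp add: good_def)
  note * = maximizing_thrust[OF _ t(2) u1 max]
  show "u t = norm (u t) *\<^sub>R (pv t /\<^sub>R norm (pv t))" using *(1) state_at[OF t(1)] by blast
  show "\<Psi> t < 0 \<Longrightarrow> u t = 0" "\<Psi> t > 0 \<Longrightarrow> u t = pv t /\<^sub>R norm (pv t)"
    using *(2,3) state_at[OF t(1)] unfolding switching_def by blast+
qed

lemma good_switching_derivative:
  assumes "good t"
  shows "(\<Psi> has_real_derivative Xi D b C (z t)) (at t)"
proof -
  have "t \<in> {0..T}" "pv t \<noteq> 0" using assms by (auto simp: good_def)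
  then show ?thesis
    using state_at[of t] good_control(1)[OF assms] good_derivatives[OF assms]
    by (intro switching_derivative) auto
qed

text \<open>Lipschitz continuity, hence absolute continuity, is what allows recovering \<Psi> from
  its derivative almost everywhere. Division by m is harmless because m attains a positive
  minimum.\<close>

lemma switching_lipschitz: obtains B where "B-lipschitz_on {0..T} \<Psi>"
proof -
  obtain A where "A-lipschitz_on {0..T} (\<lambda>t. (r t, v t, m t))" by (rule x_lipschitz)
  then have m: "A-lipschitz_on {0..T} m" by (rule lipschitz_on_triple)
  obtain B where B: "B-lipschitz_on {0..T} (\<lambda>t. (pr t, pv t, pm t))" by (rule costate_lipschitz[OF p_costate])
  have pv: "B-lipschitz_on {0..T} pv" and pm: "B-lipschitz_on {0..T} pm" using lipschitz_on_triple[OF B] by auto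
  have "continuous_on {0..T} m" "{0..T} \<noteq> {}" using m T_pos by (auto intro: lipschitz_on_continuous_on)
  then obtain t1 where t1: "t1 \<in> {0..T}" "\<And>t. t \<in> {0..T} \<Longrightarrow> m t1 \<le> m t"
    using continuous_attains_inf[of "{0..T}" m] by auto
  have \<mu>: "0 < m t1" using state_at[OF t1(1)] by simp
  have im: "(A / (m t1 * m t1))-lipschitz_on {0..T} (\<lambda>t. 1 / m t)"
    by (rule lipschitz_on_inverse_real[OF m \<mu> t1(2)])
  have np: "B-lipschitz_on {0..T} (\<lambda>t. norm (pv t))"
  proof (rule lipschitz_onI)
    fix s t assume st: "s \<in> {0..T}" "t \<in> {0..T}"
    have "dist (norm (pv s)) (norm (pv t)) \<le> dist (pv s) (pv t)"
      unfolding dist_real_def dist_norm by (rule norm_triangle_ineq3)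
    then show "dist (norm (pv s)) (norm (pv t)) \<le> B * dist s t" using lipschitz_onD[OF pv st] by linarith
  qed (rule lipschitz_on_nonneg[OF pv])
  obtain P where P: "\<And>t. t \<in> {0..T} \<Longrightarrow> norm (pv t) \<le> P"
    using compact_imp_bounded[OF compact_continuous_image[OF lipschitz_on_continuous_on[OF pv] compact_Icc]]
    unfolding bounded_iff by blast
  have "0 \<le> P" using order_trans[OF norm_ge_zero P[of 0]] T_pos by simp
  have bd: "\<bar>1 / m t\<bar> \<le> 1 / m t1" if "t \<in> {0..T}" for t
    using t1(2)[OF that] \<mu> by (simp add: frac_le)
  have "(1 / m t1 * B + P * (A / (m t1 * m t1)))-lipschitz_on {0..T} (\<lambda>t. 1 / m t * norm (pv t))"
    by (rule lipschitz_on_mult_real[OF im np bd]) (use P \<open>0 \<le> P\<close> \<mu> in auto)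
  then obtain E where E: "E-lipschitz_on {0..T} (\<lambda>t. 1 / m t * norm (pv t))" by blast
  have "(C * E + b * B)-lipschitz_on {0..T} \<Psi>"
  proof (rule lipschitz_onI)
    show "0 \<le> C * E + b * B"
      using C_pos b_pos lipschitz_on_nonneg[OF E] lipschitz_on_nonneg[OF pv] by simp
    fix s t assume st: "s \<in> {0..T}" "t \<in> {0..T}"
    have "\<Psi> s - \<Psi> t = C * (1 / m s * norm (pv s) - 1 / m t * norm (pv t)) - b * (pm s - pm t)"
      by (simp add: switching_def algebra_simps)
    then have "\<bar>\<Psi> s - \<Psi> t\<bar> \<le> C * \<bar>1 / m s * norm (pv s) - 1 / m t * norm (pv t)\<bar> + b * \<bar>pm s - pm t\<bar>"
      using C_pos b_pos by (metis abs_mult abs_of_pos abs_triangle_ineq4)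
    also have "\<dots> \<le> C * (E * dist s t) + b * (B * dist s t)"
      using lipschitz_onD[OF E st] lipschitz_onD[OF pm st] C_pos b_pos unfolding dist_real_def
      by (intro add_mono mult_left_mono) auto
    finally show "dist (\<Psi> s) (\<Psi> t) \<le> (C * E + b * B) * dist s t" by (simp add: dist_real_def algebra_simps)
  qed
  then show ?thesis by (rule that)
qed

text \<open>The almost everywhere derivative \<open>\<Xi>\<close> of the switching function is continuous where
  \<open>p\<^sub>v \<noteq> 0\<close>, so it is the derivative everywhere there.\<close>

lemma switching_continuously_differentiable:
  assumes t0: "t0 \<in> {0<..<T}" and pv0: "pv t0 \<noteq> 0"
  obtains \<delta> where "0 < \<delta>"
    "\<And>s. s \<in> ball t0 \<delta> \<Longrightarrow> (\<Psi> has_real_derivative Xi D b C (z s)) (at s)"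
proof -
  obtain A where A: "A-lipschitz_on {0..T} (\<lambda>t. (r t, v t, m t))" by (rule x_lipschitz)
  obtain B where B: "B-lipschitz_on {0..T} (\<lambda>t. (pr t, pv t, pm t))" by (rule costate_lipschitz[OF p_costate])
  have cont: "continuous_on {0..T} r" "continuous_on {0..T} v" "continuous_on {0..T} m" "continuous_on {0..T} pr" "continuous_on {0..T} pv"
    using lipschitz_on_triple[OF A] lipschitz_on_triple[OF B] by (auto intro: lipschitz_on_continuous_on)
  have "open {s \<in> {0<..<T}. pv s \<in> - {0}}"
  proof -
    have "continuous_on {0<..<T} pv" using continuous_on_subset[OF cont(5)] by (meson greaterThanLessThan_subseteq_atLeastAtMost_iff order_refl)
    from continuous_open_preimage[OF this _ open_Compl[OF closed_singleton[of 0]]]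
    have "open ({0<..<T} \<inter> pv -` (- {0}))" by simp
    then show ?thesis by (simp add: vimage_def Int_def)
  qed
  then obtain e where e: "0 < e" "cball t0 e \<subseteq> {s \<in> {0<..<T}. pv s \<in> - {0}}"
    using t0 pv0 unfolding open_contains_cball by blast
  define c d where "c = t0 - e" and "d = t0 + e"
  have cd: "{c..d} \<subseteq> {0..T}" "\<And>s. s \<in> {c..d} \<Longrightarrow> pv s \<noteq> 0" "c < d"
  proof -
    have "{c..d} = cball t0 e" by (auto simp: c_def d_def dist_real_def)
    then have "{c..d} \<subseteq> {s \<in> {0<..<T}. pv s \<in> - {0}}" using e(2) by simp
    then show "{c..d} \<subseteq> {0..T}" "\<And>s. s \<in> {c..d} \<Longrightarrow> pv s \<noteq> 0" by (force, blast)
    show "c < d" using e(1) by (simp add: c_def d_def)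
  qed
  have contXi: "continuous_on {c..d} (\<lambda>s. Xi D b C (z s))"
  proof (intro Xi_cont continuous_on_subset[OF _ cd(1)] cont)
    fix s assume s: "s \<in> {c..d}"
    show "r s \<in> Q" "v s \<noteq> 0" "m s \<noteq> 0" using state_at[OF subsetD[OF cd(1) s]] by auto
    show "pv s \<noteq> 0" by (rule cd(2)[OF s])
  qed
  obtain E where E: "E-lipschitz_on {0..T} \<Psi>" by (rule switching_lipschitz)
  obtain N where N: "negligible N" "\<And>t. t \<in> {0..T} - N \<Longrightarrow> good t" using good_AE by blast
  have int: "\<Psi> s = \<Psi> c + integral {c..s} (\<lambda>s. Xi D b C (z s))" if s: "s \<in> {c..d}" for s
  proof -
    have sub: "{c..s} \<subseteq> {0..T}" using s cd(1) by auto
    have ac: "abs_continuous_on \<Psi> {c..s}"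
      by (rule lipschitz_on_imp_abs_continuous_on[OF lipschitz_on_subset[OF E sub]])
    have "((\<lambda>s. Xi D b C (z s)) has_integral (\<Psi> s - \<Psi> c)) {c..s}"
    proof (rule abs_continuous_on_imp_has_integral[OF ac _ N(1)])
      fix t assume "t \<in> {c..s} - N"
      then have "good t" using sub N(2) by blast
      from good_switching_derivative[OF this]
      show "(\<Psi> has_vector_derivative Xi D b C (z t)) (at t within {c..s})"
        by (simp only: has_real_derivative_iff_has_vector_derivative has_vector_derivative_at_within)
    qed (use s in auto)
    then show ?thesis by (simp add: integral_unique)
  qed
  show ?thesis
  proof (rule that[OF e(1)])
    fix s assume "s \<in> ball t0 e"
    then have s: "s \<in> {c<..<d}" by (auto simp: c_def d_def dist_real_def)
    have "((\<lambda>s. integral {c..s} (\<lambda>s. Xi D b C (z s))) has_vector_derivative Xi D b C (z s)) (at s within {c..d})"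
      using integral_has_vector_derivative[OF contXi] s by auto
    then have "((\<lambda>s. integral {c..s} (\<lambda>s. Xi D b C (z s))) has_real_derivative Xi D b C (z s)) (at s)"
      using s at_within_interior[of s "{c..d}"] by (auto simp: has_real_derivative_iff_has_vector_derivative)
    then have "((\<lambda>s. \<Psi> c + integral {c..s} (\<lambda>s. Xi D b C (z s))) has_real_derivative Xi D b C (z s)) (at s)"
      by (auto intro!: derivative_eq_intros)
    then show "(\<Psi> has_real_derivative Xi D b C (z s)) (at s)"
      by (rule has_field_derivative_transform_within_open[OF _ open_greaterThanLessThan s]) (rule int[symmetric], simp)
  qed
qed

text \<open>Near \<open>t\<close> the function \<open>deriv \<Psi>\<close> equals \<open>Xi\<close>
  along the extremal everywhere, not just almost everywhere, so it may be differentiated at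
  \<open>t\<close> by the chain rule. Affinity of the right-hand side in the multiplier, here |u|,
  gives the stated form.\<close>

lemma good_second_derivative:
  assumes t: "good t" and G: "(\<lambda>(y, w). gradient (D y) w) differentiable (at (r t, v t))"
  shows "(deriv \<Psi> has_real_derivative sing_A D g b C (z t) * norm (u t) - sing_B D g b C (z t)) (at t)"
proof -
  have t': "t \<in> {0<..<T}" "t \<in> {0..T}" "pv t \<noteq> 0" using t by (auto simp: good_def)
  obtain \<delta> where \<delta>: "0 < \<delta>" "\<And>s. s \<in> ball t \<delta> \<Longrightarrow> (\<Psi> has_real_derivative Xi D b C (z s)) (at s)"
    by (rule switching_continuously_differentiable[OF t'(1,3)]) (rule that)
  define F where "F = frechet_derivative (Xi D b C) (at (z t))"
  have dXi: "(Xi D b C has_derivative F) (at (z t))"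
    unfolding F_def using state_at[OF t'(2)] t'(3) G
    by (intro frechet_derivative_works[THEN iffD1] Xi_differentiable) auto
  have "(z has_vector_derivative extremal_rhs D g b C (z t) (u t)) (at t)"
    using t unfolding good_def by (auto simp: extremal_rhs_def adjoint_rhs_def intro!: has_vector_derivative_Pair)
  then have dz: "(z has_derivative (\<lambda>h. h *\<^sub>R extremal_rhs D g b C (z t) (u t))) (at t)"
    by (simp add: has_vector_derivative_def)
  have lin: "linear F" using dXi has_derivative_linear by blast
  have "((\<lambda>s. Xi D b C (z s)) has_derivative (\<lambda>h. F (h *\<^sub>R extremal_rhs D g b C (z t) (u t)))) (at t)"
    by (rule has_derivative_compose[OF dz dXi])
  then have "((\<lambda>s. Xi D b C (z s)) has_real_derivative F (extremal_rhs D g b C (z t) (u t))) (at t)"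
    by (simp add: has_field_derivative_def linear_scale[OF lin] mult_commute_abs)
  moreover have "u t = norm (u t) *\<^sub>R thrust_dir (z t)" using good_control(1)[OF t] by simp
  then have "F (extremal_rhs D g b C (z t) (u t)) = F (extremal_rhs D g b C (z t) (norm (u t) *\<^sub>R thrust_dir (z t)))" by simp
  then have "F (extremal_rhs D g b C (z t) (u t)) = sing_A D g b C (z t) * norm (u t) - sing_B D g b C (z t)"
    unfolding extremal_rhs_affine[OF norm_ge_zero] sing_A_def sing_B_def F_def[symmetric]
    by (simp add: linear_add[OF lin] linear_scale[OF lin] mult.commute)
  ultimately have "((\<lambda>s. Xi D b C (z s)) has_real_derivative sing_A D g b C (z t) * norm (u t) - sing_B D g b C (z t)) (at t)" by simp
  then show ?thesis
  proof (rule has_field_derivative_transform_within_open[OF _ open_ball, of _ _ _ t \<delta>])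
    show "Xi D b C (z s) = deriv \<Psi> s" if "s \<in> ball t \<delta>" for s
      by (rule DERIV_imp_deriv[OF \<delta>(2)[OF that], symmetric])
  qed (use \<delta>(1) in simp)
qed

text \<open>The limit point argument is applied twice: to \<Psi> on \<open>I\<close>, then to its
  derivative on the subset \<open>J\<close> where \<open>Xi\<close> is known to vanish. The isolated
  points of \<open>J\<close> have to be discarded anew.\<close>

lemma singular_arc:
  assumes I: "I \<subseteq> {0..T}" and \<Psi>0: "\<And>t. t \<in> I \<Longrightarrow> \<Psi> t = 0"
  shows "\<exists>N. negligible N \<and> (\<forall>t\<in>I - N. good t \<and> Xi D b C (z t) = 0 \<and>
    ((\<lambda>(y, w). gradient (D y) w) differentiable (at (r t, v t)) \<longrightarrow>
       sing_A D g b C (z t) * norm (u t) = sing_B D g b C (z t)))"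
proof -
  obtain N0 where N0: "negligible N0" "\<And>t. t \<in> {0..T} - N0 \<Longrightarrow> good t" using good_AE by blast
  define N1 where "N1 = N0 \<union> {t \<in> I. \<not> t islimpt I}"
  define J where "J = I - N1"
  define N where "N = N1 \<union> {t \<in> J. \<not> t islimpt J}"
  have "negligible N" unfolding N_def N1_def using N0(1) negligible_isolated_points by (intro negligible_Un)
  have J: "good t" "(\<Psi> has_real_derivative Xi D b C (z t)) (at t)" "Xi D b C (z t) = 0" if t: "t \<in> J" for t
  proof -
    have tI: "t \<in> I" "t islimpt I" "t \<in> {0..T} - N0" using t I by (auto simp: J_def N1_def)
    show g: "good t" by (rule N0(2)[OF tI(3)])
    show d: "(\<Psi> has_real_derivative Xi D b C (z t)) (at t)" by (rule good_switching_derivative[OF g])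
    show "Xi D b C (z t) = 0"
      by (rule derivative_zero_at_limit_of_zeros[OF d[unfolded has_real_derivative_iff_has_vector_derivative] tI(2,1) \<Psi>0])
  qed
  have "sing_A D g b C (z t) * norm (u t) = sing_B D g b C (z t)"
    if t: "t \<in> I - N" and G: "(\<lambda>(y, w). gradient (D y) w) differentiable (at (r t, v t))" for t
  proof -
    have tJ: "t \<in> J" "t islimpt J" using t by (auto simp: N_def J_def)
    have "deriv \<Psi> s = 0" if "s \<in> J" for s using J(2,3)[OF that] by (simp add: DERIV_imp_deriv)
    from derivative_zero_at_limit_of_zeros[OF good_second_derivative[OF J(1)[OF tJ(1)] G, unfolded has_real_derivative_iff_has_vector_derivative] tJ(2,1) this]
    show ?thesis by simp
  qed
  then show ?thesis
    using \<open>negligible N\<close> J by (intro exI[of _ N]) (auto simp: N_def J_def)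
qed

end

subsection \<open>Degenerate extremals and the theorem\<close>

lemma hamiltonian_mass_only: "hamiltonian D g b C y (0, 0, c) w = - (c * b * norm w)"
  by (cases y) simp

lemma gradient_const: "gradient (\<lambda>_. c) (x :: 'a::euclidean_space) = 0"
  by (rule gradient_eqI) (simp add: gderiv_def)

text \<open>For the costate (0, 0, - c) the Hamiltonian is c b |w|, maximal at full thrust with the
  constant value c b. With \<open>p0 = - 1\<close> the final-time condition and transversality
  become the assumed equations for the derivatives of the cost.\<close>

lemma degenerate_pmp_extremal:
  assumes "0 < b" "0 < c" and thrust: "AE t in lebesgue_on {0..T}. norm (u t) = 1"
    and time: "free_time \<Longrightarrow> deriv (\<lambda>s. g0 s (x T)) T = b * c"
    and tangent: "\<And>w. w \<in> tangent_space M\<^sub>1 (x T) \<Longrightarrow> gradient (g0 T) (x T) \<bullet> w = c * snd (snd w)"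
    and mass: "free_final_mass M\<^sub>1 \<Longrightarrow> snd (snd (gradient (g0 T) (x T))) = c"
  shows "pmp_extremal D g b C M\<^sub>1 free_time g0 T u x (\<lambda>t. (0, 0, - c)) (- 1)"
proof -
  have sup: "(SUP w\<in>cball 0 1. hamiltonian D g b C y (0, 0, - c) w) = c * b" for y
  proof (rule cSup_eq_maximum)
    obtain e :: vec3 where "norm e = 1" using vector_choose_size[of 1] by auto
    then show "c * b \<in> hamiltonian D g b C y (0, 0, - c) ` cball 0 1"
      by (intro image_eqI[of _ _ e]) (simp_all add: hamiltonian_mass_only)
    fix h assume "h \<in> hamiltonian D g b C y (0, 0, - c) ` cball 0 1"
    then show "h \<le> c * b" using assms(1,2) by (auto simp: hamiltonian_mass_only mult_left_le)
  qed
  have "0-lipschitz_on {0..T} (\<lambda>t. (0, 0, - c) :: state)" by (rule lipschitz_onI) auto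
  then have ac: "abs_continuous_on (\<lambda>t. (0, 0, - c) :: state) {0..T}"
    by (rule lipschitz_on_imp_abs_continuous_on)
  have grad: "gradient (\<lambda>y. hamiltonian D g b C y (0, 0, - c) w) y = 0" for y w
    unfolding hamiltonian_mass_only by (rule gradient_const)
  have max: "AE t in lebesgue_on {0..T}. \<forall>w\<in>cball 0 1.
      hamiltonian D g b C (x t) (0, 0, - c) w \<le> hamiltonian D g b C (x t) (0, 0, - c) (u t)"
    using thrust by (rule AE_mp) (use assms(1,2) in \<open>auto simp: hamiltonian_mass_only mult_left_le intro!: AE_I2\<close>)
  have tan: "((0, 0, - c) - (- 1) *\<^sub>R gradient (g0 T) (x T)) \<bullet> w = 0" if "w \<in> tangent_space M\<^sub>1 (x T)" for w
    using tangent[OF that] by (cases w) (simp add: inner_add_left)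
  show ?thesis
    unfolding pmp_extremal_def grad sup
    using ac max tan time mass by (auto simp: mult.commute)
qed

section \<open>Degenerate costates and the directions they block\<close>

context rocket_trajectory
begin

text \<open>The Hamiltonian reduces to - c b |w|, so the sign of \<open>c\<close> decides between
  zero and full thrust.\<close>

lemma degenerate_costate_maximum:
  assumes p: "costate p" and N: "negligible N"
    and max: "\<And>t w. t \<in> {0..T} - N \<Longrightarrow> w \<in> cball 0 1 \<Longrightarrow>
      p t \<bullet> dynamics D g b C (r t, v t, m t) w \<le> p t \<bullet> dynamics D g b C (r t, v t, m t) (u t)"
    and deg: "\<And>t. t \<in> {0..T} \<Longrightarrow> fst (p t) = 0 \<and> fst (snd (p t)) = 0"
  obtains c where "\<And>t. t \<in> {0..T} \<Longrightarrow> p t = (0, 0, c)"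
    "c > 0 \<Longrightarrow> \<forall>t\<in>{0..T} - N. u t = 0" "c < 0 \<Longrightarrow> \<forall>t\<in>{0..T} - N. norm (u t) = 1"
proof -
  define c where "c = snd (snd (p 0))"
  have "p 0 = (0, 0, c)" using deg[of 0] T_pos by (cases "p 0") (auto simp: c_def)
  then have pc: "p t = (0, 0, c)" if "t \<in> {0..T}" for t
    using costate_mass_only[OF p, of 0 c t] T_pos that by auto
  have le: "- (c * b * norm w) \<le> - (c * b * norm (u t))" if "t \<in> {0..T} - N" "norm w \<le> 1" for t and w :: vec3
    using max[of t w] that by (simp add: hamiltonian_eq hamiltonian_mass_only pc)
  show ?thesis
  proof (rule that[OF pc])
    show "\<forall>t\<in>{0..T} - N. u t = 0" if c: "c > 0"
    proof
      fix t assume "t \<in> {0..T} - N"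
      from le[OF this, of 0] have "(c * b) * norm (u t) \<le> (c * b) * 0" by simp
      moreover have "0 < c * b" using c b_pos by simp
      ultimately have "norm (u t) \<le> 0" by (simp only: mult_le_cancel_left_pos)
      then show "u t = 0" by simp
    qed
    show "\<forall>t\<in>{0..T} - N. norm (u t) = 1" if c: "c < 0"
    proof
      fix t assume t: "t \<in> {0..T} - N"
      obtain e :: vec3 where "norm e = 1" using vector_choose_size[of 1] by auto
      with le[OF t, of e] have "(- c * b) * 1 \<le> (- c * b) * norm (u t)" by simp
      moreover have "0 < - c * b" using c b_pos by (simp add: mult_neg_pos)
      ultimately have "1 \<le> norm (u t)" by (simp only: mult_le_cancel_left_pos)
      then show "norm (u t) = 1" using u_W[of t] t by auto
    qed
  qed
qed

text \<open>When all costates with the maximum condition are degenerate, the only possible normals of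
  separating hyperplanes in time and state are the positive multiples of \<open>(- b, 0, 0, - 1)\<close>.\<close>

lemma reachable_unless_full_thrust:
  assumes nz: "\<not> (\<exists>N. negligible N \<and> (\<forall>t\<in>{0..T} - N. u t = 0))"
    and deg: "\<And>p t. costate p \<Longrightarrow> \<exists>N. negligible N \<and> (\<forall>t\<in>{0..T} - N. \<forall>w\<in>cball 0 1.
        p t \<bullet> dynamics D g b C (r t, v t, m t) w \<le> p t \<bullet> dynamics D g b C (r t, v t, m t) (u t)) \<Longrightarrow>
        t \<in> {0..T} \<Longrightarrow> fst (p t) = 0 \<and> fst (snd (p t)) = 0"
    and \<xi>: "(\<xi> has_vector_derivative d) (at 0 within {0..})" "\<xi> 0 = (r T, v T, m T)"
  shows "(\<exists>s0>0. \<forall>s. 0 < s \<and> s < s0 \<longrightarrow> reachable (T + s * \<tau>) (\<xi> s)) \<or>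
    snd (snd d) + b * \<tau> \<le> 0 \<and> (\<exists>N. negligible N \<and> (\<forall>t\<in>{0..T} - N. norm (u t) = 1))"
  using reachability_alternative[OF \<xi>, of \<tau>]
proof
  assume "\<exists>q0 p. costate p \<and> (q0 \<noteq> 0 \<or> p 0 \<noteq> 0) \<and>
      (\<exists>N. negligible N \<and> (\<forall>t\<in>{0..T} - N. \<forall>w\<in>cball 0 1.
        p t \<bullet> dynamics D g b C (r t, v t, m t) w \<le> p t \<bullet> dynamics D g b C (r t, v t, m t) (u t))) \<and>
      q0 * T + integral {0..T} (\<lambda>t. p t \<bullet> dynamics D g b C (r t, v t, m t) (u t)) = 0 \<and> 0 \<le> q0 * \<tau> + p T \<bullet> d"
  then obtain q0 p N where p: "costate p" "q0 \<noteq> 0 \<or> p 0 \<noteq> 0" and N: "negligible N"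
    and max: "\<forall>t\<in>{0..T} - N. \<forall>w\<in>cball 0 1.
        p t \<bullet> dynamics D g b C (r t, v t, m t) w \<le> p t \<bullet> dynamics D g b C (r t, v t, m t) (u t)"
    and int: "q0 * T + integral {0..T} (\<lambda>t. p t \<bullet> dynamics D g b C (r t, v t, m t) (u t)) = 0"
    and pd: "0 \<le> q0 * \<tau> + p T \<bullet> d"
    by (elim exE conjE) (rule that)
  have dg: "fst (p t) = 0 \<and> fst (snd (p t)) = 0" if "t \<in> {0..T}" for t
    using deg[OF p(1) _ that] N max by blast
  obtain c where c: "\<And>t. t \<in> {0..T} \<Longrightarrow> p t = (0, 0, c)"
    "c > 0 \<Longrightarrow> \<forall>t\<in>{0..T} - N. u t = 0" "c < 0 \<Longrightarrow> \<forall>t\<in>{0..T} - N. norm (u t) = 1"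
    by (rule degenerate_costate_maximum[OF p(1) N _ dg]) (use max that in auto)
  \<comment> \<open>c > 0 would mean zero thrust, and c = 0 would make p and then q0 vanish; only c
    < 0 is left.\<close>
  have "\<not> c > 0" using nz N c(2) by blast
  moreover have "c \<noteq> 0"
  proof
    assume "c = 0"
    then have p0: "p t = 0" if "t \<in> {0..T}" for t using c(1)[OF that] by (simp add: zero_prod_def)
    have "integral {0..T} (\<lambda>t. p t \<bullet> dynamics D g b C (r t, v t, m t) (u t)) = integral {0..T} (\<lambda>t. 0)"
      by (rule Henstock_Kurzweil_Integration.integral_cong) (simp add: p0)
    then show False using int T_pos p(2) p0[of 0] by simp
  qed
  ultimately have neg: "c < 0" by simp
  have "integral {0..T} (\<lambda>t. p t \<bullet> dynamics D g b C (r t, v t, m t) (u t)) = integral {0..T} (\<lambda>t. - (c * b))"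
    by (rule Henstock_Kurzweil_Integration.integral_spike[OF N])
      (use c(1) c(3)[OF neg] in \<open>simp add: hamiltonian_eq hamiltonian_mass_only\<close>)
  also have "\<dots> = - (c * b) * T" using T_pos by simp
  finally have "(q0 - c * b) * T = 0" using int by (simp add: algebra_simps)
  then have "q0 = c * b" using T_pos by simp
  moreover have "p T \<bullet> d = c * snd (snd d)" using c(1)[of T] T_pos by (cases d) (simp add: inner_Pair)
  ultimately have "0 \<le> c * (snd (snd d) + b * \<tau>)" using pd by (simp add: algebra_simps)
  then have "snd (snd d) + b * \<tau> \<le> 0" using neg by (simp add: zero_le_mult_iff)
  then show ?thesis using N c(3)[OF neg] by blast
qed blast

end

lemma right_derivative_of_minimum:
  fixes \<phi> :: "real \<Rightarrow> real"
  assumes d: "(\<phi> has_real_derivative l) (at 0 within {0..})" and "0 < s0"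
    and min: "\<And>s. 0 < s \<Longrightarrow> s < s0 \<Longrightarrow> \<phi> 0 \<le> \<phi> s"
  shows "0 \<le> l"
proof (rule ccontr)
  assume "\<not> 0 \<le> l"
  then obtain e where e: "0 < e" "\<And>h. 0 < h \<Longrightarrow> 0 + h \<in> {0..} \<Longrightarrow> h < e \<Longrightarrow> \<phi> (0 + h) < \<phi> 0"
    using has_real_derivative_neg_dec_right[OF d] by (metis not_le)
  have "\<phi> 0 \<le> \<phi> (min e s0 / 2)" using e(1) \<open>0 < s0\<close> by (intro min) auto
  moreover have "\<phi> (min e s0 / 2) < \<phi> 0" using e(2)[of "min e s0 / 2"] e(1) \<open>0 < s0\<close> by auto
  ultimately show False by simp
qed

theorem theorem1:
  fixes D :: "vec3 \<Rightarrow> vec3 \<Rightarrow> real" and g :: "vec3 \<Rightarrow> vec3" and b C :: real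
    and Q :: "vec3 set" and M\<^sub>1 :: "state set" and g0 :: "real \<Rightarrow> state \<Rightarrow> real"
    and free_time :: bool
    and r\<^sub>0 v\<^sub>0 :: vec3 and m\<^sub>0 t\<^sub>f :: real
    and u r v :: "real \<Rightarrow> vec3" and m :: "real \<Rightarrow> real"
  assumes "open Q" and "0 < b" and "0 < C"
    and "C1_on (\<lambda>(y, w). D y w) (Q \<times> - {0})"
    and "\<And>y w. y \<in> Q \<Longrightarrow> w \<noteq> 0 \<Longrightarrow> 0 < D y w"
    and "C1_on g Q"
    and "C1_on (\<lambda>(t, y). g0 t y) (UNIV \<times> state_space Q)"
    and "optimal D g b C Q (r\<^sub>0, v\<^sub>0, m\<^sub>0) M\<^sub>1 free_time g0 t\<^sub>f u (\<lambda>t. (r t, v t, m t))"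
    and "(free_final_mass M\<^sub>1 \<and> deriv (\<lambda>\<mu>. g0 t\<^sub>f (r t\<^sub>f, v t\<^sub>f, \<mu>)) (m t\<^sub>f) \<noteq> 0)
       \<or> (free_time \<and> deriv (\<lambda>s. g0 s (r t\<^sub>f, v t\<^sub>f, m t\<^sub>f)) t\<^sub>f \<noteq> 0)"
    and nondegenerate: "\<And>q\<^sub>r q\<^sub>v q\<^sub>m q0.
         pmp_extremal D g b C M\<^sub>1 free_time g0 t\<^sub>f u
           (\<lambda>t. (r t, v t, m t)) (\<lambda>t. (q\<^sub>r t, q\<^sub>v t, q\<^sub>m t)) q0
         \<Longrightarrow> \<not> (\<forall>t\<in>{0..t\<^sub>f}. q\<^sub>r t = 0 \<and> q\<^sub>v t = 0)"
  shows "\<exists>(p\<^sub>r :: real \<Rightarrow> vec3) (p\<^sub>v :: real \<Rightarrow> vec3) (p\<^sub>m :: real \<Rightarrow> real) (p0 :: real).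
     abs_continuous_on p\<^sub>r {0..t\<^sub>f} \<and> abs_continuous_on p\<^sub>v {0..t\<^sub>f} \<and> abs_continuous_on p\<^sub>m {0..t\<^sub>f} \<and>
     p0 \<le> 0 \<and> \<not> ((\<forall>t\<in>{0..t\<^sub>f}. p\<^sub>r t = 0 \<and> p\<^sub>v t = 0 \<and> p\<^sub>m t = 0) \<and> p0 = 0) \<and>
     (AE t in lebesgue_on {0..t\<^sub>f}.
        (p\<^sub>r has_vector_derivative
           adjoint_r D g (r t, v t, m t) (p\<^sub>r t, p\<^sub>v t, p\<^sub>m t)) (at t) \<and>
        (p\<^sub>v has_vector_derivative
           adjoint_v D (r t, v t, m t) (p\<^sub>r t, p\<^sub>v t, p\<^sub>m t)) (at t) \<and>
        (p\<^sub>m has_real_derivative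
           adjoint_m D C (r t, v t, m t) (p\<^sub>r t, p\<^sub>v t, p\<^sub>m t) (u t)) (at t)) \<and>
     (let \<Psi> = switching b C m p\<^sub>v p\<^sub>m;
          z = (\<lambda>t. ((r t, v t, m t), (p\<^sub>r t, p\<^sub>v t, p\<^sub>m t)))
      in
       (AE t in lebesgue_on {0..t\<^sub>f}. \<Psi> t < 0 \<longrightarrow> u t = 0) \<and>
       (AE t in lebesgue_on {0..t\<^sub>f}. \<Psi> t > 0 \<longrightarrow> p\<^sub>v t \<noteq> 0 \<and> u t = p\<^sub>v t /\<^sub>R norm (p\<^sub>v t)) \<and>
       (\<forall>I. I \<in> sets lebesgue \<and> I \<subseteq> {0..t\<^sub>f} \<and> emeasure lebesgue I > 0 \<and> (\<forall>t\<in>I. \<Psi> t = 0) \<longrightarrow>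
          (AE t in lebesgue_on I. (\<Psi> has_real_derivative Xi D b C (z t)) (at t) \<and> Xi D b C (z t) = 0) \<and>
          (\<exists>\<alpha> :: real \<Rightarrow> real.
             (AE t in lebesgue_on I.
                \<alpha> t \<in> {0..1} \<and> p\<^sub>v t \<noteq> 0 \<and> u t = \<alpha> t *\<^sub>R (p\<^sub>v t /\<^sub>R norm (p\<^sub>v t))) \<and>
             (AE t in lebesgue_on I.
                (\<lambda>(y, w). gradient (D y) w) differentiable (at (r t, v t)) \<longrightarrow>
                (deriv \<Psi> has_real_derivative sing_A D g b C (z t) * \<alpha> t - sing_B D g b C (z t)) (at t) \<and>
                sing_A D g b C (z t) * \<alpha> t = sing_B D g b C (z t)))))"
proof -
  let ?x = "\<lambda>t. (r t, v t, m t)"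
  let ?T = "t\<^sub>f"
  interpret R: rocket D g b C Q
    using assms(1-4,6) by unfold_locales
  have adm: "admissible D g b C Q (r\<^sub>0, v\<^sub>0, m\<^sub>0) M\<^sub>1 ?T u ?x"
    and opt: "\<And>T' u' x'. admissible D g b C Q (r\<^sub>0, v\<^sub>0, m\<^sub>0) M\<^sub>1 T' u' x' \<Longrightarrow> free_time \<or> T' = ?T \<Longrightarrow> g0 ?T (?x ?T) \<le> g0 T' (x' T')"
    using assms(8) unfolding optimal_def by blast+
  interpret RT: rocket_trajectory D g b C Q ?T u r v m
    by (rule R.rocket_trajectoryI[OF adm])
  have T: "0 < ?T" by (rule RT.T_pos)
  show ?thesis
  proof (cases "\<exists>N. negligible N \<and> (\<forall>t\<in>{0..?T} - N. u t = 0)")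
    case True
    then have u0: "AE t in lebesgue_on {0..?T}. u t = 0" by (simp add: AE_lebesgue_on_iff_negligible)
    have "0-lipschitz_on {0..?T} (\<lambda>t. 0 :: vec3)" "0-lipschitz_on {0..?T} (\<lambda>t. 1 :: real)"
      by (auto intro!: lipschitz_onI)
    then have ac: "abs_continuous_on (\<lambda>t. 0 :: vec3) {0..?T}" "abs_continuous_on (\<lambda>t. 1 :: real) {0..?T}"
      by (auto intro: lipschitz_on_imp_abs_continuous_on)
    have adj: "AE t in lebesgue_on {0..?T}.
        ((\<lambda>t. 0 :: vec3) has_vector_derivative adjoint_r D g (r t, v t, m t) (0, 0, 1)) (at t) \<and>
        ((\<lambda>t. 0 :: vec3) has_vector_derivative adjoint_v D (r t, v t, m t) (0, 0, 1)) (at t) \<and>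
        ((\<lambda>t. 1 :: real) has_real_derivative adjoint_m D C (r t, v t, m t) (0, 0, 1) (u t)) (at t)"
      by (simp add: gradient_const)
    \<comment> \<open>\<Psi> is the constant - b, so the claims about \<Psi> > 0 and about \<Psi> =
      0 on a set of positive measure are vacuous.\<close>
    have neg: "switching b C m (\<lambda>t. 0) (\<lambda>t. 1) t < 0" for t using \<open>0 < b\<close> by (simp add: switching_def)
    have empty: "I = {}" if "\<forall>t\<in>I. switching b C m (\<lambda>t. 0) (\<lambda>t. 1) t = 0" for I
      using that neg by (metis (mono_tags) all_not_in_conv less_irrefl)
    have contr: False if "I \<in> sets lebesgue \<and> I \<subseteq> {0..?T} \<and> 0 < emeasure lebesgue I \<and>
        (\<forall>t\<in>I. switching b C m (\<lambda>t. 0) (\<lambda>t. 1) t = 0)" for I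
    proof -
      have "I = {}" using that by (intro empty) blast
      then show False using that by simp
    qed
    show ?thesis
      unfolding Let_def
    proof (rule exI[of _ "\<lambda>t. 0"], rule exI[of _ "\<lambda>t. 0"], rule exI[of _ "\<lambda>t. 1"], rule exI[of _ 0],
        intro conjI allI impI ac adj)
      show "\<not> ((\<forall>t\<in>{0..?T}. (0::vec3) = 0 \<and> (0::vec3) = 0 \<and> (1::real) = 0) \<and> (0::real) = 0)"
        using T by (auto intro!: bexI[of _ 0])
      show "AE t in lebesgue_on {0..?T}. switching b C m (\<lambda>t. 0) (\<lambda>t. 1) t < 0 \<longrightarrow> u t = 0"
        using u0 by (rule AE_mp) simp
      show "AE t in lebesgue_on {0..?T}. 0 < switching b C m (\<lambda>t. 0) (\<lambda>t. 1) t \<longrightarrow>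
          (0::vec3) \<noteq> 0 \<and> u t = 0 /\<^sub>R norm (0::vec3)"
        using neg by (simp add: not_less[THEN iffD2] less_imp_le)
    qed (erule contr[THEN FalseE] | simp)+
  next
    case nz: False
    show ?thesis
    proof (cases "\<exists>p. RT.costate p \<and> (\<exists>N. negligible N \<and> (\<forall>t\<in>{0..?T} - N. \<forall>w\<in>cball 0 1.
        p t \<bullet> dynamics D g b C (?x t) w \<le> p t \<bullet> dynamics D g b C (?x t) (u t))) \<and>
        \<not> (\<forall>t\<in>{0..?T}. fst (p t) = 0 \<and> fst (snd (p t)) = 0)")
      case True
      obtain p where p: "RT.costate p" "\<exists>N. negligible N \<and> (\<forall>t\<in>{0..?T} - N. \<forall>w\<in>cball 0 1.
        p t \<bullet> dynamics D g b C (?x t) w \<le> p t \<bullet> dynamics D g b C (?x t) (u t))"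
        "\<not> (\<forall>t\<in>{0..?T}. fst (p t) = 0 \<and> fst (snd (p t)) = 0)" by (rule exE[OF True], elim conjE) (rule that)
      define pr pv pm where "pr t = fst (p t)" and "pv t = fst (snd (p t))" and "pm t = snd (snd (p t))" for t
      have p_eq: "p = (\<lambda>t. (pr t, pv t, pm t))" by (simp add: pr_def pv_def pm_def)
      interpret E: rocket_extremal D g b C Q ?T u r v m pr pv pm
        using p unfolding p_eq by unfold_locales simp_all
      obtain B where B: "B-lipschitz_on {0..?T} (\<lambda>t. (pr t, pv t, pm t))" by (rule RT.costate_lipschitz[OF E.p_costate])
      have ac: "abs_continuous_on pr {0..?T}" "abs_continuous_on pv {0..?T}" "abs_continuous_on pm {0..?T}"
        using lipschitz_on_triple[OF B] by (auto intro: lipschitz_on_imp_abs_continuous_on)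
      have good: "AE t in lebesgue_on {0..?T}. E.good t"
        using E.good_AE by (simp add: AE_lebesgue_on_iff_negligible)
      show ?thesis
        unfolding Let_def
      proof (rule exI[of _ pr], rule exI[of _ pv], rule exI[of _ pm], rule exI[of _ 0], intro conjI allI impI ac)
        show "\<not> ((\<forall>t\<in>{0..?T}. pr t = 0 \<and> pv t = 0 \<and> pm t = 0) \<and> (0::real) = 0)"
          using E.p_nondegenerate by blast
        show "AE t in lebesgue_on {0..?T}.
            (pr has_vector_derivative adjoint_r D g (r t, v t, m t) (pr t, pv t, pm t)) (at t) \<and>
            (pv has_vector_derivative adjoint_v D (r t, v t, m t) (pr t, pv t, pm t)) (at t) \<and>
            (pm has_real_derivative adjoint_m D C (r t, v t, m t) (pr t, pv t, pm t) (u t)) (at t)"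
          using good by (rule AE_mp) (intro AE_I2 impI conjI E.good_derivatives)
        show "AE t in lebesgue_on {0..?T}. E.\<Psi> t < 0 \<longrightarrow> u t = 0"
          using good by (rule AE_mp) (intro AE_I2 impI E.good_control)
        show "AE t in lebesgue_on {0..?T}. 0 < E.\<Psi> t \<longrightarrow> pv t \<noteq> 0 \<and> u t = pv t /\<^sub>R norm (pv t)"
          using good by (rule AE_mp) (intro AE_I2 impI conjI E.good_control, auto simp: E.good_def)
      next
        fix I assume I: "I \<in> sets lebesgue \<and> I \<subseteq> {0..?T} \<and> emeasure lebesgue I > 0 \<and> (\<forall>t\<in>I. E.\<Psi> t = 0)"
        then have sets: "I \<in> sets lebesgue" by blast
        obtain N where N: "negligible N" "\<And>t. t \<in> I - N \<Longrightarrow> E.good t" "\<And>t. t \<in> I - N \<Longrightarrow> Xi D b C (E.z t) = 0"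
          "\<And>t. t \<in> I - N \<Longrightarrow> (\<lambda>(y, w). gradient (D y) w) differentiable (at (r t, v t)) \<Longrightarrow>
             sing_A D g b C (E.z t) * norm (u t) = sing_B D g b C (E.z t)"
          using E.singular_arc[of I] I by blast
        show "AE t in lebesgue_on I. (E.\<Psi> has_real_derivative Xi D b C (E.z t)) (at t) \<and> Xi D b C (E.z t) = 0"
          unfolding AE_lebesgue_on_iff_negligible[OF sets]
          by (intro exI[of _ N] conjI ballI N E.good_switching_derivative)
        have 1: "AE t in lebesgue_on I. norm (u t) \<in> {0..1} \<and> pv t \<noteq> 0 \<and> u t = norm (u t) *\<^sub>R (pv t /\<^sub>R norm (pv t))"
          unfolding AE_lebesgue_on_iff_negligible[OF sets]
        proof (rule exI[of _ N], intro conjI ballI N(1))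
          fix t assume t: "t \<in> I - N"
          show "norm (u t) \<in> {0..1}" using E.good_control(4)[OF N(2)[OF t]] by simp
          show "pv t \<noteq> 0" using N(2)[OF t] by (simp add: E.good_def)
          show "u t = norm (u t) *\<^sub>R (pv t /\<^sub>R norm (pv t))" by (rule E.good_control(1)[OF N(2)[OF t]])
        qed
        have 2: "AE t in lebesgue_on I. (\<lambda>(y, w). gradient (D y) w) differentiable (at (r t, v t)) \<longrightarrow>
            (deriv E.\<Psi> has_real_derivative sing_A D g b C (E.z t) * norm (u t) - sing_B D g b C (E.z t)) (at t) \<and>
            sing_A D g b C (E.z t) * norm (u t) = sing_B D g b C (E.z t)"
          unfolding AE_lebesgue_on_iff_negligible[OF sets]
          by (rule exI[of _ N], intro conjI ballI impI N(1) E.good_second_derivative[OF N(2)] N(4))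
        show "\<exists>\<alpha>. (AE t in lebesgue_on I. \<alpha> t \<in> {0..1} \<and> pv t \<noteq> 0 \<and> u t = \<alpha> t *\<^sub>R (pv t /\<^sub>R norm (pv t))) \<and>
            (AE t in lebesgue_on I. (\<lambda>(y, w). gradient (D y) w) differentiable (at (r t, v t)) \<longrightarrow>
              (deriv E.\<Psi> has_real_derivative sing_A D g b C (E.z t) * \<alpha> t - sing_B D g b C (E.z t)) (at t) \<and>
              sing_A D g b C (E.z t) * \<alpha> t = sing_B D g b C (E.z t))"
          using 1 2 by (intro exI[of _ "\<lambda>t. norm (u t)"] conjI)
      qed simp
    next
      case False
      then have deg: "fst (p t) = 0 \<and> fst (snd (p t)) = 0"
        if "RT.costate p" "\<exists>N. negligible N \<and> (\<forall>t\<in>{0..?T} - N. \<forall>w\<in>cball 0 1.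
        p t \<bullet> dynamics D g b C (?x t) w \<le> p t \<bullet> dynamics D g b C (?x t) (u t))" "t \<in> {0..?T}" for p t
        using that by blast
      obtain G where G: "((\<lambda>(t, y). g0 t y) has_derivative blinfun_apply G) (at (?T, ?x ?T))"
        using assms(7) RT.x_X[of ?T] T unfolding C1_on_def by fastforce
      define Gt where "Gt = blinfun_apply G (1, 0)"
      define Gx where "Gx = (\<lambda>w. blinfun_apply G (0, w))"
      have linGx: "linear Gx"
      proof (rule linearI)
        show "Gx (y + y') = Gx y + Gx y'" for y y' by (simp add: Gx_def flip: blinfun.add_right)
        show "Gx (k *\<^sub>R y) = k *\<^sub>R Gx y" for k y
          using blinfun.scaleR_right[of G k "(0, y)"] by (simp add: Gx_def)
      qed
      \<comment> \<open>Stated within an arbitrary set \<open>S\<close>: it serves both for ordinary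
        partial derivatives and for one-sided derivatives along curves.\<close>
      have chain: "((\<lambda>s. g0 (\<tau> s) (\<eta> s)) has_derivative (\<lambda>h. Gt * \<tau>' h + Gx (\<eta>' h))) (at a within S)"
        if "(\<tau> has_derivative \<tau>') (at a within S)" "(\<eta> has_derivative \<eta>') (at a within S)" "\<tau> a = ?T" "\<eta> a = ?x ?T"
        for \<tau> :: "'z::real_normed_vector \<Rightarrow> real" and \<eta> \<tau>' \<eta>' a S
      proof -
        have "((\<lambda>(t, y). g0 t y) has_derivative blinfun_apply G) (at ((\<lambda>s. (\<tau> s, \<eta> s)) a))" using G that by simp
        from has_derivative_compose[OF has_derivative_Pair[OF that(1,2)] this]
        have "((\<lambda>s. g0 (\<tau> s) (\<eta> s)) has_derivative (\<lambda>h. blinfun_apply G (\<tau>' h, \<eta>' h))) (at a within S)" by simp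
        moreover have "blinfun_apply G (\<tau>' h, \<eta>' h) = Gt * \<tau>' h + Gx (\<eta>' h)" for h
        proof -
          have "(\<tau>' h, \<eta>' h) = \<tau>' h *\<^sub>R (1, 0) + (0, \<eta>' h)" by simp
          then show ?thesis unfolding Gt_def Gx_def by (simp only: blinfun.add_right blinfun.scaleR_right) simp
        qed
        ultimately show ?thesis by simp
      qed
      have dt: "deriv (\<lambda>s. g0 s (?x ?T)) ?T = Gt"
        using chain[of "\<lambda>s. s" "\<lambda>h. h" ?T UNIV "\<lambda>s. ?x ?T" "\<lambda>h. 0"] linear_0[OF linGx]
        by (intro DERIV_imp_deriv) (simp add: has_field_derivative_def)
      have dm: "deriv (\<lambda>\<mu>. g0 ?T (r ?T, v ?T, \<mu>)) (m ?T) = Gx (0, 0, 1)"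
      proof (rule DERIV_imp_deriv)
        have "((\<lambda>\<mu>. (r ?T, v ?T, \<mu>)) has_derivative (\<lambda>h. (0, 0, h))) (at (m ?T))"
          by (intro has_derivative_Pair has_derivative_const has_derivative_ident)
        then have "((\<lambda>\<mu>. g0 ?T (r ?T, v ?T, \<mu>)) has_derivative (\<lambda>h. Gt * 0 + Gx (0, 0, h))) (at (m ?T))"
          by (rule chain[OF has_derivative_const]) simp_all
        moreover have "(\<lambda>h. Gt * 0 + Gx (0, 0, h)) = (*) (Gx (0, 0, 1))"
        proof
          show "Gt * 0 + Gx (0, 0, h) = Gx (0, 0, 1) * h" for h
            using linear_scale[OF linGx, of h "(0, 0, 1)"] by simp
        qed
        ultimately show "((\<lambda>\<mu>. g0 ?T (r ?T, v ?T, \<mu>)) has_real_derivative Gx (0, 0, 1)) (at (m ?T))"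
          unfolding has_field_derivative_def by (simp only:)
      qed
      have "((\<lambda>y. g0 ?T y) has_derivative (\<lambda>h. Gt * 0 + Gx h)) (at (?x ?T))"
        by (rule chain[OF has_derivative_const has_derivative_ident]) simp_all
      then have grad: "gradient (g0 ?T) (?x ?T) \<bullet> h = Gx h" for h
        using gradient_of_has_derivative(2)[of "g0 ?T" Gx "?x ?T"] by simp
      have x0: "?x 0 = (r\<^sub>0, v\<^sub>0, m\<^sub>0)" using adm by (simp add: admissible_def)
      have xT: "?x ?T \<in> M\<^sub>1" using adm by (simp add: admissible_def)
      let ?full = "\<exists>N. negligible N \<and> (\<forall>t\<in>{0..?T} - N. norm (u t) = 1)"
      \<comment> \<open>If the points of a curve in the target are reachable, they are final points
        of competitors, so the cost has a nonnegative right derivative along the curve. The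
        condition \<open>dir\<close> excludes the other alternative of
        \<open>reachable_unless_full_thrust\<close>.\<close>
      have cost: "0 \<le> Gt * \<tau> + Gx d"
        if \<xi>: "(\<xi> has_vector_derivative d) (at 0 within {0..})" "\<xi> 0 = ?x ?T"
          and s1: "0 < s1" "\<And>s. 0 < s \<Longrightarrow> s < s1 \<Longrightarrow> \<xi> s \<in> M\<^sub>1"
          and \<tau>: "free_time \<or> \<tau> = 0" and dir: "0 < snd (snd d) + b * \<tau> \<or> \<not> ?full" for \<xi> d s1 \<tau>
      proof -
        have "(\<exists>s0>0. \<forall>s. 0 < s \<and> s < s0 \<longrightarrow> RT.reachable (?T + s * \<tau>) (\<xi> s)) \<or>
            snd (snd d) + b * \<tau> \<le> 0 \<and> ?full"
          by (rule RT.reachable_unless_full_thrust[OF nz _ \<xi>]) (rule deg)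
        then have "\<exists>s0>0. \<forall>s. 0 < s \<and> s < s0 \<longrightarrow> RT.reachable (?T + s * \<tau>) (\<xi> s)"
          by (rule disjE) (assumption, use dir in \<open>simp add: not_le[symmetric]\<close>)
        then obtain s0 where s0: "0 < s0" "\<forall>s. 0 < s \<and> s < s0 \<longrightarrow> RT.reachable (?T + s * \<tau>) (\<xi> s)"
          by (elim exE conjE) (rule that)
        have "((\<lambda>s. g0 (?T + s * \<tau>) (\<xi> s)) has_derivative (\<lambda>h. Gt * (h * \<tau>) + Gx (h *\<^sub>R d))) (at 0 within {0..})"
          using \<xi> by (intro chain) (auto intro!: derivative_eq_intros simp: has_vector_derivative_def)
        moreover have "(\<lambda>h. Gt * (h * \<tau>) + Gx (h *\<^sub>R d)) = (*) (Gt * \<tau> + Gx d)"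
          by (rule ext) (simp add: linear_scale[OF linGx] algebra_simps)
        ultimately have d: "((\<lambda>s. g0 (?T + s * \<tau>) (\<xi> s)) has_real_derivative Gt * \<tau> + Gx d) (at 0 within {0..})"
          by (simp only: has_field_derivative_def)
        show ?thesis
        proof (rule right_derivative_of_minimum[OF d, of "min s0 s1"])
          fix s assume s: "0 < s" "s < min s0 s1"
          then have "RT.reachable (?T + s * \<tau>) (\<xi> s)" "\<xi> s \<in> M\<^sub>1" using s0(2) s1(2) by auto
          then obtain u' x' where "admissible D g b C Q (r\<^sub>0, v\<^sub>0, m\<^sub>0) M\<^sub>1 (?T + s * \<tau>) u' x'" "x' (?T + s * \<tau>) = \<xi> s"
            unfolding RT.reachable_def admissible_def x0 by force
          from opt[OF this(1)] this(2) \<tau>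
          show "g0 (?T + 0 * \<tau>) (\<xi> 0) \<le> g0 (?T + s * \<tau>) (\<xi> s)" using \<xi>(2) by auto
        qed (use s0(1) s1(1) in simp)
      qed
      have mass_in: "(a, c, e + k) \<in> M\<^sub>1" if "free_final_mass M\<^sub>1" "(a, c, e) \<in> M\<^sub>1" for a c e k
        using that by (auto simp: free_final_mass_def)
      have lin_curve: "((\<lambda>s. ?x ?T + s *\<^sub>R d) has_vector_derivative d) (at 0 within {0..})" for d
        by (auto intro!: derivative_eq_intros)
      have cost_mass: "0 \<le> Gt * \<tau> + Gx (0, 0, k)"
        if "free_final_mass M\<^sub>1" "free_time \<or> \<tau> = 0" "0 < k + b * \<tau> \<or> \<not> ?full" for k \<tau>
        using that mass_in[OF that(1)] xT
        by (intro cost[OF lin_curve, of "(0, 0, k)" 1 \<tau>]) auto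
      have cost_time: "0 \<le> Gt * \<tau>" if "free_time" "0 < b * \<tau> \<or> \<not> ?full" for \<tau>
        using cost[OF lin_curve, of 0 1 \<tau>] that xT linear_0[OF linGx] by (auto simp: zero_prod_def)
      have Gxm: "Gx (0, 0, k) = k * Gx (0, 0, 1)" for k
        using linear_scale[OF linGx, of k "(0, 0, 1)"] by simp
      \<comment> \<open>Without full thrust every direction is available together with its opposite.
        The partial derivatives of the cost in the free variables then vanish, contrary to the
        assumption.\<close>
      have full: ?full
      proof (rule ccontr)
        assume nf: "\<not> ?full"
        have "Gx (0, 0, 1) = 0" if "free_final_mass M\<^sub>1"
          using cost_mass[OF that, of 0 1] cost_mass[OF that, of 0 "-1"] nf Gxm[of "-1"] by simp
        moreover have "Gt = 0" if "free_time"
          using cost_time[OF that, of 1] cost_time[OF that, of "-1"] nf by simp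
        ultimately show False using assms(9) dt dm by auto
      qed
      \<comment> \<open>Reachable directions satisfy \<delta>m + b \<delta>t > 0 strictly. Taking
        this excess to be k and letting k tend to 0 reaches the boundary.\<close>
      have eps: "0 \<le> A" if "\<And>k. 0 < k \<Longrightarrow> 0 \<le> A + k * B" for A B :: real
      proof (rule field_le_epsilon)
        fix e :: real assume "0 < e"
        then have "0 < e / (\<bar>B\<bar> + 1)" by (simp add: add_nonneg_pos)
        from that[OF this] have "0 \<le> A + e * (B / (\<bar>B\<bar> + 1))" by simp
        moreover have "e * (B / (\<bar>B\<bar> + 1)) \<le> e * 1"
          using \<open>0 < e\<close> by (intro mult_left_mono) (auto simp: divide_le_eq)
        ultimately show "0 \<le> A + e" by simp
      qed
      have time_mass: "Gt = b * Gx (0, 0, 1)" if ft: "free_time" and fm: "free_final_mass M\<^sub>1"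
      proof -
        \<comment> \<open>A change of time of either sign is offset by the mass change k - b \<tau>,
          which leaves the excess k.\<close>
        have "0 \<le> (Gt - b * Gx (0, 0, 1)) * \<tau>" for \<tau>
        proof (rule eps)
          fix k :: real assume "0 < k"
          then show "0 \<le> (Gt - b * Gx (0, 0, 1)) * \<tau> + k * Gx (0, 0, 1)"
            using cost_mass[OF fm, of \<tau> "k - b * \<tau>"] ft Gxm[of "k - b * \<tau>"] by (simp add: algebra_simps)
        qed
        from this[of 1] this[of "-1"] show ?thesis by simp
      qed
      have mass_pos: "0 \<le> Gx (0, 0, 1)" if fm: "free_final_mass M\<^sub>1" using cost_mass[OF fm, of 0 1] by simp
      have time_pos: "0 \<le> Gt" if ft: "free_time" using cost_time[OF ft, of 1] \<open>0 < b\<close> by simp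
      \<comment> \<open>The target is arbitrary, so its tangent set need not be a subspace.
        Reversing the curve provides opposites, which turns the later inequality into the equation
        of transversality.\<close>
      have rev: "- w \<in> tangent_space M\<^sub>1 (?x ?T)" if w: "w \<in> tangent_space M\<^sub>1 (?x ?T)" for w
      proof -
        obtain \<gamma> \<epsilon> where \<gamma>: "0 < \<epsilon>" "\<gamma> C1_differentiable_on {-\<epsilon><..<\<epsilon>}" "\<gamma> ` {-\<epsilon><..<\<epsilon>} \<subseteq> M\<^sub>1" "\<gamma> 0 = ?x ?T"
          "(\<gamma> has_vector_derivative w) (at 0)" using w unfolding tangent_space_def by blast
        have "(\<lambda>s. \<gamma> (- s)) C1_differentiable_on {-\<epsilon><..<\<epsilon>}"
        proof -
          obtain D\<gamma> where D\<gamma>: "\<forall>s\<in>{-\<epsilon><..<\<epsilon>}. (\<gamma> has_vector_derivative D\<gamma> s) (at s)" "continuous_on {-\<epsilon><..<\<epsilon>} D\<gamma>"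
            using \<gamma>(2) unfolding C1_differentiable_on_def by blast
          have "((\<lambda>s. \<gamma> (- s)) has_vector_derivative - D\<gamma> (- s)) (at s)" if "s \<in> {-\<epsilon><..<\<epsilon>}" for s
          proof -
            have "((\<gamma> \<circ> uminus) has_vector_derivative (-1) *\<^sub>R D\<gamma> (- s)) (at s)"
              using D\<gamma>(1) that by (intro vector_diff_chain_at) (auto intro!: derivative_eq_intros)
            then show ?thesis by (simp add: comp_def)
          qed
          moreover have "continuous_on {-\<epsilon><..<\<epsilon>} (\<lambda>s. - D\<gamma> (- s))"
            by (intro continuous_intros continuous_on_compose2[OF D\<gamma>(2)]) auto
          ultimately show ?thesis unfolding C1_differentiable_on_def by (intro exI[of _ "\<lambda>s. - D\<gamma> (- s)"]) auto
        qed
        moreover have "((\<gamma> \<circ> uminus) has_vector_derivative (-1) *\<^sub>R w) (at 0)"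
          using \<gamma>(5) by (intro vector_diff_chain_at) (auto intro!: derivative_eq_intros)
        then have "((\<lambda>s. \<gamma> (- s)) has_vector_derivative - w) (at 0)" by (simp add: comp_def)
        moreover have "(\<lambda>s. \<gamma> (- s)) ` {-\<epsilon><..<\<epsilon>} \<subseteq> M\<^sub>1" using \<gamma>(3) by (auto intro!: subsetD[OF \<gamma>(3)])
        ultimately show ?thesis
          unfolding tangent_space_def using \<gamma>(1,4) by (intro CollectI exI[of _ "\<lambda>s. \<gamma> (- s)"] exI[of _ \<epsilon>]) auto
      qed
      \<comment> \<open>A curve in the target, shifted linearly in the mass when the final mass is
        free, is combined with a change of the final time.\<close>
      have tangent_cost: "0 \<le> Gt * \<tau> + Gx (w + (0, 0, k))"
        if w: "w \<in> tangent_space M\<^sub>1 (?x ?T)" and k: "free_final_mass M\<^sub>1 \<or> k = 0"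
          and \<tau>: "free_time \<or> \<tau> = 0" and pos: "0 < snd (snd w) + k + b * \<tau>" for w k \<tau>
      proof -
        obtain \<gamma> \<epsilon> where \<gamma>: "0 < \<epsilon>" "\<gamma> ` {-\<epsilon><..<\<epsilon>} \<subseteq> M\<^sub>1" "\<gamma> 0 = ?x ?T"
          "(\<gamma> has_vector_derivative w) (at 0)" using w unfolding tangent_space_def by blast
        have "((\<lambda>s. s *\<^sub>R (0, 0, k)) has_vector_derivative (0, 0, k)) (at 0 within {0..})"
          by (auto intro!: derivative_eq_intros)
        then have curve: "((\<lambda>s. \<gamma> s + s *\<^sub>R (0, 0, k)) has_vector_derivative w + (0, 0, k)) (at 0 within {0..})"
          by (intro has_vector_derivative_add has_vector_derivative_at_within[OF \<gamma>(4)])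
        show ?thesis
        proof (rule cost[OF curve, of \<epsilon> \<tau>])
          fix s :: real assume "0 < s" "s < \<epsilon>"
          then have g: "\<gamma> s \<in> M\<^sub>1" using \<gamma>(2) by auto
          obtain a c e where "\<gamma> s = (a, c, e)" by (metis prod.exhaust)
          then show "\<gamma> s + s *\<^sub>R (0, 0, k) \<in> M\<^sub>1" using g k mass_in[of a c e "s * k"] by auto
        qed (use \<gamma> \<tau> pos in \<open>auto simp: zero_prod_def[symmetric]\<close>)
      qed
      \<comment> \<open>\<open>c\<close> is the rate of the cost per unit of the excess \<delta>m +
        b \<delta>t. It is read off from the mass derivative or from the time derivative, whichever
        is free and nonzero. In either case the mass component of \<open>w\<close> is compensated,
        by mass or by time, so that the excess k remains.\<close>
      obtain c where c: "0 < c" "free_time \<Longrightarrow> Gt = b * c" "free_final_mass M\<^sub>1 \<Longrightarrow> Gx (0, 0, 1) = c"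
        "\<And>w. w \<in> tangent_space M\<^sub>1 (?x ?T) \<Longrightarrow> 0 \<le> Gx w - c * snd (snd w)"
      proof -
        consider (mass) "free_final_mass M\<^sub>1" "Gx (0, 0, 1) \<noteq> 0" | (time) "free_time" "Gt \<noteq> 0"
          using assms(9) dt dm by auto
        then show thesis
        proof cases
          case mass
          show thesis
          proof (rule that[of "Gx (0, 0, 1)"])
            show "0 < Gx (0, 0, 1)" using mass_pos mass by simp
            fix w assume w: "w \<in> tangent_space M\<^sub>1 (?x ?T)"
            show "0 \<le> Gx w - Gx (0, 0, 1) * snd (snd w)"
            proof (rule eps)
              fix k :: real assume "0 < k"
              then show "0 \<le> Gx w - Gx (0, 0, 1) * snd (snd w) + k * Gx (0, 0, 1)"
                using tangent_cost[OF w, of "k - snd (snd w)" 0] mass Gxm[of "k - snd (snd w)"]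
                by (simp add: linear_add[OF linGx] algebra_simps)
            qed
          qed (use time_mass mass in auto)
        next
          case time
          show thesis
          proof (rule that[of "Gt / b"])
            show "0 < Gt / b" using time_pos time \<open>0 < b\<close> by simp
            show "Gt = b * (Gt / b)" using \<open>0 < b\<close> by simp
            show "Gx (0, 0, 1) = Gt / b" if "free_final_mass M\<^sub>1" using time_mass[OF time(1) that] \<open>0 < b\<close> by simp
            fix w assume w: "w \<in> tangent_space M\<^sub>1 (?x ?T)"
            show "0 \<le> Gx w - Gt / b * snd (snd w)"
            proof (rule eps)
              fix k :: real assume k: "0 < k"
              have "0 \<le> Gt * ((k - snd (snd w)) / b) + Gx (w + (0, 0, 0))"
                using time(1) k \<open>0 < b\<close> by (intro tangent_cost[OF w]) auto
              moreover have "w + (0, 0, 0) = w" by (cases w) simp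
              ultimately show "0 \<le> Gx w - Gt / b * snd (snd w) + k * (Gt / b)"
                by (simp add: diff_divide_distrib algebra_simps)
            qed
          qed
        qed
      qed
      have "pmp_extremal D g b C M\<^sub>1 free_time g0 ?T u ?x (\<lambda>t. (0, 0, - c)) (- 1)"
      proof (rule degenerate_pmp_extremal[OF \<open>0 < b\<close> c(1)])
        show "AE t in lebesgue_on {0..?T}. norm (u t) = 1" using full by (simp add: AE_lebesgue_on_iff_negligible)
        show "deriv (\<lambda>s. g0 s (?x ?T)) ?T = b * c" if "free_time" using dt c(2)[OF that] by simp
        show "gradient (g0 ?T) (?x ?T) \<bullet> w = c * snd (snd w)" if w: "w \<in> tangent_space M\<^sub>1 (?x ?T)" for w
          using c(4)[OF w] c(4)[OF rev[OF w]] linear_neg[OF linGx, of w] by (simp add: grad)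
        show "snd (snd (gradient (g0 ?T) (?x ?T))) = c" if "free_final_mass M\<^sub>1"
          using grad[of "(0, 0, 1)"] c(3)[OF that] by (cases "gradient (g0 ?T) (?x ?T)") (simp add: inner_Pair)
      qed
      from nondegenerate[OF this] show ?thesis by simp
    qed
  qed
qed

end
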